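(* Let $\Omega\subset\mathbb{R}^2$ be a bounded convex polygonal domain, $T>0$, $\lambda$ a constant, $u_0\in L^2(\Omega)$ an initial datum, and $f,k:\mathbb{R}\to\mathbb{R}$. Let $u$ be the solution of $$\frac{\partial u}{\partial t}-\nabla\cdot(k(u)\nabla u)=\lambda\frac{f(u)}{\left(\int_\Omega f(u)\,dx\right)^2}\ \text{in } \Omega\times(0,T),\qquad u=0\ \text{on }\partial\Omega\times(0,T),\qquad u|_{t=0}=u_0\ \text{in }\Omega .$$ Assume: (i) $u\in L^\infty(0,T;H_0^1(\Omega)\cap H^2(\Omega))$ and $u_t\in L^2(0,T;H^1(\Omega))$; (ii) there is a constant $c>0$ with $c^{-1}\le k(s)\le c$ for all $s\in\mathbb{R}$; (iii) there are positive constants $c_1,c_2,\nu$ with $\nu\le f(\xi)\le c_1|\xi|+c_2$ for all $\xi\in\mathbb{R}$; (iv) there is a constant $c>0$ with $|f(\xi)-f(\xi')|+|k(\xi)-k(\xi')|\le c|\xi-\xi'|$ for all $\xi,\xi'\in\mathbb{R}$. Then for each $h>0$ there exists $t_0(h)>0$ such that there is a unique $u^h$, with $u^h(t)\in S_h^0$ for $0\le t\le t_0(h)$, satisfying $u^h(0)=P_hu_0$ and, for $0\le t\le t_0(h)$, $$\big(I_hu^h_t,I_hv\big)-\sum_{b\in B_h}\int_{\partial b}k(u^h)\frac{\partial u^h}{\partial n}I_hv=\frac{\lambda}{\left(\int_\Omega f(u^h)\,dx\right)^2}\big(f(u^h),I_hv\big)\qquad\forall\, v\in S_h^0 .$$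
   Context: Notation. $(\cdot,\cdot)$ and $\|\cdot\|$ are the inner product and norm of $L^2(\Omega)$; $\|\cdot\|_s$ and $\|\cdot\|_{s,p}$ are the norms of $H^s(\Omega)$ and $W^{s,p}(\Omega)$. The subscript $t$ denotes the time derivative; $\nabla$ is the gradient in $x$. Meshes. $\{T_h\}_{h>0}$ is a family of quasi-uniform triangulations of $\Omega$ with mesh size $h$; $T_v^h$ is the set of vertices of $T_h$. The finite element space is $$S_h^0=\{v\in H_0^1(\Omega): v|_e \text{ is a linear (affine) function for all } e\in T_h\}.$$ It is assumed that the triangulations are such that, with $c$ independent of $h$, for all $v\in S_h^0$: $\|v\|_{\beta,q}\le c\,h^{r-\beta-2\max\{0,1/p-1/q\}}\|v\|_{r,p}$ for $0\le r\le\beta\le1$, $1\le p,q\le\infty$, and $\|v\|_{0,\infty}\le c|\ln h|^{1/2}\|v\|_1$. $P_h:L^2(\Omega)\to S_h^0$ is the $L^2(\Omega)$-orthogonal projection. Dual mesh (boxes). For each triangle $e\in T_h$ let $q$ be the intersection point of the perpendicular bisectors of the three edges of $e$; it is assumed that $q\in\overline e$. Join $q$ by straight segments to the midpoints of the edges of $e$; this divides $e$ into subregions, each having one vertex of $e$ as a corner. For each vertex $p\in T_v^h$ the box $b_p$ is the union of all the subregions (over all triangles) that have $p$ as a corner. $B_h=\{b_p:p\in T_v^h\}$ is the dual mesh. On $\partial b$, $b\in B_h$, $n$ denotes the unit outward normal to $b$. Interpolation. $I_h:\mathcal{C}(\Omega)\to L^2(\Omega)$ is the piecewise constant interpolation: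 $I_hv=v(p)$ on $b_p$ for every $p\in T_v^h$. In the integral over $\partial b_p$, $I_hv$ is the constant value $v(p)$ it takes on the box $b_p$ (so boxes of boundary vertices contribute zero when $v\in S_h^0$). *)

theory Defs
  imports "HOL-Analysis.Analysis" "HOL-Probability.Essential_Supremum"
begin

section \<open>Lebesgue and Sobolev spaces on an open set\<close>

text \<open>
  Elements of function spaces over \<open>\<Omega>\<close> are represented by functions on the whole ambient space;
  only their values on \<open>\<Omega>\<close> (for the finite element space below: on \<open>closure \<Omega>\<close>) matter.
\<close>

definition Lp_space :: "ereal \<Rightarrow> 'a::euclidean_space set \<Rightarrow> ('a \<Rightarrow> real) set" where
  "Lp_space p \<Omega> = {v \<in> borel_measurable (lebesgue_on \<Omega>).
     if p = \<infinity> then \<exists>C. AE x in lebesgue_on \<Omega>. \<bar>v x\<bar> \<le> C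
     else integrable (lebesgue_on \<Omega>) (\<lambda>x. \<bar>v x\<bar> powr real_of_ereal p)}"

definition Lp_norm :: "ereal \<Rightarrow> 'a::euclidean_space set \<Rightarrow> ('a \<Rightarrow> real) \<Rightarrow> real" where
  "Lp_norm p \<Omega> v =
     (if p = \<infinity> then real_of_ereal (esssup (lebesgue_on \<Omega>) (\<lambda>x. ereal \<bar>v x\<bar>))
      else (\<integral>x. \<bar>v x\<bar> powr real_of_ereal p \<partial>lebesgue_on \<Omega>) powr (1 / real_of_ereal p))"

definition L2_inner :: "'a::euclidean_space set \<Rightarrow> ('a \<Rightarrow> real) \<Rightarrow> ('a \<Rightarrow> real) \<Rightarrow> real" where
  "L2_inner \<Omega> v w = (\<integral>x. v x * w x \<partial>lebesgue_on \<Omega>)"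

definition locally_integrable ::
    "'a::euclidean_space set \<Rightarrow> ('a \<Rightarrow> 'b::{banach, second_countable_topology}) \<Rightarrow> bool" where
  "locally_integrable \<Omega> v \<longleftrightarrow> (\<forall>K. compact K \<and> K \<subseteq> \<Omega> \<longrightarrow> integrable (lebesgue_on K) v)"

primrec continuously_differentiable :: "nat \<Rightarrow> ('a::euclidean_space \<Rightarrow> real) \<Rightarrow> bool" where
  "continuously_differentiable 0 \<phi> \<longleftrightarrow> continuous_on UNIV \<phi>"
| "continuously_differentiable (Suc n) \<phi> \<longleftrightarrow>
     (\<forall>x. \<phi> differentiable at x) \<and>
     (\<forall>i\<in>Basis. continuously_differentiable n (\<lambda>x. frechet_derivative \<phi> (at x) i))"

definition test_functions :: "'a::euclidean_space set \<Rightarrow> ('a \<Rightarrow> real) set" where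
  "test_functions \<Omega> = {\<phi>. (\<forall>n. continuously_differentiable n \<phi>) \<and>
     compact (closure {x. \<phi> x \<noteq> 0}) \<and> closure {x. \<phi> x \<noteq> 0} \<subseteq> \<Omega>}"

definition has_weak_gradient ::
    "'a::euclidean_space set \<Rightarrow> ('a \<Rightarrow> real) \<Rightarrow> ('a \<Rightarrow> 'a) \<Rightarrow> bool" where
  "has_weak_gradient \<Omega> v g \<longleftrightarrow> locally_integrable \<Omega> v \<and> locally_integrable \<Omega> g \<and>
     (\<forall>\<phi>\<in>test_functions \<Omega>. \<forall>i\<in>Basis.
        L2_inner \<Omega> v (\<lambda>x. frechet_derivative \<phi> (at x) i) = - L2_inner \<Omega> (\<lambda>x. g x \<bullet> i) \<phi>)"

definition weak_gradient :: "'a::euclidean_space set \<Rightarrow> ('a \<Rightarrow> real) \<Rightarrow> 'a \<Rightarrow> 'a" where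
  "weak_gradient \<Omega> v = (SOME g. has_weak_gradient \<Omega> v g)"

text \<open>In the next definition \<open>frechet_derivative \<phi> (at x) (F x)\<close> is \<open>F x \<bullet> \<nabla>\<phi> x\<close>.\<close>

definition has_weak_divergence ::
    "'a::euclidean_space set \<Rightarrow> ('a \<Rightarrow> 'a) \<Rightarrow> ('a \<Rightarrow> real) \<Rightarrow> bool" where
  "has_weak_divergence \<Omega> F d \<longleftrightarrow> locally_integrable \<Omega> F \<and> locally_integrable \<Omega> d \<and>
     (\<forall>\<phi>\<in>test_functions \<Omega>.
        (\<integral>x. frechet_derivative \<phi> (at x) (F x) \<partial>lebesgue_on \<Omega>) = - L2_inner \<Omega> d \<phi>)"

primrec sobolev_space :: "nat \<Rightarrow> ereal \<Rightarrow> 'a::euclidean_space set \<Rightarrow> ('a \<Rightarrow> real) set" where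
  "sobolev_space 0 p \<Omega> = Lp_space p \<Omega>"
| "sobolev_space (Suc m) p \<Omega> = {v \<in> Lp_space p \<Omega>.
     \<exists>g. has_weak_gradient \<Omega> v g \<and> (\<forall>i\<in>Basis. (\<lambda>x. g x \<bullet> i) \<in> sobolev_space m p \<Omega>)}"

text \<open>
  For \<open>m \<le> 1\<close> this is the usual norm of \<open>W\<^sup>m\<^sup>,\<^sup>p\<close>; for \<open>m \<ge> 2\<close> mixed derivatives are counted once for
  every order of differentiation, which gives an equivalent norm.
\<close>

primrec sobolev_norm :: "nat \<Rightarrow> ereal \<Rightarrow> 'a::euclidean_space set \<Rightarrow> ('a \<Rightarrow> real) \<Rightarrow> real" where
  "sobolev_norm 0 p \<Omega> v = Lp_norm p \<Omega> v"
| "sobolev_norm (Suc m) p \<Omega> v =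
     (if p = \<infinity>
      then Max (insert (Lp_norm p \<Omega> v)
             ((\<lambda>i. sobolev_norm m p \<Omega> (\<lambda>x. weak_gradient \<Omega> v x \<bullet> i)) ` Basis))
      else (Lp_norm p \<Omega> v powr real_of_ereal p +
            (\<Sum>i\<in>Basis. sobolev_norm m p \<Omega> (\<lambda>x. weak_gradient \<Omega> v x \<bullet> i) powr real_of_ereal p))
           powr (1 / real_of_ereal p))"

text \<open>
  \<open>H\<^sub>0\<^sup>1\<close> is the closure of the test functions in \<open>H\<^sup>1\<close>; convergence in \<open>H\<^sup>1\<close> is written out as
  \<open>L\<^sup>2\<close>-convergence of the functions and of all first derivatives.
\<close>

definition H10_space :: "'a::euclidean_space set \<Rightarrow> ('a \<Rightarrow> real) set" where
  "H10_space \<Omega> = {v \<in> Lp_space 2 \<Omega>. \<exists>g. has_weak_gradient \<Omega> v g \<and>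
     (\<forall>i\<in>Basis. (\<lambda>x. g x \<bullet> i) \<in> Lp_space 2 \<Omega>) \<and>
     (\<exists>\<phi>. (\<forall>n. \<phi> n \<in> test_functions \<Omega>) \<and>
        (\<lambda>n::nat. Lp_norm 2 \<Omega> (\<lambda>x. \<phi> n x - v x)) \<longlonglongrightarrow> 0 \<and>
        (\<forall>i\<in>Basis.
           (\<lambda>n. Lp_norm 2 \<Omega> (\<lambda>x. frechet_derivative (\<phi> n) (at x) i - g x \<bullet> i)) \<longlonglongrightarrow> 0))}"


section \<open>Functions of time with values in a function space\<close>

text \<open>
  In the following, \<open>X\<close> is the value space with norm \<open>N\<close>. Strong (Bochner) measurability is
  approximability almost everywhere by simple functions.
\<close>

definition strongly_measurable ::
    "real set \<Rightarrow> ('a \<Rightarrow> real) set \<Rightarrow> (('a \<Rightarrow> real) \<Rightarrow> real) \<Rightarrow> (real \<Rightarrow> 'a \<Rightarrow> real) \<Rightarrow> bool" where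
  "strongly_measurable J X N u \<longleftrightarrow>
     (\<exists>s :: nat \<Rightarrow> real \<Rightarrow> 'a \<Rightarrow> real.
        (\<forall>n. finite (s n ` J) \<and> s n ` J \<subseteq> X \<and> (\<forall>y. {t \<in> J. s n t = y} \<in> sets lebesgue)) \<and>
        (AE t in lebesgue_on J. (\<lambda>n. N (\<lambda>x. s n t x - u t x)) \<longlonglongrightarrow> 0))"

definition bochner_space ::
    "ereal \<Rightarrow> real set \<Rightarrow> ('a \<Rightarrow> real) set \<Rightarrow> (('a \<Rightarrow> real) \<Rightarrow> real) \<Rightarrow> (real \<Rightarrow> 'a \<Rightarrow> real) set" where
  "bochner_space p J X N = {u. (AE t in lebesgue_on J. u t \<in> X) \<and>
     strongly_measurable J X N u \<and> (\<lambda>t. N (u t)) \<in> Lp_space p J}"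

text \<open>
  The weak time derivative, as an identity of \<open>L\<^sup>2(\<Omega>)\<close>-valued integrals tested with every element
  of \<open>L\<^sup>2(\<Omega>)\<close>. On the real line the weak gradient is the weak derivative.
\<close>

definition has_weak_time_derivative ::
    "'a::euclidean_space set \<Rightarrow> real \<Rightarrow> (real \<Rightarrow> 'a \<Rightarrow> real) \<Rightarrow> (real \<Rightarrow> 'a \<Rightarrow> real) \<Rightarrow> bool" where
  "has_weak_time_derivative \<Omega> T u w \<longleftrightarrow> (\<forall>\<psi>\<in>Lp_space 2 \<Omega>.
     has_weak_gradient {0<..<T} (\<lambda>t. L2_inner \<Omega> (u t) \<psi>) (\<lambda>t. L2_inner \<Omega> (w t) \<psi>))"

text \<open>
  As \<open>u\<close> is determined only for almost every time, the initial value is the essential limit of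
  \<open>u t\<close> in \<open>L\<^sup>2(\<Omega>)\<close> as \<open>t\<close> decreases to \<open>0\<close>.
\<close>

definition attains_initial_value ::
    "'a::euclidean_space set \<Rightarrow> (real \<Rightarrow> 'a \<Rightarrow> real) \<Rightarrow> ('a \<Rightarrow> real) \<Rightarrow> bool" where
  "attains_initial_value \<Omega> u u0 \<longleftrightarrow> (\<forall>\<epsilon>>0. \<exists>\<delta>>0.
     AE t in lebesgue_on {0<..<\<delta>}. Lp_norm 2 \<Omega> (\<lambda>x. u t x - u0 x) < \<epsilon>)"

text \<open>
  The nonlocal parabolic problem; \<open>ut\<close> is the time derivative of \<open>u\<close>. The differential equation
  is read as: for almost every \<open>t\<close>, the weak divergence of \<open>k(u) \<nabla>u\<close> in \<open>\<Omega>\<close> is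
  \<open>u\<^sub>t - lam f(u) / (\<integral> f(u))\<^sup>2\<close>.
\<close>

definition nonlocal_parabolic_solution ::
    "'a::euclidean_space set \<Rightarrow> real \<Rightarrow> real \<Rightarrow> (real \<Rightarrow> real) \<Rightarrow> (real \<Rightarrow> real) \<Rightarrow> ('a \<Rightarrow> real) \<Rightarrow>
     (real \<Rightarrow> 'a \<Rightarrow> real) \<Rightarrow> (real \<Rightarrow> 'a \<Rightarrow> real) \<Rightarrow> bool" where
  "nonlocal_parabolic_solution \<Omega> T lam f k u0 u ut \<longleftrightarrow>
     has_weak_time_derivative \<Omega> T u ut \<and>
     (AE t in lebesgue_on {0<..<T}.
        has_weak_gradient \<Omega> (u t) (weak_gradient \<Omega> (u t)) \<and>
        has_weak_divergence \<Omega> (\<lambda>x. k (u t x) *\<^sub>R weak_gradient \<Omega> (u t) x)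
          (\<lambda>x. ut t x - lam * (f (u t x) / (\<integral>y. f (u t y) \<partial>lebesgue_on \<Omega>)\<^sup>2))) \<and>
     (AE t in lebesgue_on {0<..<T}. u t \<in> H10_space \<Omega>) \<and>
     attains_initial_value \<Omega> u u0"


section \<open>Triangulations and linear finite elements\<close>

definition convex_polygonal_domain :: "(real^2) set \<Rightarrow> bool" where
  "convex_polygonal_domain \<Omega> \<longleftrightarrow>
     \<Omega> \<noteq> {} \<and> open \<Omega> \<and> bounded \<Omega> \<and> convex \<Omega> \<and> polytope (closure \<Omega>)"

definition triangulation_of :: "(real^2) set \<Rightarrow> (real^2) set set \<Rightarrow> bool" where
  "triangulation_of \<Omega> M \<longleftrightarrow> triangulation M \<and> (\<forall>e\<in>M. 2 simplex e) \<and> \<Union>M = closure \<Omega>"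

definition mesh_vertices :: "(real^2) set set \<Rightarrow> (real^2) set" where
  "mesh_vertices M = {p. \<exists>e\<in>M. p extreme_point_of e}"

definition quasi_uniform_family ::
    "(real^2) set \<Rightarrow> real set \<Rightarrow> (real \<Rightarrow> (real^2) set set) \<Rightarrow> bool" where
  "quasi_uniform_family \<Omega> H M \<longleftrightarrow>
     (\<forall>h\<in>H. h > 0 \<and> triangulation_of \<Omega> (M h) \<and> h = Max (diameter ` M h)) \<and>
     (\<exists>c>0. \<forall>h\<in>H. \<forall>e\<in>M h. \<exists>x. ball x (c * h) \<subseteq> e)"

text \<open>
  The triangles are closed, so a function that is affine on each of them is continuous on
  \<open>closure \<Omega>\<close>: the continuous representative is built into this definition.
\<close>

definition fe_space :: "(real^2) set \<Rightarrow> (real^2) set set \<Rightarrow> (real^2 \<Rightarrow> real) set" where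
  "fe_space \<Omega> M = {v \<in> H10_space \<Omega>. \<forall>e\<in>M. \<exists>a c. \<forall>x\<in>e. v x = a \<bullet> x + c}"

definition inverse_estimates ::
    "(real^2) set \<Rightarrow> real set \<Rightarrow> (real \<Rightarrow> (real^2) set set) \<Rightarrow> bool" where
  "inverse_estimates \<Omega> H M \<longleftrightarrow>
     (\<forall>(r::nat) (\<beta>::nat) (p::ereal) (q::ereal). r \<le> \<beta> \<and> \<beta> \<le> 1 \<and> 1 \<le> p \<and> 1 \<le> q \<longrightarrow>
        (\<exists>c>0. \<forall>h\<in>H. \<forall>v\<in>fe_space \<Omega> (M h).
           sobolev_norm \<beta> q \<Omega> v \<le>
             c * h powr (real r - real \<beta> - 2 * max 0 (real_of_ereal (1 / p) - real_of_ereal (1 / q)))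
               * sobolev_norm r p \<Omega> v)) \<and>
     (\<exists>c>0. \<forall>h\<in>H. \<forall>v\<in>fe_space \<Omega> (M h).
        sobolev_norm 0 \<infinity> \<Omega> v \<le> c * \<bar>ln h\<bar> powr (1 / 2) * sobolev_norm 1 2 \<Omega> v)"

definition is_L2_projection ::
    "'a::euclidean_space set \<Rightarrow> ('a \<Rightarrow> real) set \<Rightarrow> ('a \<Rightarrow> real) \<Rightarrow> ('a \<Rightarrow> real) \<Rightarrow> bool" where
  "is_L2_projection \<Omega> S w Pw \<longleftrightarrow> Pw \<in> S \<and> (\<forall>v\<in>S. L2_inner \<Omega> Pw v = L2_inner \<Omega> w v)"


section \<open>The dual mesh\<close>

definition circumcenter :: "(real^2) set \<Rightarrow> real^2" where
  "circumcenter e = (THE q. \<forall>p p'. p extreme_point_of e \<and> p' extreme_point_of e \<longrightarrow>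
     (q - midpoint p p') \<bullet> (p' - p) = 0)"

definition circumcenters_inside :: "(real^2) set set \<Rightarrow> bool" where
  "circumcenters_inside M \<longleftrightarrow> (\<forall>e\<in>M. circumcenter e \<in> e)"

text \<open>
  The subregion of \<open>e\<close> with corner \<open>p\<close> is the convex quadrilateral with vertices \<open>p\<close>, the midpoints
  of the two edges of \<open>e\<close> at \<open>p\<close>, and the circumcenter. (The case \<open>p' = p\<close> contributes \<open>p\<close>.)
\<close>

definition subregion :: "(real^2) set \<Rightarrow> real^2 \<Rightarrow> (real^2) set" where
  "subregion e p = convex hull (insert (circumcenter e) {midpoint p p' |p'. p' extreme_point_of e})"

definition dual_box :: "(real^2) set set \<Rightarrow> real^2 \<Rightarrow> (real^2) set" where
  "dual_box M p = (\<Union>e\<in>{e\<in>M. p extreme_point_of e}. subregion e p)"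

text \<open>Two boxes overlap only in a null set, where the value below is irrelevant.\<close>

definition box_interpolation :: "(real^2) set set \<Rightarrow> (real^2 \<Rightarrow> real) \<Rightarrow> real^2 \<Rightarrow> real" where
  "box_interpolation M v x = (\<Sum>p\<in>mesh_vertices M. v p * indicator (dual_box M p) x)"

text \<open>
  \<open>n\<close> is the outward unit normal to \<open>b\<close> at \<open>x\<close> if near \<open>x\<close> the set \<open>b\<close> is the half-plane with
  outward unit normal \<open>n\<close>. For a polygon this determines \<open>n\<close> at all boundary points other than the
  corners; there the value is set to \<open>0\<close>.
\<close>

definition is_outward_normal :: "(real^2) set \<Rightarrow> real^2 \<Rightarrow> real^2 \<Rightarrow> bool" where
  "is_outward_normal b x n \<longleftrightarrow>
     norm n = 1 \<and> (\<exists>\<epsilon>>0. \<forall>y\<in>ball x \<epsilon>. y \<in> b \<longleftrightarrow> (y - x) \<bullet> n \<le> 0)"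

definition outward_normal :: "(real^2) set \<Rightarrow> real^2 \<Rightarrow> real^2" where
  "outward_normal b x =
     (if \<exists>n. is_outward_normal b x n then THE n. is_outward_normal b x n else 0)"

text \<open>
  The normal derivative is taken from inside \<open>b\<close>, so that it also makes sense on the part of the
  boundary of a box that lies on the boundary of the domain.
\<close>

definition normal_derivative :: "(real^2) set \<Rightarrow> (real^2 \<Rightarrow> real) \<Rightarrow> real^2 \<Rightarrow> real" where
  "normal_derivative b u x = vector_derivative (\<lambda>s. u (x + s *\<^sub>R outward_normal b x)) (at_left 0)"

text \<open>
  The arc length integral over the boundary of the box of \<open>p\<close>. The boundary is covered by the sides
  of the subregions with corner \<open>p\<close>, each given here by its two end points; sides common to two
  subregions occur only once in this set, and the indicator function removes those sides which lie
  inside the box.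
\<close>

definition subregion_sides :: "(real^2) set set \<Rightarrow> real^2 \<Rightarrow> ((real^2) \<times> (real^2)) set" where
  "subregion_sides M p =
     {(p, midpoint p p') |e p'. e \<in> M \<and> p extreme_point_of e \<and> p' extreme_point_of e \<and> p' \<noteq> p} \<union>
     {(midpoint p p', circumcenter e) |e p'.
        e \<in> M \<and> p extreme_point_of e \<and> p' extreme_point_of e \<and> p' \<noteq> p}"

definition box_boundary_integral ::
    "(real^2) set set \<Rightarrow> real^2 \<Rightarrow> (real^2 \<Rightarrow> real) \<Rightarrow> real" where
  "box_boundary_integral M p g = (\<Sum>(a, c)\<in>subregion_sides M p.
     dist a c * (\<integral>s. indicator (frontier (dual_box M p)) (a + s *\<^sub>R (c - a)) * g (a + s *\<^sub>R (c - a))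
                   \<partial>lebesgue_on {0..1}))"


section \<open>The finite volume element scheme\<close>

text \<open>
  \<open>uh\<close> solves the semidiscrete problem on \<open>[0, t0]\<close>. The time derivative \<open>uht\<close> is taken pointwise
  on \<open>closure \<Omega>\<close>, which is the derivative in the finite dimensional space \<open>fe_space \<Omega> M\<close>; it is
  one-sided at the end points of the time interval.
\<close>

definition fve_solution ::
    "(real^2) set \<Rightarrow> (real^2) set set \<Rightarrow> real \<Rightarrow> (real \<Rightarrow> real) \<Rightarrow> (real \<Rightarrow> real) \<Rightarrow>
     (real^2 \<Rightarrow> real) \<Rightarrow> real \<Rightarrow> (real \<Rightarrow> real^2 \<Rightarrow> real) \<Rightarrow> bool" where
  "fve_solution \<Omega> M lam f k u0 t0 uh \<longleftrightarrow>
     (\<forall>t\<in>{0..t0}. uh t \<in> fe_space \<Omega> M) \<and>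
     is_L2_projection \<Omega> (fe_space \<Omega> M) u0 (uh 0) \<and>
     (\<exists>uht.
        (\<forall>t\<in>{0..t0}. \<forall>x\<in>closure \<Omega>.
           ((\<lambda>s. uh s x) has_real_derivative uht t x) (at t within {0..t0})) \<and>
        (\<forall>t\<in>{0..t0}. \<forall>v\<in>fe_space \<Omega> M.
           L2_inner \<Omega> (box_interpolation M (uht t)) (box_interpolation M v)
           - (\<Sum>p\<in>mesh_vertices M.
                box_boundary_integral M p
                  (\<lambda>x. k (uh t x) * normal_derivative (dual_box M p) (uh t) x * v p))
           = lam / (\<integral>x. f (uh t x) \<partial>lebesgue_on \<Omega>)\<^sup>2
             * L2_inner \<Omega> (\<lambda>x. f (uh t x)) (box_interpolation M v)))"

end

theory Submission
  imports Defs "HOL-Probability.Discrete_Topology"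
begin

text \<open>
  A finite element function is determined on \<open>closure \<Omega>\<close> by its nodal values, so the scheme is a system
  of ordinary differential equations. The form \<open>(I\<^sub>h v, I\<^sub>h w)\<close> is positive definite in the nodal values,
  because a vertex \<open>p\<close> lies in no box but its own and hence \<open>I\<^sub>h v = v p\<close> on a nonempty open set near \<open>p\<close>.
  In coordinates with respect to a basis \<open>\<phi>\<^sub>i\<close> that is orthonormal for this form, the scheme reads
  \<open>c\<^sub>i' = G\<^sub>i(c)\<close>. Normal derivatives of piecewise affine functions are bounded and linear in \<open>c\<close>, and
  \<open>\<integral> f(u)\<close> is bounded below by \<open>\<nu> |\<Omega>|\<close>; together with the Lipschitz continuity of \<open>f\<close> and \<open>k\<close> this
  makes \<open>G\<close> locally Lipschitz. The Picard-Lindeloef theorem gives existence and a Gronwall argument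
  uniqueness.
\<close>

section \<open>Local existence and uniqueness for ordinary differential equations\<close>

text \<open>Functions live on the whole plane and only their values on the closed domain count, so
  \<open>fe_space\<close> is infinite dimensional as a set. Everything is therefore reduced to nodal
  values, and uniqueness is stated on \<open>closure \<Omega>\<close>. With hat functions one would
  have to prove membership in H_0^1 and to decide which nodal vectors occur. A maximal orthonormal
  family for the lumped form supplies coordinates instead, and asks of H_0^1 only that it is a
  linear space; the same device with the L2 product yields P_h. The boundary integrals are the
  delicate term: the gradient jumps across edges, the normal has a default value at corners, and the
  integrals are Lebesgue integrals, so measurability of the normal derivative along a box boundary
  has to be proved before differences of integrals can be estimated. Since k(u) multiplies a
  gradient that is linear in c, this term is controlled on bounded sets of coefficients only; hence
  a short time interval whose length may depend on the mesh.\<close>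

lemma picard_lindeloef:
  fixes F :: "'a::banach \<Rightarrow> 'a"
  assumes r: "r > 0" and L: "L-lipschitz_on (cball x0 r) F"
  obtains t0 g where "t0 > 0" "g 0 = x0"
    "\<And>t. t \<in> {0..t0} \<Longrightarrow> (g has_vector_derivative F (g t)) (at t within {0..t0})"
proof -
  have L0: "0 \<le> L" using L by (rule lipschitz_on_nonneg)
  define B where "B = norm (F x0) + L * r"
  have B0: "0 \<le> B" using L0 r by (simp add: B_def)
  have B: "norm (F x) \<le> B" if "x \<in> cball x0 r" for x
  proof -
    have "dist (F x) (F x0) \<le> L * dist x x0"
      using lipschitz_onD[OF L that] r by simp
    also have "\<dots> \<le> L * r" using that L0 by (intro mult_left_mono) (auto simp: dist_commute)
    finally show ?thesis
      unfolding B_def dist_norm using norm_triangle_sub[of "F x" "F x0"] by linarith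
  qed
  \<comment> \<open>The first bound gives B * t0 \<le> r, which keeps the Picard iterates in the
    ball; the second makes the contraction factor L * t0 at most 1/2. The summands 1 guard against B
    = 0 and L = 0.\<close>
  define t0 where "t0 = min (r / (B + 1)) (1 / (2 * (L + 1)))"
  have t0: "t0 > 0" using r B0 L0 by (auto simp: t0_def)
  have "t0 \<le> r / (B + 1)" by (simp add: t0_def)
  then have t0B: "B * t0 \<le> r"
    using B0 t0 by (simp add: field_simps)
  have "t0 \<le> 1 / (2 * (L + 1))" by (simp add: t0_def)
  then have t0L: "L * t0 \<le> 1/2"
    using L0 t0 by (simp add: field_simps)
  \<comment> \<open>Bounded continuous functions on the whole line form a complete space. Clamping
    time to [0, t0] makes the integral operator act on them.\<close>
  define cl where "cl t = max 0 (min t0 t)" for t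
  have cl: "0 \<le> cl t" "cl t \<le> t0" for t using t0 by (auto simp: cl_def)
  define S where "S = PiC (UNIV :: real set) (\<lambda>_. cball x0 r)"
  have SD: "apply_bcontfun g t \<in> cball x0 r" if "g \<in> S" for g t
    using that by (auto simp: S_def mem_PiC_iff Pi_iff)
  have cont: "continuous_on X (\<lambda>s. F (apply_bcontfun g s))" if "g \<in> S" for g X
    by (rule continuous_on_compose2[OF lipschitz_on_continuous_on[OF L]]) (use SD[OF that] in auto)
  define J where "J g t = x0 + integral {0..cl t} (\<lambda>s. F (apply_bcontfun g s))" for g t
  have J_ball: "J g t \<in> cball x0 r" if "g \<in> S" for g t
  proof -
    have "norm (integral {0..cl t} (\<lambda>s. F (apply_bcontfun g s))) \<le> B * (cl t - 0)"
      by (rule integral_bound) (use cl cont[OF that] B SD[OF that] in auto)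
    also have "\<dots> \<le> r" using mult_left_mono[OF cl(2) B0, of t] t0B by simp
    finally show ?thesis by (simp add: J_def dist_norm)
  qed
  have J_cont: "continuous_on UNIV (J g)" if "g \<in> S" for g
  proof -
    have "continuous_on {0..t0} (\<lambda>x. integral {0..x} (\<lambda>s. F (apply_bcontfun g s)))"
      by (intro indefinite_integral_continuous_1 integrable_continuous_real cont that)
    moreover have "continuous_on UNIV cl" unfolding cl_def by (intro continuous_intros)
    ultimately have "continuous_on UNIV (\<lambda>t. integral {0..cl t} (\<lambda>s. F (apply_bcontfun g s)))"
      by (rule continuous_on_compose2) (use cl in auto)
    then show ?thesis unfolding J_def by (intro continuous_intros)
  qed
  have J_bc: "J g \<in> bcontfun" if "g \<in> S" for g
  proof -
    have "range (J g) \<subseteq> cball x0 r" using J_ball[OF that] by auto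
    then show ?thesis
      using J_cont[OF that] bounded_subset[OF bounded_cball] by (auto simp: bcontfun_def)
  qed
  have app: "apply_bcontfun (Bcontfun (J g)) = J g" if "g \<in> S" for g
    using J_bc[OF that] by (simp add: Bcontfun_inverse)
  have "\<exists>!g\<in>S. Bcontfun (J g) = g"
  proof (rule Banach_fix[of _ "1/2"])
    show "complete S"
      unfolding S_def complete_eq_closed by (intro closed_PiC) auto
    show "S \<noteq> {}"
    proof -
      have "const_bcontfun x0 \<in> S" using r by (auto simp: S_def mem_PiC_iff)
      then show ?thesis by auto
    qed
    show "(\<lambda>g. Bcontfun (J g)) ` S \<subseteq> S"
    proof clarify
      fix g assume "g \<in> S"
      then show "Bcontfun (J g) \<in> S"
        using J_ball[OF \<open>g \<in> S\<close>] app[OF \<open>g \<in> S\<close>] by (simp add: S_def mem_PiC_iff)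
    qed
    show "dist (Bcontfun (J g)) (Bcontfun (J h)) \<le> 1/2 * dist g h" if "g \<in> S" "h \<in> S" for g h
    proof (rule dist_bound)
      fix t
      have "dist (J g t) (J h t)
          = norm (integral {0..cl t} (\<lambda>s. F (apply_bcontfun g s) - F (apply_bcontfun h s)))"
        using that by (simp add: J_def dist_norm integral_diff integrable_continuous_real cont)
      also have "\<dots> \<le> (L * dist g h) * (cl t - 0)"
      proof (rule integral_bound)
        show "continuous_on {0..cl t} (\<lambda>s. F (apply_bcontfun g s) - F (apply_bcontfun h s))"
          by (intro continuous_intros cont that)
        fix s
        have "norm (F (apply_bcontfun g s) - F (apply_bcontfun h s)) \<le>
            L * dist (apply_bcontfun g s) (apply_bcontfun h s)"
          using lipschitz_onD[OF L SD SD, OF that] by (simp add: dist_norm)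
        also have "\<dots> \<le> L * dist g h"
          using L0 dist_bounded by (intro mult_left_mono)
        finally show "norm (F (apply_bcontfun g s) - F (apply_bcontfun h s)) \<le> L * dist g h" .
      qed (use cl in auto)
      also have "\<dots> \<le> L * dist g h * t0"
        using cl L0 by (intro mult_left_mono) auto
      also have "\<dots> = (L * t0) * dist g h" by simp
      also have "\<dots> \<le> 1/2 * dist g h" using t0L by (intro mult_right_mono) auto
      finally show "dist (apply_bcontfun (Bcontfun (J g)) t) (apply_bcontfun (Bcontfun (J h)) t)
          \<le> 1/2 * dist g h"
        by (simp add: app that)
    qed
  qed auto
  then obtain g where g: "g \<in> S" "Bcontfun (J g) = g" by auto
  have gJ: "apply_bcontfun g t = x0 + integral {0..cl t} (\<lambda>s. F (apply_bcontfun g s))" for t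
    using app[OF g(1)] unfolding g(2) by (metis J_def)
  show ?thesis
  proof (rule that[of t0 "apply_bcontfun g"])
    show "apply_bcontfun g 0 = x0" using t0 by (subst gJ) (simp add: cl_def)
    fix t assume t: "t \<in> {0..t0}"
    \<comment> \<open>On [0, t0] the clamping is the identity, so the fixed point is an indefinite
      integral there.\<close>
    have "((\<lambda>t. integral {0..t} (\<lambda>s. F (apply_bcontfun g s))) has_vector_derivative
            F (apply_bcontfun g t)) (at t within {0..t0})"
      by (rule integral_has_vector_derivative[OF cont[OF g(1)] t])
    then have "((\<lambda>t. x0 + integral {0..t} (\<lambda>s. F (apply_bcontfun g s))) has_vector_derivative
            F (apply_bcontfun g t)) (at t within {0..t0})"
      by (auto intro!: derivative_eq_intros)
    then show "(apply_bcontfun g has_vector_derivative F (apply_bcontfun g t)) (at t within {0..t0})"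
      by (rule has_vector_derivative_transform[OF t, rotated])
         (subst gJ, auto simp: cl_def)
  qed (use t0 in auto)
qed

section \<open>Local Lipschitz estimates in finitely many coordinates\<close>

definition coord_box :: "nat \<Rightarrow> real \<Rightarrow> (nat \<Rightarrow> real) set" where
  "coord_box n R = {c. \<forall>i<n. \<bar>c i\<bar> \<le> R}"

definition coord_dist :: "nat \<Rightarrow> (nat \<Rightarrow> real) \<Rightarrow> (nat \<Rightarrow> real) \<Rightarrow> real" where
  "coord_dist n c d = (\<Sum>i<n. \<bar>c i - d i\<bar>)"

lemma coord_dist_nonneg: "0 \<le> coord_dist n c d"
  by (simp add: coord_dist_def sum_nonneg)

lemma coord_le_coord_dist: "i < n \<Longrightarrow> \<bar>c i - d i\<bar> \<le> coord_dist n c d"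
  unfolding coord_dist_def by (rule member_le_sum[of i _ "\<lambda>i. \<bar>c i - d i\<bar>"]) auto

text \<open>The constant may depend on the box but not on the parameter s, which ranges over points
  of the domain, of a box boundary or of a time-independent dummy set. Boundedness is included so
  that the notion is closed under products. As \<open>coord_dist\<close> ignores coordinates from n
  on, such functions depend on the first n coordinates only.\<close>

definition uniformly_loc_lipschitz :: "nat \<Rightarrow> 'b set \<Rightarrow> ((nat \<Rightarrow> real) \<Rightarrow> 'b \<Rightarrow> real) \<Rightarrow> bool" where
  "uniformly_loc_lipschitz n A \<psi> \<longleftrightarrow> (\<forall>R. \<exists>K. \<forall>c\<in>coord_box n R. \<forall>d\<in>coord_box n R. \<forall>s\<in>A.
     \<bar>\<psi> c s\<bar> \<le> K \<and> \<bar>\<psi> c s - \<psi> d s\<bar> \<le> K * coord_dist n c d)"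

lemma uniformly_loc_lipschitzE:
  assumes "uniformly_loc_lipschitz n A \<psi>"
  obtains K where "K \<ge> 0" "\<And>c s. c \<in> coord_box n R \<Longrightarrow> s \<in> A \<Longrightarrow> \<bar>\<psi> c s\<bar> \<le> K"
    "\<And>c d s. c \<in> coord_box n R \<Longrightarrow> d \<in> coord_box n R \<Longrightarrow> s \<in> A \<Longrightarrow>
       \<bar>\<psi> c s - \<psi> d s\<bar> \<le> K * coord_dist n c d"
proof -
  obtain K where K: "\<forall>c\<in>coord_box n R. \<forall>d\<in>coord_box n R. \<forall>s\<in>A.
     \<bar>\<psi> c s\<bar> \<le> K \<and> \<bar>\<psi> c s - \<psi> d s\<bar> \<le> K * coord_dist n c d"
    using assms unfolding uniformly_loc_lipschitz_def by blast
  show ?thesis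
  \<comment> \<open>An empty box or an empty \<open>A\<close> leaves the sign of K open.\<close>
  proof (rule that[of "max 0 K"])
    show "\<bar>\<psi> c s\<bar> \<le> max 0 K" if "c \<in> coord_box n R" "s \<in> A" for c s
      using K that by fastforce
    fix c d s assume "c \<in> coord_box n R" "d \<in> coord_box n R" "s \<in> A"
    then have "\<bar>\<psi> c s - \<psi> d s\<bar> \<le> K * coord_dist n c d" using K by blast
    also have "\<dots> \<le> max 0 K * coord_dist n c d"
      by (intro mult_right_mono coord_dist_nonneg) auto
    finally show "\<bar>\<psi> c s - \<psi> d s\<bar> \<le> max 0 K * coord_dist n c d" .
  qed simp
qed

lemma uniformly_loc_lipschitzI:
  assumes "\<And>R. \<exists>K1 K2. \<forall>c\<in>coord_box n R. \<forall>d\<in>coord_box n R. \<forall>s\<in>A.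
     \<bar>\<psi> c s\<bar> \<le> K1 \<and> \<bar>\<psi> c s - \<psi> d s\<bar> \<le> K2 * coord_dist n c d"
  shows "uniformly_loc_lipschitz n A \<psi>"
  unfolding uniformly_loc_lipschitz_def
proof
  fix R
  obtain K1 K2 where K: "\<forall>c\<in>coord_box n R. \<forall>d\<in>coord_box n R. \<forall>s\<in>A.
     \<bar>\<psi> c s\<bar> \<le> K1 \<and> \<bar>\<psi> c s - \<psi> d s\<bar> \<le> K2 * coord_dist n c d"
    using assms by blast
  have "K2 * coord_dist n c d \<le> max K1 K2 * coord_dist n c d" for c d
    by (intro mult_right_mono coord_dist_nonneg) auto
  then show "\<exists>K. \<forall>c\<in>coord_box n R. \<forall>d\<in>coord_box n R. \<forall>s\<in>A.
     \<bar>\<psi> c s\<bar> \<le> K \<and> \<bar>\<psi> c s - \<psi> d s\<bar> \<le> K * coord_dist n c d"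
    using K by (intro exI[of _ "max K1 K2"]) (meson order_trans max.cobounded1)
qed

lemma uniformly_loc_lipschitz_const:
  assumes "\<And>s. s \<in> A \<Longrightarrow> \<bar>g s\<bar> \<le> B"
  shows "uniformly_loc_lipschitz n A (\<lambda>c. g)"
  using assms by (intro uniformly_loc_lipschitzI exI[of _ B] exI[of _ 0]) auto

lemma uniformly_loc_lipschitz_coord:
  assumes "i < n"
  shows "uniformly_loc_lipschitz n A (\<lambda>c s. c i)"
proof (rule uniformly_loc_lipschitzI)
  show "\<exists>K1 K2. \<forall>c\<in>coord_box n R. \<forall>d\<in>coord_box n R. \<forall>s\<in>A.
     \<bar>c i\<bar> \<le> K1 \<and> \<bar>c i - d i\<bar> \<le> K2 * coord_dist n c d" for R
    using assms coord_le_coord_dist[OF assms]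
    by (intro exI[of _ R] exI[of _ 1]) (auto simp: coord_box_def)
qed

lemma uniformly_loc_lipschitz_add:
  assumes f: "uniformly_loc_lipschitz n A \<phi>" and g: "uniformly_loc_lipschitz n A \<psi>"
  shows "uniformly_loc_lipschitz n A (\<lambda>c s. \<phi> c s + \<psi> c s)"
proof (rule uniformly_loc_lipschitzI)
  fix R
  obtain K1 where K1: "K1 \<ge> 0" "\<And>c s. c \<in> coord_box n R \<Longrightarrow> s \<in> A \<Longrightarrow> \<bar>\<phi> c s\<bar> \<le> K1"
    "\<And>c d s. c \<in> coord_box n R \<Longrightarrow> d \<in> coord_box n R \<Longrightarrow> s \<in> A \<Longrightarrow>
       \<bar>\<phi> c s - \<phi> d s\<bar> \<le> K1 * coord_dist n c d"
    by (rule uniformly_loc_lipschitzE[OF f, of R]) blast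
  obtain K2 where K2: "K2 \<ge> 0" "\<And>c s. c \<in> coord_box n R \<Longrightarrow> s \<in> A \<Longrightarrow> \<bar>\<psi> c s\<bar> \<le> K2"
    "\<And>c d s. c \<in> coord_box n R \<Longrightarrow> d \<in> coord_box n R \<Longrightarrow> s \<in> A \<Longrightarrow>
       \<bar>\<psi> c s - \<psi> d s\<bar> \<le> K2 * coord_dist n c d"
    by (rule uniformly_loc_lipschitzE[OF g, of R]) blast
  have "\<bar>\<phi> c s + \<psi> c s\<bar> \<le> K1 + K2 \<and>
      \<bar>(\<phi> c s + \<psi> c s) - (\<phi> d s + \<psi> d s)\<bar> \<le> (K1 + K2) * coord_dist n c d"
    if "c \<in> coord_box n R" "d \<in> coord_box n R" "s \<in> A" for c d s
    using K1(2)[of c s] K2(2)[of c s] K1(3)[of c d s] K2(3)[of c d s] that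
    unfolding distrib_right by (auto simp: abs_le_iff)
  then show "\<exists>K1 K2. \<forall>c\<in>coord_box n R. \<forall>d\<in>coord_box n R. \<forall>s\<in>A.
     \<bar>\<phi> c s + \<psi> c s\<bar> \<le> K1 \<and>
     \<bar>(\<phi> c s + \<psi> c s) - (\<phi> d s + \<psi> d s)\<bar> \<le> K2 * coord_dist n c d"
    by blast
qed

lemma uniformly_loc_lipschitz_sum:
  assumes "\<And>i. i \<in> I \<Longrightarrow> uniformly_loc_lipschitz n A (\<phi> i)"
  shows "uniformly_loc_lipschitz n A (\<lambda>c s. \<Sum>i\<in>I. \<phi> i c s)"
  using assms
proof (induction I rule: infinite_finite_induct)
  case (insert x F)
  then show ?case by (simp add: uniformly_loc_lipschitz_add)
qed (auto intro: uniformly_loc_lipschitz_const[of _ _ 0])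

text \<open>In the usual splitting of a difference of products, the Lipschitz constant of each
  factor is multiplied by the bound of the other.\<close>

lemma uniformly_loc_lipschitz_mult:
  assumes f: "uniformly_loc_lipschitz n A \<phi>" and g: "uniformly_loc_lipschitz n A \<psi>"
  shows "uniformly_loc_lipschitz n A (\<lambda>c s. \<phi> c s * \<psi> c s)"
proof (rule uniformly_loc_lipschitzI)
  fix R
  obtain K1 where K1: "K1 \<ge> 0" "\<And>c s. c \<in> coord_box n R \<Longrightarrow> s \<in> A \<Longrightarrow> \<bar>\<phi> c s\<bar> \<le> K1"
    "\<And>c d s. c \<in> coord_box n R \<Longrightarrow> d \<in> coord_box n R \<Longrightarrow> s \<in> A \<Longrightarrow>
       \<bar>\<phi> c s - \<phi> d s\<bar> \<le> K1 * coord_dist n c d"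
    by (rule uniformly_loc_lipschitzE[OF f, of R]) blast
  obtain K2 where K2: "K2 \<ge> 0" "\<And>c s. c \<in> coord_box n R \<Longrightarrow> s \<in> A \<Longrightarrow> \<bar>\<psi> c s\<bar> \<le> K2"
    "\<And>c d s. c \<in> coord_box n R \<Longrightarrow> d \<in> coord_box n R \<Longrightarrow> s \<in> A \<Longrightarrow>
       \<bar>\<psi> c s - \<psi> d s\<bar> \<le> K2 * coord_dist n c d"
    by (rule uniformly_loc_lipschitzE[OF g, of R]) blast
  have "\<bar>\<phi> c s * \<psi> c s\<bar> \<le> K1 * K2 \<and>
      \<bar>\<phi> c s * \<psi> c s - \<phi> d s * \<psi> d s\<bar> \<le> (2 * K1 * K2) * coord_dist n c d"
    if *: "c \<in> coord_box n R" "d \<in> coord_box n R" "s \<in> A" for c d s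
  proof
    let ?D = "coord_dist n c d"
    note D = coord_dist_nonneg[of n c d]
    show "\<bar>\<phi> c s * \<psi> c s\<bar> \<le> K1 * K2"
      unfolding abs_mult using K1 K2 * by (intro mult_mono) auto
    have "\<bar>\<phi> c s * \<psi> c s - \<phi> d s * \<psi> d s\<bar>
        = \<bar>\<phi> c s * (\<psi> c s - \<psi> d s) + (\<phi> c s - \<phi> d s) * \<psi> d s\<bar>"
      by (simp add: algebra_simps)
    also have "\<dots> \<le> \<bar>\<phi> c s\<bar> * \<bar>\<psi> c s - \<psi> d s\<bar> + \<bar>\<phi> c s - \<phi> d s\<bar> * \<bar>\<psi> d s\<bar>"
      unfolding abs_mult[symmetric] by (rule abs_triangle_ineq)
    also have "\<dots> \<le> K1 * (K2 * ?D) + (K1 * ?D) * K2"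
      using K1 K2 * D by (intro add_mono mult_mono) auto
    finally show "\<bar>\<phi> c s * \<psi> c s - \<phi> d s * \<psi> d s\<bar> \<le> (2 * K1 * K2) * ?D"
      by (simp add: algebra_simps)
  qed
  then show "\<exists>K1 K2. \<forall>c\<in>coord_box n R. \<forall>d\<in>coord_box n R. \<forall>s\<in>A.
     \<bar>\<phi> c s * \<psi> c s\<bar> \<le> K1 \<and> \<bar>\<phi> c s * \<psi> c s - \<phi> d s * \<psi> d s\<bar> \<le> K2 * coord_dist n c d"
    by blast
qed

lemma uniformly_loc_lipschitz_compose:
  assumes g: "uniformly_loc_lipschitz n A \<psi>"
    and f: "\<And>x y. \<bar>f x - f y\<bar> \<le> C * \<bar>x - y\<bar>"
  shows "uniformly_loc_lipschitz n A (\<lambda>c s. f (\<psi> c s))"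
proof (rule uniformly_loc_lipschitzI)
  have C: "0 \<le> C" using f[of 1 0] by simp
  fix R
  obtain K where K: "K \<ge> 0" "\<And>c s. c \<in> coord_box n R \<Longrightarrow> s \<in> A \<Longrightarrow> \<bar>\<psi> c s\<bar> \<le> K"
    "\<And>c d s. c \<in> coord_box n R \<Longrightarrow> d \<in> coord_box n R \<Longrightarrow> s \<in> A \<Longrightarrow>
       \<bar>\<psi> c s - \<psi> d s\<bar> \<le> K * coord_dist n c d"
    by (rule uniformly_loc_lipschitzE[OF g, of R]) blast
  have "\<bar>f (\<psi> c s)\<bar> \<le> \<bar>f 0\<bar> + C * K \<and>
      \<bar>f (\<psi> c s) - f (\<psi> d s)\<bar> \<le> (C * K) * coord_dist n c d"
    if *: "c \<in> coord_box n R" "d \<in> coord_box n R" "s \<in> A" for c d s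
    using f[of "\<psi> c s" 0] mult_left_mono[OF K(2)[of c s] C]
      f[of "\<psi> c s" "\<psi> d s"] mult_left_mono[OF K(3)[of c d s] C] * by auto
  then show "\<exists>K1 K2. \<forall>c\<in>coord_box n R. \<forall>d\<in>coord_box n R. \<forall>s\<in>A.
     \<bar>f (\<psi> c s)\<bar> \<le> K1 \<and> \<bar>f (\<psi> c s) - f (\<psi> d s)\<bar> \<le> K2 * coord_dist n c d"
    by blast
qed

text \<open>Inversion is not globally Lipschitz, but \<open>\<lambda>x. inverse (max m x)\<close>
  is, with constant 1/m^2, and the two agree on the values taken here. This reduces the claim to
  composition with a Lipschitz function.\<close>

lemma uniformly_loc_lipschitz_inverse:
  assumes g: "uniformly_loc_lipschitz n A \<psi>" and m: "m > 0" and le: "\<And>c s. s \<in> A \<Longrightarrow> m \<le> \<psi> c s"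
  shows "uniformly_loc_lipschitz n A (\<lambda>c s. inverse (\<psi> c s))"
proof -
  have "\<bar>inverse (max m x) - inverse (max m y)\<bar> \<le> inverse (m\<^sup>2) * \<bar>x - y\<bar>" for x y :: real
  proof -
    have pos: "max m x > 0" "max m y > 0" using m by auto
    have "inverse (max m x) - inverse (max m y) = (max m y - max m x) * inverse (max m x * max m y)"
      using pos by (simp add: field_simps)
    then have "\<bar>inverse (max m x) - inverse (max m y)\<bar>
        = \<bar>max m y - max m x\<bar> * inverse (max m x * max m y)"
      using pos by (simp add: abs_mult)
    also have "\<dots> \<le> \<bar>x - y\<bar> * inverse (m * m)"
      using m by (intro mult_mono le_imp_inverse_le) auto
    finally show ?thesis by (simp add: power2_eq_square mult.commute)
  qed
  from uniformly_loc_lipschitz_compose[OF g, of "\<lambda>x. inverse (max m x)", OF this]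
  show ?thesis
    unfolding uniformly_loc_lipschitz_def using le by (simp add: max_absorb2)
qed

lemma (in finite_measure) abs_integral_le_const:
  fixes h :: "'a \<Rightarrow> real"
  assumes "\<And>x. x \<in> space M \<Longrightarrow> \<bar>h x\<bar> \<le> b" "h \<in> borel_measurable M"
  shows "\<bar>\<integral>x. h x \<partial>M\<bar> \<le> b * measure M (space M)"
proof -
  have "integrable M h" using assms by (intro integrable_const_bound[where B = b]) auto
  have "\<bar>\<integral>x. h x \<partial>M\<bar> \<le> (\<integral>x. \<bar>h x\<bar> \<partial>M)" by (rule integral_abs_bound)
  also have "\<dots> \<le> (\<integral>x. b \<partial>M)"
    using assms \<open>integrable M h\<close> by (intro integral_mono) auto
  finally show ?thesis by (simp add: mult.commute)
qed

text \<open>Uniformity in the parameter is what survives integration over a finite measure; both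
  constants are multiplied by the total mass. The result no longer depends on the parameter, so its
  set \<open>A\<close> is arbitrary.\<close>

lemma uniformly_loc_lipschitz_integral:
  assumes g: "uniformly_loc_lipschitz n (space N) \<psi>" and N: "finite_measure N"
    and meas: "\<And>c. \<psi> c \<in> borel_measurable N"
  shows "uniformly_loc_lipschitz n A (\<lambda>c s. \<integral>x. \<psi> c x \<partial>N)"
proof (rule uniformly_loc_lipschitzI)
  interpret finite_measure N by fact
  fix R
  obtain K where K: "K \<ge> 0" "\<And>c s. c \<in> coord_box n R \<Longrightarrow> s \<in> space N \<Longrightarrow> \<bar>\<psi> c s\<bar> \<le> K"
    "\<And>c d s. c \<in> coord_box n R \<Longrightarrow> d \<in> coord_box n R \<Longrightarrow> s \<in> space N \<Longrightarrow>
       \<bar>\<psi> c s - \<psi> d s\<bar> \<le> K * coord_dist n c d"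
    by (rule uniformly_loc_lipschitzE[OF g, of R]) blast
  have "\<bar>\<integral>x. \<psi> c x \<partial>N\<bar> \<le> K * measure N (space N) \<and>
      \<bar>(\<integral>x. \<psi> c x \<partial>N) - (\<integral>x. \<psi> d x \<partial>N)\<bar> \<le> (K * measure N (space N)) * coord_dist n c d"
    if *: "c \<in> coord_box n R" "d \<in> coord_box n R" for c d
  proof
    show "\<bar>\<integral>x. \<psi> c x \<partial>N\<bar> \<le> K * measure N (space N)"
      using K * meas by (intro abs_integral_le_const) auto
    have "integrable N (\<psi> c)" "integrable N (\<psi> d)"
      using K(2) * meas by (auto intro!: integrable_const_bound[where B = K])
    then have "(\<integral>x. \<psi> c x \<partial>N) - (\<integral>x. \<psi> d x \<partial>N) = (\<integral>x. \<psi> c x - \<psi> d x \<partial>N)" by simp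
    also have "\<bar>\<dots>\<bar> \<le> K * coord_dist n c d * measure N (space N)"
      using K(3) * meas by (intro abs_integral_le_const) auto
    finally show "\<bar>(\<integral>x. \<psi> c x \<partial>N) - (\<integral>x. \<psi> d x \<partial>N)\<bar>
        \<le> (K * measure N (space N)) * coord_dist n c d"
      by (simp add: mult_ac)
  qed
  then show "\<exists>K1 K2. \<forall>c\<in>coord_box n R. \<forall>d\<in>coord_box n R. \<forall>s\<in>A.
       \<bar>\<integral>x. \<psi> c x \<partial>N\<bar> \<le> K1 \<and>
       \<bar>(\<integral>x. \<psi> c x \<partial>N) - (\<integral>x. \<psi> d x \<partial>N)\<bar> \<le> K2 * coord_dist n c d" by blast
qed

section \<open>Systems of ordinary differential equations in coordinates\<close>

instance bcontfun :: (metric_space, banach) banach ..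

text \<open>
  As \<open>n\<close> is not a type, coordinate vectors are embedded into the Banach space of bounded functions on
  the discrete metric space of all indices.
\<close>

lemma ode_system_local_existence:
  fixes G :: "nat \<Rightarrow> (nat \<Rightarrow> real) \<Rightarrow> real"
  assumes G: "\<And>i. i < n \<Longrightarrow> uniformly_loc_lipschitz n UNIV (\<lambda>c (s::unit). G i c)"
  obtains t0 c where "t0 > 0" "\<And>i. i < n \<Longrightarrow> c 0 i = a i"
    "\<And>t i. t \<in> {0..t0} \<Longrightarrow> i < n \<Longrightarrow>
       ((\<lambda>t. c t i) has_real_derivative G i (c t)) (at t within {0..t0})"
proof -
  define emb :: "(nat \<Rightarrow> real) \<Rightarrow> nat discrete \<Rightarrow>\<^sub>C real"
    where "emb x = Bcontfun (\<lambda>i. if of_discrete i < n then x (of_discrete i) else 0)" for x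
  define cf :: "(nat discrete \<Rightarrow>\<^sub>C real) \<Rightarrow> nat \<Rightarrow> real"
    where "cf x i = apply_bcontfun x (discrete i)" for x i
  have emb: "cf (emb x) i = (if i < n then x i else 0)" for x i
  proof -
    have "(\<lambda>i. if of_discrete i < n then x (of_discrete i) else 0) \<in> bcontfun"
    proof (rule bcontfun_normI)
      show "norm (if of_discrete i < n then x (of_discrete i) else 0) \<le> (\<Sum>i<n. \<bar>x i\<bar>)" for i
        by (auto intro!: member_le_sum[of "of_discrete i" _ "\<lambda>i. \<bar>x i\<bar>"] sum_nonneg)
    qed (simp add: continuous_on_open_vimage open_discrete)
    then show ?thesis by (simp add: emb_def cf_def Bcontfun_inverse discrete_inverse)
  qed
  define F where "F x = emb (\<lambda>i. G i (cf x))" for x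
  define x0 where "x0 = emb a"
  \<comment> \<open>Coordinates are dominated by the sup norm, so every point of the unit ball
    around \<open>x0\<close> has its coordinates in this box.\<close>
  define R where "R = norm x0 + 1"
  have "\<exists>K\<ge>0. \<forall>c\<in>coord_box n R. \<forall>d\<in>coord_box n R. \<bar>G i c - G i d\<bar> \<le> K * coord_dist n c d"
    if "i < n" for i
    by (rule uniformly_loc_lipschitzE[OF G[OF that], of R]) blast
  then obtain K where K0: "\<And>i. i < n \<Longrightarrow> K i \<ge> 0" and K: "\<And>i c d. i < n \<Longrightarrow> c \<in> coord_box n R \<Longrightarrow>
      d \<in> coord_box n R \<Longrightarrow> \<bar>G i c - G i d\<bar> \<le> K i * coord_dist n c d" by metis
  \<comment> \<open>Each \<open>K i\<close> refers to \<open>coord_dist\<close>, a sum of n terms,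
    none of which exceeds the sup distance; hence the factor n.\<close>
  define L where "L = (\<Sum>i<n. K i) * real n"
  have coord: "\<bar>cf x i\<bar> \<le> norm x" for x :: "nat discrete \<Rightarrow>\<^sub>C real" and i
    using norm_bounded[of x "discrete i"] by (simp add: cf_def)
  have bound: "cf x \<in> coord_box n R" if "x \<in> cball x0 1" for x
  proof -
    have "norm x \<le> R"
      using that norm_triangle_sub[of x x0] by (simp add: R_def dist_norm norm_minus_commute)
    then show ?thesis using coord[of x] order_trans by (auto simp: coord_box_def)
  qed
  have lip: "L-lipschitz_on (cball x0 1) F"
  proof (rule lipschitz_onI)
    show "0 \<le> L" unfolding L_def using K0 by (intro mult_nonneg_nonneg sum_nonneg) auto
    fix x y assume xy: "x \<in> cball x0 1" "y \<in> cball x0 1"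
    have "dist (cf (F x) i) (cf (F y) i) \<le> L * dist x y" for i
    proof -
      show "dist (cf (F x) i) (cf (F y) i) \<le> L * dist x y"
      proof (cases "i < n")
        case True
        have "dist (cf (F x) i) (cf (F y) i)
            \<le> K i * coord_dist n (cf x) (cf y)"
          using K[OF True bound bound, OF xy] True by (simp add: F_def emb dist_real_def)
        also have "\<dots> \<le> K i * (\<Sum>j<n. dist x y)"
          unfolding coord_dist_def
        proof (intro mult_left_mono sum_mono K0 True)
          show "\<bar>cf x j - cf y j\<bar> \<le> dist x y" for j
            using dist_bounded[of x "discrete j" y] by (simp add: cf_def dist_real_def)
        qed
        also have "\<dots> \<le> (\<Sum>i<n. K i) * (\<Sum>j<n. dist x y)"
          using True K0 by (intro mult_right_mono member_le_sum sum_nonneg) auto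
        finally show ?thesis by (simp add: L_def)
      qed (use \<open>0 \<le> L\<close> in \<open>auto simp: F_def emb\<close>)
    qed
    then have "dist (apply_bcontfun (F x) j) (apply_bcontfun (F y) j) \<le> L * dist x y" for j
      by (cases j) (simp add: cf_def)
    then show "dist (F x) (F y) \<le> L * dist x y" by (rule dist_bound)
  qed
  obtain t0 g where t0: "t0 > 0" and g0: "g 0 = x0"
    and g: "\<And>t. t \<in> {0..t0} \<Longrightarrow> (g has_vector_derivative F (g t)) (at t within {0..t0})"
    by (rule picard_lindeloef[OF _ lip]) auto
  show ?thesis
  proof (rule that[OF t0, of "\<lambda>t. cf (g t)"])
    show "cf (g 0) i = a i" if "i < n" for i
      using that by (simp add: g0 x0_def emb)
    fix t i assume t: "t \<in> {0..t0}" and i: "i < n"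
    have "bounded_linear (\<lambda>x :: nat discrete \<Rightarrow>\<^sub>C real. cf x i)"
      by (rule bounded_linear_intro[where K = 1]) (use coord in \<open>auto simp: cf_def\<close>)
    from bounded_linear.has_vector_derivative[OF this g[OF t]]
    have "((\<lambda>t. cf (g t) i) has_vector_derivative cf (F (g t)) i)
        (at t within {0..t0})" .
    then show "((\<lambda>t. cf (g t) i) has_real_derivative G i (cf (g t)))
        (at t within {0..t0})"
      using i by (simp add: has_real_derivative_iff_has_vector_derivative F_def emb)
  qed
qed

text \<open>Both solutions are continuous on a compact interval and so stay in a common box, where
  one set of Lipschitz constants applies. The squared Euclidean distance \<open>E\<close> is
  differentiable, unlike \<open>coord_dist\<close>, and satisfies E' \<le> C E; hence E(t) exp(-C t)
  is nonincreasing and starts at 0.\<close>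

lemma ode_system_unique:
  fixes G :: "nat \<Rightarrow> (nat \<Rightarrow> real) \<Rightarrow> real"
  assumes G: "\<And>i. i < n \<Longrightarrow> uniformly_loc_lipschitz n UNIV (\<lambda>c (s::unit). G i c)"
    and c: "\<And>t i. t \<in> {0..t0} \<Longrightarrow> i < n \<Longrightarrow>
       ((\<lambda>t. c t i) has_real_derivative G i (c t)) (at t within {0..t0})"
    and d: "\<And>t i. t \<in> {0..t0} \<Longrightarrow> i < n \<Longrightarrow>
       ((\<lambda>t. d t i) has_real_derivative G i (d t)) (at t within {0..t0})"
    and init: "\<And>i. i < n \<Longrightarrow> c 0 i = d 0 i"
    and t: "t \<in> {0..t0}" and i: "i < n"
  shows "c t i = d t i"
proof -
  have bdd: "\<exists>B. \<forall>t\<in>{0..t0}. x t \<in> coord_box n B"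
    if x: "\<And>t i. t \<in> {0..t0} \<Longrightarrow> i < n \<Longrightarrow>
       ((\<lambda>t. x t i) has_real_derivative G i (x t)) (at t within {0..t0})" for x
  proof -
    have "\<exists>B. \<forall>t\<in>{0..t0}. \<bar>x t i\<bar> \<le> B" if "i < n" for i
    proof -
      have "continuous_on {0..t0} (\<lambda>t. x t i)"
        using x that by (intro DERIV_continuous_on) auto
      then have "bounded ((\<lambda>t. x t i) ` {0..t0})"
        using compact_continuous_image compact_imp_bounded by blast
      then show ?thesis by (auto simp: bounded_iff)
    qed
    then obtain B where B: "\<And>i t. i < n \<Longrightarrow> t \<in> {0..t0} \<Longrightarrow> \<bar>x t i\<bar> \<le> B i" by metis
    have "\<bar>x t i\<bar> \<le> (\<Sum>i<n. \<bar>B i\<bar>)" if "i < n" "t \<in> {0..t0}" for i t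
    proof -
      have "\<bar>x t i\<bar> \<le> \<bar>B i\<bar>" using B[OF that] by linarith
      also have "\<dots> \<le> (\<Sum>i<n. \<bar>B i\<bar>)" using that by (intro member_le_sum) auto
      finally show ?thesis .
    qed
    then show ?thesis unfolding coord_box_def by blast
  qed
  obtain B1 where B1: "\<And>t. t \<in> {0..t0} \<Longrightarrow> c t \<in> coord_box n B1" using bdd[OF c] by blast
  obtain B2 where B2: "\<And>t. t \<in> {0..t0} \<Longrightarrow> d t \<in> coord_box n B2" using bdd[OF d] by blast
  define R where "R = max B1 B2"
  have R: "c t \<in> coord_box n R" "d t \<in> coord_box n R" if "t \<in> {0..t0}" for t
    using B1[OF that] B2[OF that] by (auto simp: R_def coord_box_def)
  have "\<exists>K\<ge>0. \<forall>c\<in>coord_box n R. \<forall>d\<in>coord_box n R. \<bar>G i c - G i d\<bar> \<le> K * coord_dist n c d"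
    if "i < n" for i
    by (rule uniformly_loc_lipschitzE[OF G[OF that], of R]) blast
  then obtain K where K0: "\<And>i. i < n \<Longrightarrow> K i \<ge> 0" and K: "\<And>i c d. i < n \<Longrightarrow> c \<in> coord_box n R \<Longrightarrow>
      d \<in> coord_box n R \<Longrightarrow> \<bar>G i c - G i d\<bar> \<le> K i * coord_dist n c d" by metis
  define E where "E t = (\<Sum>i<n. (c t i - d t i)\<^sup>2)" for t
  define E' where "E' t = (\<Sum>i<n. 2 * (c t i - d t i) * (G i (c t) - G i (d t)))" for t
  have dE: "(E has_real_derivative E' t) (at t within {0..t0})" if "t \<in> {0..t0}" for t
    unfolding E_def[abs_def] E'_def
    by (rule DERIV_sum) (use c[OF that] d[OF that] in \<open>auto intro!: derivative_eq_intros\<close>)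
  \<comment> \<open>The factor 2 comes from differentiating squares, the sum of the
    \<open>K i\<close> from the Lipschitz bounds, and n from Cauchy-Schwarz, which compares
    \<open>coord_dist\<close> with the Euclidean distance.\<close>
  define C where "C = 2 * (\<Sum>i<n. K i) * real n"
  have E'_le: "E' t \<le> C * E t" if t: "t \<in> {0..t0}" for t
  proof -
    let ?D = "coord_dist n (c t) (d t)"
    note D = coord_dist_nonneg[of n "c t" "d t"]
    have "E' t \<le> (\<Sum>i<n. 2 * ?D * (K i * ?D))"
      unfolding E'_def
    proof (intro sum_mono)
      fix i assume "i \<in> {..<n}"
      then have i: "i < n" by simp
      have "2 * (c t i - d t i) * (G i (c t) - G i (d t))
          \<le> \<bar>2 * (c t i - d t i)\<bar> * \<bar>G i (c t) - G i (d t)\<bar>"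
        unfolding abs_mult[symmetric] by simp
      also have "\<dots> \<le> (2 * ?D) * (K i * ?D)"
      proof (rule mult_mono)
        show "\<bar>2 * (c t i - d t i)\<bar> \<le> 2 * ?D"
          using coord_le_coord_dist[OF i, of "c t" "d t"] by (simp add: abs_mult)
        show "\<bar>G i (c t) - G i (d t)\<bar> \<le> K i * ?D" using K[OF i R[OF t]] .
      qed (use D in auto)
      finally show "2 * (c t i - d t i) * (G i (c t) - G i (d t)) \<le> 2 * ?D * (K i * ?D)" .
    qed
    also have "\<dots> = 2 * (\<Sum>i<n. K i) * ?D\<^sup>2"
      by (simp add: sum_distrib_left sum_distrib_right power2_eq_square mult_ac)
    also have "\<dots> \<le> 2 * (\<Sum>i<n. K i) * (real n * E t)"
    proof (intro mult_left_mono mult_nonneg_nonneg sum_nonneg)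
      have "(\<Sum>i<n. \<bar>c t i - d t i\<bar> * 1)\<^sup>2 \<le> (\<Sum>i<n. \<bar>c t i - d t i\<bar>\<^sup>2) * (\<Sum>i<n. 1\<^sup>2)"
        by (rule Cauchy_Schwarz_ineq_sum)
      then show "?D\<^sup>2 \<le> real n * E t" by (simp add: E_def coord_dist_def mult.commute)
    qed (use K0 in auto)
    finally show ?thesis by (simp add: C_def)
  qed
  have "E t * exp (- C * t) \<le> E 0 * exp (- C * 0)"
  proof (rule DERIV_nonpos_imp_decreasing_open[of 0 t "\<lambda>s. E s * exp (- C * s)"])
    show "0 \<le> t" using t by simp
    show "continuous_on {0..t} (\<lambda>s. E s * exp (- C * s))"
    proof -
      have "continuous_on {0..t0} E" using dE by (rule DERIV_continuous_on)
      then have "continuous_on {0..t} E" by (rule continuous_on_subset) (use t in auto)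
      then show ?thesis by (intro continuous_intros)
    qed
    fix s assume s: "0 < s" "s < t"
    have "(E has_real_derivative E' s) (at s)"
      using dE[of s] s t by (simp add: at_within_Icc_at)
    then have "((\<lambda>s. E s * exp (- C * s)) has_real_derivative (E' s - C * E s) * exp (- C * s)) (at s)"
      by (auto intro!: derivative_eq_intros simp: algebra_simps)
    moreover have "(E' s - C * E s) * exp (- C * s) \<le> 0"
      using E'_le[of s] s t by (intro mult_nonpos_nonneg) auto
    ultimately show "\<exists>y. ((\<lambda>s. E s * exp (- C * s)) has_real_derivative y) (at s) \<and> y \<le> 0" by blast
  qed
  then have "E t \<le> 0" using init by (simp add: E_def mult_le_0_iff)
  moreover have "(c t i - d t i)\<^sup>2 \<le> E t"
    unfolding E_def using i by (intro member_le_sum[of i _ "\<lambda>i. (c t i - d t i)\<^sup>2"]) auto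
  ultimately have "(c t i - d t i)\<^sup>2 \<le> 0" by linarith
  then show ?thesis by simp
qed

section \<open>Orthonormal bases of nodal function spaces\<close>

text \<open>A homogeneous linear system with more unknowns than equations, solved by elimination: if
  some \<open>\<phi> k\<close> is nonzero at p, it serves as the pivot, and multiples of it are
  subtracted so that the other functions vanish at p.\<close>

lemma nontrivial_vanishing_combination:
  fixes \<phi> :: "'i \<Rightarrow> 'a \<Rightarrow> real"
  assumes "finite P" "finite I" "card P < card I"
  shows "\<exists>c. (\<exists>i\<in>I. c i \<noteq> 0) \<and> (\<forall>p\<in>P. (\<Sum>i\<in>I. c i * \<phi> i p) = 0)"
  using assms
proof (induction P arbitrary: I \<phi> rule: finite_induct)
  case empty
  then show ?case by (intro exI[of _ "\<lambda>_. 1"]) (auto simp: card_gt_0_iff)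
next
  case (insert p P)
  show ?case
  proof (cases "\<forall>i\<in>I. \<phi> i p = 0")
    case True
    from insert have "card P < card I" by simp
    from insert.IH[OF \<open>finite I\<close> this, of \<phi>] obtain c
      where "\<exists>i\<in>I. c i \<noteq> 0" "\<forall>p\<in>P. (\<Sum>i\<in>I. c i * \<phi> i p) = 0" by blast
    then show ?thesis using True by (intro exI[of _ c]) auto
  next
    case False
    then obtain k where k: "k \<in> I" "\<phi> k p \<noteq> 0" by blast
    define r where "r i = \<phi> i p / \<phi> k p" for i
    have "card P < card (I - {k})" using insert k by simp
    from insert.IH[OF _ this, of "\<lambda>i q. \<phi> i q - r i * \<phi> k q"] insert obtain c
      where c: "\<exists>i\<in>I-{k}. c i \<noteq> 0"
        "\<forall>q\<in>P. (\<Sum>i\<in>I-{k}. c i * (\<phi> i q - r i * \<phi> k q)) = 0" by auto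
    define s where "s = (\<Sum>i\<in>I-{k}. c i * r i)"
    \<comment> \<open>The pivot coefficient collects the multiples of \<open>\<phi> k\<close>
      subtracted from the other functions, which turns the reduced combination into one of the
      original functions.\<close>
    define d where "d = c(k := - s)"
    have d: "(\<Sum>i\<in>I. d i * \<phi> i q) = (\<Sum>i\<in>I-{k}. c i * (\<phi> i q - r i * \<phi> k q))" for q
    proof -
      have "(\<Sum>i\<in>I. d i * \<phi> i q) = d k * \<phi> k q + (\<Sum>i\<in>I-{k}. d i * \<phi> i q)"
        using k insert by (simp add: sum.remove)
      also have "(\<Sum>i\<in>I-{k}. d i * \<phi> i q) = (\<Sum>i\<in>I-{k}. c i * \<phi> i q)"
        by (intro sum.cong) (auto simp: d_def)
      finally show ?thesis
        by (simp add: d_def s_def algebra_simps sum_subtractf sum_distrib_left)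
    qed
    have "(\<Sum>i\<in>I. d i * \<phi> i p) = 0"
      unfolding d using k by (intro sum.neutral) (simp add: r_def)
    moreover have "\<exists>i\<in>I. d i \<noteq> 0" using c(1) by (auto simp: d_def)
    ultimately show ?thesis using c(2) d by (intro exI[of _ d]) auto
  qed
qed

text \<open>
  As \<open>P\<close> is finite, \<open>S\<close> is finite dimensional modulo the functions vanishing on \<open>P\<close>, although its
  elements may be arbitrary elsewhere.
\<close>

locale nodal_inner_space =
  fixes S :: "('a \<Rightarrow> real) set" and Q :: "('a \<Rightarrow> real) \<Rightarrow> ('a \<Rightarrow> real) \<Rightarrow> real" and P :: "'a set"
  assumes finite_P: "finite P"
    and S_zero: "(\<lambda>x. 0) \<in> S"
    and S_lin: "\<And>v w a b. v \<in> S \<Longrightarrow> w \<in> S \<Longrightarrow> (\<lambda>x. a * v x + b * w x) \<in> S"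
    and Q_lin: "\<And>v w z a b. v \<in> S \<Longrightarrow> w \<in> S \<Longrightarrow> z \<in> S \<Longrightarrow>
      Q (\<lambda>x. a * v x + b * w x) z = a * Q v z + b * Q w z"
    and Q_sym: "\<And>v w. v \<in> S \<Longrightarrow> w \<in> S \<Longrightarrow> Q v w = Q w v"
    and Q_nonneg: "\<And>v. v \<in> S \<Longrightarrow> 0 \<le> Q v v"
    and Q_eq_0_iff: "\<And>v. v \<in> S \<Longrightarrow> Q v v = 0 \<longleftrightarrow> (\<forall>p\<in>P. v p = 0)"
begin

lemma S_sum: "(\<And>i. i \<in> I \<Longrightarrow> \<phi> i \<in> S) \<Longrightarrow> (\<lambda>x. \<Sum>i\<in>I. c i * \<phi> i x) \<in> S"
proof (induction I rule: infinite_finite_induct)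
  case (insert i I)
  then show ?case using S_lin[of "\<phi> i" "\<lambda>x. \<Sum>i\<in>I. c i * \<phi> i x" "c i" 1] by simp
qed (auto simp: S_zero)

lemma Q_zero: "z \<in> S \<Longrightarrow> Q (\<lambda>x. 0) z = 0"
  using Q_lin[OF S_zero S_zero, of z 0 0] by simp

lemma Q_sum: "(\<And>i. i \<in> I \<Longrightarrow> \<phi> i \<in> S) \<Longrightarrow> z \<in> S \<Longrightarrow>
  Q (\<lambda>x. \<Sum>i\<in>I. c i * \<phi> i x) z = (\<Sum>i\<in>I. c i * Q (\<phi> i) z)"
proof (induction I rule: infinite_finite_induct)
  case (insert i I)
  then show ?case
    using Q_lin[of "\<phi> i" "\<lambda>x. \<Sum>i\<in>I. c i * \<phi> i x" z "c i" 1] S_sum[of I \<phi> c] by simp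
qed (auto simp: Q_zero)

definition orthonormal_family :: "nat \<Rightarrow> (nat \<Rightarrow> 'a \<Rightarrow> real) \<Rightarrow> bool" where
  "orthonormal_family n \<phi> \<longleftrightarrow> (\<forall>i<n. \<phi> i \<in> S) \<and>
     (\<forall>i<n. \<forall>j<n. Q (\<phi> i) (\<phi> j) = (if i = j then 1 else 0))"

lemma orthonormal_family_Q_sum:
  assumes "orthonormal_family n \<phi>" "j < n"
  shows "Q (\<lambda>x. \<Sum>i<n. c i * \<phi> i x) (\<phi> j) = c j"
proof -
  have "Q (\<lambda>x. \<Sum>i<n. c i * \<phi> i x) (\<phi> j) = (\<Sum>i<n. c i * Q (\<phi> i) (\<phi> j))"
    using assms by (intro Q_sum) (auto simp: orthonormal_family_def)
  also have "\<dots> = (\<Sum>i<n. if i = j then c i else 0)"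
    using assms by (intro sum.cong) (auto simp: orthonormal_family_def)
  finally show ?thesis using assms by (simp add: sum.delta)
qed

text \<open>A longer family would have a nontrivial combination vanishing on \<open>P\<close>. Its
  Q-square would be 0 by definiteness, yet by orthonormality it equals the sum of the squared
  coefficients.\<close>

lemma orthonormal_family_le_card:
  assumes "orthonormal_family n \<phi>"
  shows "n \<le> card P"
proof (rule ccontr)
  assume "\<not> n \<le> card P"
  then obtain c where c: "\<exists>i<n. c i \<noteq> 0" "\<forall>p\<in>P. (\<Sum>i<n. c i * \<phi> i p) = 0"
    using nontrivial_vanishing_combination[of P "{..<n}" \<phi>] finite_P by auto
  define v where "v = (\<lambda>x. \<Sum>i<n. c i * \<phi> i x)"
  have vS: "v \<in> S" using assms unfolding v_def by (intro S_sum) (auto simp: orthonormal_family_def)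
  have "Q v v = (\<Sum>i<n. c i * Q (\<phi> i) v)"
    using vS assms unfolding v_def by (intro Q_sum) (auto simp: orthonormal_family_def)
  also have "\<dots> = (\<Sum>i<n. c i * c i)"
  proof (intro sum.cong refl)
    fix i assume "i \<in> {..<n}"
    then show "c i * Q (\<phi> i) v = c i * c i"
      using assms Q_sym[of "\<phi> i" v] vS orthonormal_family_Q_sum[OF assms, of i c]
      by (simp add: v_def orthonormal_family_def)
  qed
  finally have "(\<Sum>i<n. c i * c i) = 0"
    using Q_eq_0_iff[OF vS] c(2) by (simp add: v_def)
  then have "\<forall>i<n. c i * c i = 0" by (subst (asm) sum_nonneg_eq_0_iff) auto
  then show False using c(1) by auto
qed

text \<open>The size of orthonormal families is bounded, so a largest one exists. If some v differed
  from its expansion at a point of \<open>P\<close>, the remainder would have positive Q-square, and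
  normalising it would extend the family.\<close>

lemma ex_orthonormal_basis:
  obtains n \<phi> where "orthonormal_family n \<phi>"
    "\<And>v p. v \<in> S \<Longrightarrow> p \<in> P \<Longrightarrow> v p = (\<Sum>i<n. Q v (\<phi> i) * \<phi> i p)"
proof -
  define N where "N = {n. \<exists>\<phi>. orthonormal_family n \<phi>}"
  have N: "N \<subseteq> {..card P}" unfolding N_def using orthonormal_family_le_card by auto
  then have fin: "finite N" by (rule finite_subset) simp
  have "0 \<in> N" by (simp add: N_def orthonormal_family_def)
  then have "Max N \<in> N" using fin by (intro Max_in) auto
  define n where "n = Max N"
  obtain \<phi> where \<phi>: "orthonormal_family n \<phi>" using \<open>Max N \<in> N\<close> by (auto simp: N_def n_def)
  show ?thesis
  proof (rule that[OF \<phi>], rule ccontr)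
    fix v p assume v: "v \<in> S" and p: "p \<in> P" and ne: "v p \<noteq> (\<Sum>i<n. Q v (\<phi> i) * \<phi> i p)"
    define w where "w = (\<lambda>x. \<Sum>i<n. Q v (\<phi> i) * \<phi> i x)"
    define r where "r = (\<lambda>x. 1 * v x + (-1) * w x)"
    have \<phi>S: "\<phi> i \<in> S" if "i < n" for i using \<phi> that by (simp add: orthonormal_family_def)
    have wS: "w \<in> S" unfolding w_def by (intro S_sum) (auto simp: \<phi>S)
    have rS: "r \<in> S" unfolding r_def by (intro S_lin v wS)
    have orth: "Q r (\<phi> i) = 0" if "i < n" for i
    proof -
      have "Q r (\<phi> i) = 1 * Q v (\<phi> i) + (-1) * Q w (\<phi> i)"
        unfolding r_def by (rule Q_lin[OF v wS \<phi>S[OF that]])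
      moreover have "Q w (\<phi> i) = Q v (\<phi> i)"
        unfolding w_def by (rule orthonormal_family_Q_sum[OF \<phi> that])
      ultimately show ?thesis by simp
    qed
    have "r p \<noteq> 0" using ne by (simp add: r_def w_def)
    then have pos: "Q r r > 0" using Q_eq_0_iff[OF rS] Q_nonneg[OF rS] p by force
    \<comment> \<open>The vanishing second summand brings the normalised remainder into the form of
      the linearity assumptions.\<close>
    define e where "e = (\<lambda>x. (1 / sqrt (Q r r)) * r x + 0 * r x)"
    have eS: "e \<in> S" unfolding e_def by (intro S_lin rS)
    have Qe: "Q e z = Q r z / sqrt (Q r r)" if "z \<in> S" for z
      using Q_lin[OF rS rS that, of "1 / sqrt (Q r r)" 0] by (simp add: e_def)
    have "Q e e = Q r e / sqrt (Q r r)" by (rule Qe[OF eS])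
    also have "Q r e = Q r r / sqrt (Q r r)" using Q_sym[OF rS eS] Qe[OF rS] by simp
    finally have ee: "Q e e = 1" using pos by (simp add: divide_divide_eq_left)
    have e_orth: "Q e (\<phi> i) = 0" "Q (\<phi> i) e = 0" if "i < n" for i
      using Qe[OF \<phi>S[OF that]] orth[OF that] Q_sym[OF eS \<phi>S[OF that]] by auto
    have "orthonormal_family (Suc n) (\<phi>(n := e))"
      using \<phi> eS ee e_orth by (auto simp: orthonormal_family_def less_Suc_eq)
    then have "Suc n \<in> N" by (auto simp: N_def)
    then have "Suc n \<le> n" unfolding n_def using fin by (intro Max_ge)
    then show False by simp
  qed
qed

text \<open>Riesz representation: the representer has the coefficients \<open>l (\<phi> i)\<close>.
  The functional has to factor through the values on \<open>P\<close>, because expansions in the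
  basis are valid only there.\<close>

lemma ex_representer:
  assumes l_lin: "\<And>v w a b. v \<in> S \<Longrightarrow> w \<in> S \<Longrightarrow> l (\<lambda>x. a * v x + b * w x) = a * l v + b * l w"
    and l_cong: "\<And>v w. v \<in> S \<Longrightarrow> w \<in> S \<Longrightarrow> (\<And>p. p \<in> P \<Longrightarrow> v p = w p) \<Longrightarrow> l v = (l w :: real)"
  shows "\<exists>w\<in>S. \<forall>v\<in>S. Q w v = l v"
proof -
  obtain n \<phi> where \<phi>: "orthonormal_family n \<phi>"
    and basis: "\<And>v p. v \<in> S \<Longrightarrow> p \<in> P \<Longrightarrow> v p = (\<Sum>i<n. Q v (\<phi> i) * \<phi> i p)"
    using ex_orthonormal_basis by blast
  have \<phi>S: "\<phi> i \<in> S" if "i < n" for i using \<phi> that by (simp add: orthonormal_family_def)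
  have l_zero: "l (\<lambda>x. 0) = 0" using l_lin[OF S_zero S_zero, of 0 0] by simp
  have l_sum: "l (\<lambda>x. \<Sum>i\<in>I. c i * \<phi> i x) = (\<Sum>i\<in>I. c i * l (\<phi> i))" if "I \<subseteq> {..<n}" for I c
    using finite_subset[OF that finite_lessThan] that
  proof (induction I rule: finite_induct)
    case (insert i I)
    then show ?case
      using l_lin[of "\<phi> i" "\<lambda>x. \<Sum>i\<in>I. c i * \<phi> i x" "c i" 1] S_sum[of I \<phi> c] \<phi>S by (auto simp: subset_iff)
  qed (simp add: l_zero)
  define w where "w = (\<lambda>x. \<Sum>i<n. l (\<phi> i) * \<phi> i x)"
  have "w \<in> S" unfolding w_def by (intro S_sum) (auto simp: \<phi>S)
  moreover have "Q w v = l v" if v: "v \<in> S" for v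
  proof -
    have "Q w v = (\<Sum>i<n. l (\<phi> i) * Q (\<phi> i) v)"
      unfolding w_def by (intro Q_sum v) (auto simp: \<phi>S)
    also have "\<dots> = (\<Sum>i<n. Q v (\<phi> i) * l (\<phi> i))"
      using Q_sym[OF v] \<phi>S by (intro sum.cong) auto
    also have "\<dots> = l (\<lambda>x. \<Sum>i<n. Q v (\<phi> i) * \<phi> i x)" by (rule l_sum[symmetric]) simp
    also have "\<dots> = l v" by (rule l_cong) (use v basis \<phi>S in \<open>auto intro!: S_sum\<close>)
    finally show ?thesis .
  qed
  ultimately show ?thesis by blast
qed

end

section \<open>Linearity of \<open>H\<^sub>0\<^sup>1\<close> and of the finite element space\<close>

lemma Lp_space_2_iff:
  "v \<in> Lp_space 2 \<Omega> \<longleftrightarrow>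
     v \<in> borel_measurable (lebesgue_on \<Omega>) \<and> integrable (lebesgue_on \<Omega>) (\<lambda>x. (v x)\<^sup>2)"
  by (simp add: Lp_space_def)

lemma Lp_norm_2: "Lp_norm 2 \<Omega> v = sqrt (\<integral>x. (v x)\<^sup>2 \<partial>lebesgue_on \<Omega>)"
  by (simp add: Lp_norm_def powr_half_sqrt)

declare numeral_eq_ereal [simp del]


lemma Lp_space_2_integrable_mult:
  assumes "v \<in> Lp_space 2 \<Omega>" "w \<in> Lp_space 2 \<Omega>"
  shows "integrable (lebesgue_on \<Omega>) (\<lambda>x. v x * w x)"
proof (rule Bochner_Integration.integrable_bound)
  show "integrable (lebesgue_on \<Omega>) (\<lambda>x. (v x)\<^sup>2 + (w x)\<^sup>2)"
    using assms by (simp add: Lp_space_2_iff)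
  show "AE x in lebesgue_on \<Omega>. norm (v x * w x) \<le> norm ((v x)\<^sup>2 + (w x)\<^sup>2)"
  proof (rule AE_I2)
    fix x
    have "2 * (\<bar>v x\<bar> * \<bar>w x\<bar>) \<le> (v x)\<^sup>2 + (w x)\<^sup>2"
      using sum_squares_bound[of "\<bar>v x\<bar>" "\<bar>w x\<bar>"] by (simp add: mult_ac)
    moreover have "0 \<le> \<bar>v x\<bar> * \<bar>w x\<bar>" by simp
    ultimately show "norm (v x * w x) \<le> norm ((v x)\<^sup>2 + (w x)\<^sup>2)"
      unfolding real_norm_def abs_mult by linarith
  qed
qed (use assms in \<open>auto simp: Lp_space_2_iff\<close>)

lemma Lp_space_2_lin:
  assumes "v \<in> Lp_space 2 \<Omega>" "w \<in> Lp_space 2 \<Omega>"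
  shows "(\<lambda>x. a * v x + b * w x) \<in> Lp_space 2 \<Omega>"
proof -
  have "(\<lambda>x. (a * v x + b * w x)\<^sup>2) = (\<lambda>x. a\<^sup>2 * (v x)\<^sup>2 + b\<^sup>2 * (w x)\<^sup>2 + 2 * a * b * (v x * w x))"
    by (auto simp: power2_eq_square algebra_simps)
  then show ?thesis
    using assms Lp_space_2_integrable_mult[OF assms] by (auto simp: Lp_space_2_iff)
qed

lemma L2_inner_lin:
  assumes "v \<in> Lp_space 2 \<Omega>" "w \<in> Lp_space 2 \<Omega>" "z \<in> Lp_space 2 \<Omega>"
  shows "L2_inner \<Omega> (\<lambda>x. a * v x + b * w x) z = a * L2_inner \<Omega> v z + b * L2_inner \<Omega> w z"
proof -
  have "L2_inner \<Omega> (\<lambda>x. a * v x + b * w x) z =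
      (\<integral>x. a * (v x * z x) + b * (w x * z x) \<partial>lebesgue_on \<Omega>)"
    unfolding L2_inner_def by (simp add: algebra_simps)
  also have "\<dots> = a * L2_inner \<Omega> v z + b * L2_inner \<Omega> w z"
    unfolding L2_inner_def using assms by (simp add: Lp_space_2_integrable_mult)
  finally show ?thesis .
qed

lemma L2_inner_commute: "L2_inner \<Omega> v w = L2_inner \<Omega> w v"
  by (simp add: L2_inner_def mult.commute)

lemma Lp_norm_2_tendsto_0_iff:
  "(\<lambda>n. Lp_norm 2 \<Omega> (v n)) \<longlonglongrightarrow> 0 \<longleftrightarrow> (\<lambda>n. \<integral>x. (v n x)\<^sup>2 \<partial>lebesgue_on \<Omega>) \<longlonglongrightarrow> 0"
proof
  assume "(\<lambda>n. Lp_norm 2 \<Omega> (v n)) \<longlonglongrightarrow> 0"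
  from tendsto_power[OF this, of 2]
  show "(\<lambda>n. \<integral>x. (v n x)\<^sup>2 \<partial>lebesgue_on \<Omega>) \<longlonglongrightarrow> 0" by (simp add: Lp_norm_2)
next
  assume "(\<lambda>n. \<integral>x. (v n x)\<^sup>2 \<partial>lebesgue_on \<Omega>) \<longlonglongrightarrow> 0"
  from tendsto_real_sqrt[OF this] show "(\<lambda>n. Lp_norm 2 \<Omega> (v n)) \<longlonglongrightarrow> 0" by (simp add: Lp_norm_2)
qed

text \<open>For squared norms the pointwise inequality (x + y)^2 \<le> 2 x^2 + 2 y^2 takes the place
  of the triangle inequality in L2.\<close>

lemma Lp_norm_2_lin_tendsto_0:
  assumes v: "\<And>n. v n \<in> Lp_space 2 \<Omega>" and w: "\<And>n. w n \<in> Lp_space 2 \<Omega>"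
    and lim: "(\<lambda>n. Lp_norm 2 \<Omega> (v n)) \<longlonglongrightarrow> 0" "(\<lambda>n. Lp_norm 2 \<Omega> (w n)) \<longlonglongrightarrow> 0"
  shows "(\<lambda>n. Lp_norm 2 \<Omega> (\<lambda>x. a * v n x + b * w n x)) \<longlonglongrightarrow> 0"
  unfolding Lp_norm_2_tendsto_0_iff
proof (rule tendsto_sandwich)
  let ?I = "\<lambda>v. \<integral>x. (v x)\<^sup>2 \<partial>lebesgue_on \<Omega>"
  show "\<forall>\<^sub>F n in sequentially. 0 \<le> ?I (\<lambda>x. a * v n x + b * w n x)" by simp
  show "\<forall>\<^sub>F n in sequentially. ?I (\<lambda>x. a * v n x + b * w n x)
      \<le> 2 * a\<^sup>2 * ?I (v n) + 2 * b\<^sup>2 * ?I (w n)"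
  proof (rule always_eventually, rule allI)
    fix n
    have "?I (\<lambda>x. a * v n x + b * w n x) \<le>
        (\<integral>x. 2 * a\<^sup>2 * (v n x)\<^sup>2 + 2 * b\<^sup>2 * (w n x)\<^sup>2 \<partial>lebesgue_on \<Omega>)"
    proof (rule integral_mono)
      show "integrable (lebesgue_on \<Omega>) (\<lambda>x. (a * v n x + b * w n x)\<^sup>2)"
        using Lp_space_2_lin[OF v w] by (simp add: Lp_space_2_iff)
      show "integrable (lebesgue_on \<Omega>) (\<lambda>x. 2 * a\<^sup>2 * (v n x)\<^sup>2 + 2 * b\<^sup>2 * (w n x)\<^sup>2)"
        using v w by (simp add: Lp_space_2_iff)
      show "(a * v n x + b * w n x)\<^sup>2 \<le> 2 * a\<^sup>2 * (v n x)\<^sup>2 + 2 * b\<^sup>2 * (w n x)\<^sup>2" for x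
        using zero_le_power2[of "a * v n x - b * w n x"]
        by (simp add: power2_eq_square algebra_simps)
    qed
    then show "?I (\<lambda>x. a * v n x + b * w n x) \<le> 2 * a\<^sup>2 * ?I (v n) + 2 * b\<^sup>2 * ?I (w n)"
      using v w by (simp add: Lp_space_2_iff)
  qed
  have "(\<lambda>n. 2 * a\<^sup>2 * ?I (v n) + 2 * b\<^sup>2 * ?I (w n)) \<longlonglongrightarrow> 2 * a\<^sup>2 * 0 + 2 * b\<^sup>2 * 0"
    using lim unfolding Lp_norm_2_tendsto_0_iff by (intro tendsto_intros)
  then show "(\<lambda>n. 2 * a\<^sup>2 * ?I (v n) + 2 * b\<^sup>2 * ?I (w n)) \<longlonglongrightarrow> 0" by simp
qed simp

section \<open>Test functions and the space H_0^1\<close>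

lemma frechet_derivative_lin:
  fixes \<phi> \<psi> :: "'a::real_normed_vector \<Rightarrow> real"
  assumes "\<phi> differentiable at x" "\<psi> differentiable at x"
  shows "frechet_derivative (\<lambda>x. a * \<phi> x + b * \<psi> x) (at x) i =
    a * frechet_derivative \<phi> (at x) i + b * frechet_derivative \<psi> (at x) i"
proof -
  have "((\<lambda>x. a * \<phi> x + b * \<psi> x) has_derivative
      (\<lambda>i. a * frechet_derivative \<phi> (at x) i + b * frechet_derivative \<psi> (at x) i)) (at x)"
    using assms unfolding frechet_derivative_works by (auto intro!: derivative_eq_intros)
  from frechet_derivative_at[OF this] show ?thesis by metis
qed

lemma continuously_differentiable_lin:
  assumes "continuously_differentiable n \<phi>" "continuously_differentiable n \<psi>"
  shows "continuously_differentiable n (\<lambda>x. a * \<phi> x + b * \<psi> x)"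
  using assms
proof (induction n arbitrary: \<phi> \<psi>)
  case 0
  then show ?case by (auto intro!: continuous_intros)
next
  case (Suc n)
  then show ?case by (simp add: frechet_derivative_lin)
qed

lemma continuously_differentiable_zero:
  "continuously_differentiable n (\<lambda>x :: 'a::euclidean_space. 0)"
  by (induction n) auto

lemma test_functions_zero: "(\<lambda>x. 0) \<in> test_functions \<Omega>"
  by (simp add: test_functions_def continuously_differentiable_zero)

lemma test_functions_lin:
  assumes "\<phi> \<in> test_functions \<Omega>" "\<psi> \<in> test_functions \<Omega>"
  shows "(\<lambda>x. a * \<phi> x + b * \<psi> x) \<in> test_functions \<Omega>"
proof -
  have "{x. a * \<phi> x + b * \<psi> x \<noteq> 0} \<subseteq> {x. \<phi> x \<noteq> 0} \<union> {x. \<psi> x \<noteq> 0}" by auto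
  from closure_mono[OF this] have sub: "closure {x. a * \<phi> x + b * \<psi> x \<noteq> 0} \<subseteq> closure {x. \<phi> x \<noteq> 0} \<union> closure {x. \<psi> x \<noteq> 0}"
    unfolding closure_Un .
  have "compact (closure {x. \<phi> x \<noteq> 0} \<union> closure {x. \<psi> x \<noteq> 0})"
    using assms by (intro compact_Un) (auto simp: test_functions_def)
  then have "compact (closure {x. a * \<phi> x + b * \<psi> x \<noteq> 0})"
    unfolding compact_eq_bounded_closed using bounded_subset[OF _ sub] by simp
  moreover have "closure {x. a * \<phi> x + b * \<psi> x \<noteq> 0} \<subseteq> \<Omega>"
    using sub assms by (auto simp: test_functions_def)
  moreover have "continuously_differentiable n (\<lambda>x. a * \<phi> x + b * \<psi> x)" for n
    using assms by (intro continuously_differentiable_lin) (auto simp: test_functions_def)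
  ultimately show ?thesis by (simp add: test_functions_def)
qed

text \<open>Continuity is asked for up to the boundary: the closure is compact, so the function is
  bounded on a set of finite measure.\<close>

lemma continuous_in_Lp_space_2:
  fixes v :: "'a::euclidean_space \<Rightarrow> real"
  assumes v: "continuous_on (closure \<Omega>) v" and \<Omega>: "bounded \<Omega>" "\<Omega> \<in> sets lebesgue"
  shows "v \<in> Lp_space 2 \<Omega>"
proof -
  have meas: "v \<in> borel_measurable (lebesgue_on \<Omega>)"
    using v closure_subset \<Omega> by (intro continuous_imp_measurable_on_sets_lebesgue) (auto intro: continuous_on_subset)
  have "compact (v ` closure \<Omega>)"
    using v \<Omega> by (intro compact_continuous_image) (auto simp: compact_closure)
  then have "bounded (v ` closure \<Omega>)" by (rule compact_imp_bounded)
  then obtain B where B: "\<And>x. x \<in> closure \<Omega> \<Longrightarrow> \<bar>v x\<bar> \<le> B"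
    by (auto simp: bounded_iff)
  have "\<Omega> \<in> lmeasurable" using \<Omega> by (simp add: bounded_set_imp_lmeasurable)
  then have "finite_measure (lebesgue_on \<Omega>)" by (rule finite_measure_lebesgue_on)
  moreover have "AE x in lebesgue_on \<Omega>. norm ((v x)\<^sup>2) \<le> B\<^sup>2"
  proof (rule AE_I2)
    fix x assume "x \<in> space (lebesgue_on \<Omega>)"
    then have "\<bar>v x\<bar> \<le> B" using B closure_subset by (auto simp: space_restrict_space)
    then show "norm ((v x)\<^sup>2) \<le> B\<^sup>2" using abs_le_square_iff[of "v x" B] by simp
  qed
  ultimately have "integrable (lebesgue_on \<Omega>) (\<lambda>x. (v x)\<^sup>2)"
    using meas by (intro finite_measure.integrable_const_bound[where B = "B\<^sup>2"]) auto
  then show ?thesis using meas by (simp add: Lp_space_2_iff)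
qed

lemma test_functionsD:
  assumes "\<phi> \<in> test_functions \<Omega>"
  shows "continuous_on A \<phi>" "\<phi> differentiable at x"
    "i \<in> Basis \<Longrightarrow> continuous_on A (\<lambda>x. frechet_derivative \<phi> (at x) i)"
proof -
  have "continuously_differentiable 0 \<phi>" "continuously_differentiable (Suc 0) \<phi>"
    using assms unfolding test_functions_def by simp_all
  then show "continuous_on A \<phi>" "\<phi> differentiable at x"
    "i \<in> Basis \<Longrightarrow> continuous_on A (\<lambda>x. frechet_derivative \<phi> (at x) i)"
    by (auto intro: continuous_on_subset)
qed

lemma locally_integrable_lin:
  fixes v w :: "'a::euclidean_space \<Rightarrow> 'b::{banach, second_countable_topology}"
  assumes "locally_integrable \<Omega> v" "locally_integrable \<Omega> w"
  shows "locally_integrable \<Omega> (\<lambda>x. a *\<^sub>R v x + b *\<^sub>R w x)"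
  using assms unfolding locally_integrable_def by auto

context
  fixes \<Omega> :: "'a::euclidean_space set"
  assumes bdd: "bounded \<Omega>" and meas: "\<Omega> \<in> sets lebesgue"
begin

lemma test_functions_Lp_space_2:
  assumes "\<phi> \<in> test_functions \<Omega>"
  shows "\<phi> \<in> Lp_space 2 \<Omega>" "i \<in> Basis \<Longrightarrow> (\<lambda>x. frechet_derivative \<phi> (at x) i) \<in> Lp_space 2 \<Omega>"
  by (intro continuous_in_Lp_space_2 bdd meas test_functionsD[OF assms]; assumption)+

lemma H10_space_zero: "(\<lambda>x. 0) \<in> H10_space \<Omega>"
proof -
  have "has_weak_gradient \<Omega> (\<lambda>x. 0) (\<lambda>x. 0)"
    by (simp add: has_weak_gradient_def locally_integrable_def L2_inner_def)
  then show ?thesis unfolding H10_space_def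
    by (auto simp: Lp_space_2_iff Lp_norm_2 intro!: exI[of _ "\<lambda>x. 0"] exI[of _ "\<lambda>n x. 0"] test_functions_zero)
qed

text \<open>Membership asks for some weak gradient and some approximating sequence, so combinations
  of chosen ones serve. All integrals split because test functions and their first derivatives are
  continuous and hence square integrable on a bounded set.\<close>

lemma H10_space_lin:
  assumes v: "v \<in> H10_space \<Omega>" and w: "w \<in> H10_space \<Omega>"
  shows "(\<lambda>x. a * v x + b * w x) \<in> H10_space \<Omega>"
proof -
  obtain g1 \<phi>1 where v2: "v \<in> Lp_space 2 \<Omega>" and g1: "has_weak_gradient \<Omega> v g1"
    "\<And>i. i \<in> Basis \<Longrightarrow> (\<lambda>x. g1 x \<bullet> i) \<in> Lp_space 2 \<Omega>"
    and \<phi>1: "\<And>n. \<phi>1 n \<in> test_functions \<Omega>" "(\<lambda>n::nat. Lp_norm 2 \<Omega> (\<lambda>x. \<phi>1 n x - v x)) \<longlonglongrightarrow> 0"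
      "\<And>i. i \<in> Basis \<Longrightarrow>
           (\<lambda>n. Lp_norm 2 \<Omega> (\<lambda>x. frechet_derivative (\<phi>1 n) (at x) i - g1 x \<bullet> i)) \<longlonglongrightarrow> 0"
    using v unfolding H10_space_def mem_Collect_eq by (elim conjE exE) (rule that, (assumption | erule spec bspec)+)
  obtain g2 \<phi>2 where w2: "w \<in> Lp_space 2 \<Omega>" and g2: "has_weak_gradient \<Omega> w g2"
    "\<And>i. i \<in> Basis \<Longrightarrow> (\<lambda>x. g2 x \<bullet> i) \<in> Lp_space 2 \<Omega>"
    and \<phi>2: "\<And>n. \<phi>2 n \<in> test_functions \<Omega>" "(\<lambda>n::nat. Lp_norm 2 \<Omega> (\<lambda>x. \<phi>2 n x - w x)) \<longlonglongrightarrow> 0"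
      "\<And>i. i \<in> Basis \<Longrightarrow>
           (\<lambda>n. Lp_norm 2 \<Omega> (\<lambda>x. frechet_derivative (\<phi>2 n) (at x) i - g2 x \<bullet> i)) \<longlonglongrightarrow> 0"
    using w unfolding H10_space_def mem_Collect_eq by (elim conjE exE) (rule that, (assumption | erule spec bspec)+)
  define z where "z = (\<lambda>x. a * v x + b * w x)"
  define g where "g = (\<lambda>x. a *\<^sub>R g1 x + b *\<^sub>R g2 x)"
  define \<phi> where "\<phi> n = (\<lambda>x. a * \<phi>1 n x + b * \<phi>2 n x)" for n
  have gi: "(\<lambda>x. g x \<bullet> i) = (\<lambda>x. a * (g1 x \<bullet> i) + b * (g2 x \<bullet> i))" for i
    by (simp add: g_def inner_add_left)
  have grad: "has_weak_gradient \<Omega> z g"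
    unfolding has_weak_gradient_def
  proof (intro conjI ballI)
    show "locally_integrable \<Omega> z" "locally_integrable \<Omega> g"
      using g1(1) g2(1) locally_integrable_lin[of \<Omega> v w a b]
      unfolding has_weak_gradient_def z_def g_def by (auto intro: locally_integrable_lin)
    fix \<theta> and i :: 'a assume \<theta>: "\<theta> \<in> test_functions \<Omega>" and i: "i \<in> Basis"
    have "L2_inner \<Omega> z (\<lambda>x. frechet_derivative \<theta> (at x) i) =
        a * L2_inner \<Omega> v (\<lambda>x. frechet_derivative \<theta> (at x) i) +
        b * L2_inner \<Omega> w (\<lambda>x. frechet_derivative \<theta> (at x) i)"
      unfolding z_def by (rule L2_inner_lin[OF v2 w2 test_functions_Lp_space_2(2)[OF \<theta> i]])
    also have "\<dots> = - (a * L2_inner \<Omega> (\<lambda>x. g1 x \<bullet> i) \<theta> + b * L2_inner \<Omega> (\<lambda>x. g2 x \<bullet> i) \<theta>)"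
      using g1(1) g2(1) \<theta> i by (simp add: has_weak_gradient_def)
    also have "a * L2_inner \<Omega> (\<lambda>x. g1 x \<bullet> i) \<theta> + b * L2_inner \<Omega> (\<lambda>x. g2 x \<bullet> i) \<theta> =
        L2_inner \<Omega> (\<lambda>x. g x \<bullet> i) \<theta>"
      unfolding gi
      by (rule L2_inner_lin[OF g1(2)[OF i] g2(2)[OF i] test_functions_Lp_space_2(1)[OF \<theta>], symmetric])
    finally show "L2_inner \<Omega> z (\<lambda>x. frechet_derivative \<theta> (at x) i) = - L2_inner \<Omega> (\<lambda>x. g x \<bullet> i) \<theta>" .
  qed
  have diff: "(\<lambda>x. p x - q x) \<in> Lp_space 2 \<Omega>" if "p \<in> Lp_space 2 \<Omega>" "q \<in> Lp_space 2 \<Omega>" for p q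
    using Lp_space_2_lin[OF that, of 1 "-1"] by simp
  have lim0: "(\<lambda>n. Lp_norm 2 \<Omega> (\<lambda>x. \<phi> n x - z x)) \<longlonglongrightarrow> 0"
  proof -
    have "(\<lambda>n. Lp_norm 2 \<Omega> (\<lambda>x. a * (\<phi>1 n x - v x) + b * (\<phi>2 n x - w x))) \<longlonglongrightarrow> 0"
      by (intro Lp_norm_2_lin_tendsto_0 diff test_functions_Lp_space_2 \<phi>1 \<phi>2 v2 w2)
    then show ?thesis by (simp add: \<phi>_def z_def algebra_simps)
  qed
  have lim1: "(\<lambda>n. Lp_norm 2 \<Omega> (\<lambda>x. frechet_derivative (\<phi> n) (at x) i - g x \<bullet> i)) \<longlonglongrightarrow> 0"
    if i: "i \<in> Basis" for i
  proof -
    have "(\<lambda>n. Lp_norm 2 \<Omega> (\<lambda>x. a * (frechet_derivative (\<phi>1 n) (at x) i - g1 x \<bullet> i)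
        + b * (frechet_derivative (\<phi>2 n) (at x) i - g2 x \<bullet> i))) \<longlonglongrightarrow> 0"
      by (intro Lp_norm_2_lin_tendsto_0 diff test_functions_Lp_space_2 \<phi>1 \<phi>2 g1 g2 i)
    moreover have "frechet_derivative (\<phi> n) (at x) i =
        a * frechet_derivative (\<phi>1 n) (at x) i + b * frechet_derivative (\<phi>2 n) (at x) i" for n x
      unfolding \<phi>_def by (intro frechet_derivative_lin test_functionsD[OF \<phi>1(1)] test_functionsD[OF \<phi>2(1)])
    ultimately show ?thesis by (simp add: gi[THEN fun_cong] algebra_simps)
  qed
  have "z \<in> H10_space \<Omega>"
    unfolding H10_space_def
  proof (intro CollectI conjI exI[of _ g] ballI exI[of _ \<phi>] allI)
    show "z \<in> Lp_space 2 \<Omega>" unfolding z_def by (rule Lp_space_2_lin[OF v2 w2])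
    show "(\<lambda>x. g x \<bullet> i) \<in> Lp_space 2 \<Omega>" if "i \<in> Basis" for i
      unfolding gi by (rule Lp_space_2_lin[OF g1(2)[OF that] g2(2)[OF that]])
    show "\<phi> n \<in> test_functions \<Omega>" for n
      unfolding \<phi>_def by (intro test_functions_lin \<phi>1 \<phi>2)
  qed (use grad lim0 lim1 in auto)
  then show ?thesis by (simp add: z_def)
qed

end

lemma fe_space_zero:
  assumes "bounded \<Omega>" "\<Omega> \<in> sets lebesgue"
  shows "(\<lambda>x. 0) \<in> fe_space \<Omega> M"
  using H10_space_zero[OF assms] by (auto simp: fe_space_def intro!: exI[of _ 0])

lemma fe_space_lin:
  assumes \<Omega>: "bounded \<Omega>" "\<Omega> \<in> sets lebesgue" and v: "v \<in> fe_space \<Omega> M" and w: "w \<in> fe_space \<Omega> M"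
  shows "(\<lambda>x. a * v x + b * w x) \<in> fe_space \<Omega> M"
proof -
  have "\<exists>d c. \<forall>x\<in>e. a * v x + b * w x = d \<bullet> x + c" if "e \<in> M" for e
  proof -
    have "\<exists>d c. \<forall>x\<in>e. v x = d \<bullet> x + c"
      using v that unfolding fe_space_def by simp
    then obtain d1 c1 where 1: "\<And>x. x \<in> e \<Longrightarrow> v x = d1 \<bullet> x + c1" by auto
    have "\<exists>d c. \<forall>x\<in>e. w x = d \<bullet> x + c"
      using w that unfolding fe_space_def by simp
    then obtain d2 c2 where 2: "\<And>x. x \<in> e \<Longrightarrow> w x = d2 \<bullet> x + c2" by auto
    show ?thesis
      by (intro exI[of _ "a *\<^sub>R d1 + b *\<^sub>R d2"] exI[of _ "a * c1 + b * c2"])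
         (simp add: 1 2 inner_add_left algebra_simps)
  qed
  moreover have "(\<lambda>x. a * v x + b * w x) \<in> H10_space \<Omega>"
    using v w by (intro H10_space_lin[OF \<Omega>]) (simp_all add: fe_space_def)
  ultimately show ?thesis by (simp add: fe_space_def)
qed

section \<open>The dual mesh\<close>

text \<open>Turns the perpendicular bisector of two points into the set of points equidistant from
  them; for equal points the condition becomes trivial.\<close>

lemma inner_midpoint_diff:
  fixes q p p' :: "'a::real_inner"
  shows "(q - midpoint p p') \<bullet> (p' - p) = ((q - p) \<bullet> (q - p) - (q - p') \<bullet> (q - p')) / 2"
  by (simp add: midpoint_def inner_simps inner_commute algebra_simps)

text \<open>Subtracting the quadratic equations leaves two linear ones for q - a. The assumption
  says that their determinant, twice the signed area of the triangle, is nonzero.\<close>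

lemma ex1_equidistant:
  fixes a b c :: "real^2"
  assumes D: "(b - a)$1 * (c - a)$2 - (b - a)$2 * (c - a)$1 \<noteq> 0"
  shows "\<exists>!q. (q - a) \<bullet> (q - a) = (q - b) \<bullet> (q - b) \<and> (q - a) \<bullet> (q - a) = (q - c) \<bullet> (q - c)"
proof -
  define u w where "u = b - a" and "w = c - a"
  define D where "D = u$1 * w$2 - u$2 * w$1"
  have D0: "D \<noteq> 0" using D by (simp add: D_def u_def w_def)
  have eq: "(q - a) \<bullet> (q - a) = (q - b) \<bullet> (q - b) \<and> (q - a) \<bullet> (q - a) = (q - c) \<bullet> (q - c)
      \<longleftrightarrow> 2 * ((q - a) \<bullet> u) = u \<bullet> u \<and> 2 * ((q - a) \<bullet> w) = w \<bullet> w" for q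
  proof -
    have *: "q - b = (q - a) - u" "q - c = (q - a) - w" by (simp_all add: u_def w_def)
    have N: "(y - z) \<bullet> (y - z) = y \<bullet> y - 2 * (y \<bullet> z) + z \<bullet> z" for y z :: "real^2"
      by (simp add: inner_diff_left inner_diff_right inner_commute)
    show ?thesis unfolding * N by auto
  qed
  have in2: "x \<bullet> y = x$1 * y$1 + x$2 * y$2" for x y :: "real^2"
    by (simp add: inner_vec_def sum_2)
  \<comment> \<open>Cramer's rule for the position of the circumcenter relative to a.\<close>
  define r :: "real^2" where "r = vector [(w$2 * (u \<bullet> u) - u$2 * (w \<bullet> w)) / (2 * D),
    (u$1 * (w \<bullet> w) - w$1 * (u \<bullet> u)) / (2 * D)]"
  have r1: "2 * D * r$1 = w$2 * (u \<bullet> u) - u$2 * (w \<bullet> w)"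
    and r2: "2 * D * r$2 = u$1 * (w \<bullet> w) - w$1 * (u \<bullet> u)"
    using D0 by (simp_all add: r_def)
  have Du: "D * (2 * (r \<bullet> u)) = D * (u \<bullet> u)"
  proof -
    have "D * (2 * (r \<bullet> u)) = (2 * D * r$1) * u$1 + (2 * D * r$2) * u$2"
      by (simp add: in2 algebra_simps)
    also have "\<dots> = D * (u \<bullet> u)"
      unfolding r1 r2 by (simp add: D_def algebra_simps in2)
    finally show ?thesis .
  qed
  have Dw: "D * (2 * (r \<bullet> w)) = D * (w \<bullet> w)"
  proof -
    have "D * (2 * (r \<bullet> w)) = (2 * D * r$1) * w$1 + (2 * D * r$2) * w$2"
      by (simp add: in2 algebra_simps)
    also have "\<dots> = D * (w \<bullet> w)"
      unfolding r1 r2 by (simp add: D_def algebra_simps in2)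
    finally show ?thesis .
  qed
  have r: "2 * (r \<bullet> u) = u \<bullet> u" "2 * (r \<bullet> w) = w \<bullet> w" using Du Dw D0 by simp_all
  show ?thesis
    unfolding eq
  proof (rule ex1I[of _ "a + r"])
    show "2 * ((a + r - a) \<bullet> u) = u \<bullet> u \<and> 2 * ((a + r - a) \<bullet> w) = w \<bullet> w" using r by simp
    fix q assume "2 * ((q - a) \<bullet> u) = u \<bullet> u \<and> 2 * ((q - a) \<bullet> w) = w \<bullet> w"
    then have "(q - a - r) \<bullet> u = 0" "(q - a - r) \<bullet> w = 0"
      using r by (simp_all add: inner_diff_left)
    then have s: "(q - a - r)$1 * u$1 + (q - a - r)$2 * u$2 = 0"
      "(q - a - r)$1 * w$1 + (q - a - r)$2 * w$2 = 0" by (simp_all only: in2)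
    \<comment> \<open>Multiplying the homogeneous system by the adjugate matrix isolates each
      coordinate of the difference of two solutions.\<close>
    have "D * (q - a - r)$1 = w$2 * ((q - a - r)$1 * u$1 + (q - a - r)$2 * u$2)
        - u$2 * ((q - a - r)$1 * w$1 + (q - a - r)$2 * w$2)"
      "D * (q - a - r)$2 = u$1 * ((q - a - r)$1 * w$1 + (q - a - r)$2 * w$2)
        - w$1 * ((q - a - r)$1 * u$1 + (q - a - r)$2 * u$2)"
      unfolding D_def by algebra+
    then have "(q - a - r)$1 = 0" "(q - a - r)$2 = 0" unfolding s using D0 by simp_all
    then have "q - a - r = 0" by (simp add: vec_eq_iff forall_2)
    then show "q = a + r" by (simp add: algebra_simps)
  qed
qed

text \<open>If the determinant vanished, the three corners would lie on the line through a with
  normal \<open>n\<close>, which is b - a turned by a right angle, and their hull would have empty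
  interior.\<close>

lemma triangle_det_nonzero:
  fixes a b c :: "real^2"
  assumes ne: "interior (convex hull {a, b, c}) \<noteq> {}" and ab: "a \<noteq> b"
  shows "(b - a)$1 * (c - a)$2 - (b - a)$2 * (c - a)$1 \<noteq> 0"
proof
  assume D: "(b - a)$1 * (c - a)$2 - (b - a)$2 * (c - a)$1 = 0"
  define n :: "real^2" where "n = vector [- ((b - a)$2), (b - a)$1]"
  have in2: "n \<bullet> y = - ((b - a)$2) * y$1 + (b - a)$1 * y$2" for y
    by (simp add: inner_vec_def sum_2 n_def)
  have "n \<noteq> 0"
  proof
    assume "n = 0"
    then have "n$1 = 0" "n$2 = 0" by simp_all
    then have "b = a" by (simp add: n_def vec_eq_iff forall_2)
    then show False using ab by simp
  qed
  have "n \<bullet> (b - a) = 0" "n \<bullet> (c - a) = 0" using D unfolding in2 by (simp_all add: algebra_simps)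
  then have "{a, b, c} \<subseteq> {x. n \<bullet> x = n \<bullet> a}" by (auto simp: inner_diff_right)
  then have "convex hull {a, b, c} \<subseteq> {x. n \<bullet> x = n \<bullet> a}"
    by (intro hull_minimal convex_hyperplane)
  then have "interior (convex hull {a, b, c}) \<subseteq> interior {x. n \<bullet> x = n \<bullet> a}" by (rule interior_mono)
  then show False using ne \<open>n \<noteq> 0\<close> by simp
qed

lemma affine_eq_on_hull:
  fixes d :: "'a::euclidean_space"
  assumes "\<And>x. x \<in> V \<Longrightarrow> d \<bullet> x + k = 0" "x \<in> convex hull V"
  shows "d \<bullet> x + k = 0"
proof -
  have "V \<subseteq> {x. d \<bullet> x = - k}" using assms(1) by (auto simp: eq_neg_iff_add_eq_0)
  then have "convex hull V \<subseteq> {x. d \<bullet> x = - k}" by (intro hull_minimal convex_hyperplane)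
  then show ?thesis using assms(2) by auto
qed

text \<open>A single mesh of the family. The last assumption is the trace of quasi-uniformity: every
  triangle contains a ball of positive radius.\<close>

locale fe_mesh =
  fixes \<Omega> :: "(real^2) set" and M :: "(real^2) set set"
  assumes domain: "convex_polygonal_domain \<Omega>" and triangulation: "triangulation_of \<Omega> M"
    and circumcenters: "circumcenters_inside M"
    and interior_nonempty: "\<And>e. e \<in> M \<Longrightarrow> interior e \<noteq> {}"
begin

lemma open_domain: "open \<Omega>" and bounded_domain: "bounded \<Omega>" and domain_nonempty: "\<Omega> \<noteq> {}"
  and convex_domain: "convex \<Omega>"
  using domain by (auto simp: convex_polygonal_domain_def)

lemma domain_lebesgue: "\<Omega> \<in> sets lebesgue" and domain_lmeasurable: "\<Omega> \<in> lmeasurable"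
  using open_domain bounded_domain by (auto simp: lmeasurable_open)

lemma finite_measure_domain: "finite_measure (lebesgue_on \<Omega>)"
  by (rule finite_measure_lebesgue_on[OF domain_lmeasurable])

lemma interior_closure_domain: "interior (closure \<Omega>) = \<Omega>"
  using convex_interior_closure[OF convex_domain] interior_open[OF open_domain] by simp

lemma compact_closure_domain: "compact (closure \<Omega>)"
  using bounded_domain by (simp add: compact_closure)

lemma finite_M: "finite M" and Union_M: "\<Union>M = closure \<Omega>"
  using triangulation by (auto simp: triangulation_of_def triangulation_def)

lemma mem_M_subset: "e \<in> M \<Longrightarrow> e \<subseteq> closure \<Omega>"
  using Union_M by auto

lemma triangleE:
  assumes "e \<in> M"
  obtains a b c where "e = convex hull {a, b, c}" "a \<noteq> b" "\<And>p. p extreme_point_of e \<longleftrightarrow> p \<in> {a, b, c}"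
proof -
  have "2 simplex e" using triangulation assms by (simp add: triangulation_of_def)
  then obtain C where C: "\<not> affine_dependent C" "card C = 3" "e = convex hull C"
    unfolding simplex by auto
  then obtain a b c where "C = {a, b, c}" "a \<noteq> b" unfolding card_3_iff by blast
  then show ?thesis
    using C extreme_point_of_convex_hull_affine_independent[OF C(1)] by (intro that[of a b c]) auto
qed

lemma mem_M_hull:
  assumes "e \<in> M"
  shows "e = convex hull {p. p extreme_point_of e}"
proof -
  obtain a b c where abc: "e = convex hull {a, b, c}" "\<And>p. p extreme_point_of e \<longleftrightarrow> p \<in> {a, b, c}"
    using triangleE[OF assms] by metis
  then have "{p. p extreme_point_of e} = {a, b, c}" by blast
  then show ?thesis using abc(1) by simp
qed

lemma finite_extreme_points: "e \<in> M \<Longrightarrow> finite {p. p extreme_point_of e}"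
  by (erule triangleE) auto

lemma mem_M_compact: "e \<in> M \<Longrightarrow> compact e" and mem_M_convex: "e \<in> M \<Longrightarrow> convex e"
  by (erule triangleE; simp add: finite_imp_compact_convex_hull)+

lemma mem_M_closed: "e \<in> M \<Longrightarrow> closed e"
  by (simp add: mem_M_compact compact_imp_closed)

lemma mesh_vertices_eq: "mesh_vertices M = (\<Union>e\<in>M. {p. p extreme_point_of e})"
  by (auto simp: mesh_vertices_def)

lemma finite_mesh_vertices: "finite (mesh_vertices M)"
  unfolding mesh_vertices_eq using finite_M finite_extreme_points by blast

lemma mesh_vertices_subset: "mesh_vertices M \<subseteq> closure \<Omega>"
  using mem_M_subset by (auto simp: mesh_vertices_def extreme_point_of_def)

text \<open>Justifies the definite description: for a nondegenerate triangle the conditions for all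
  pairs of corners reduce to two equations of equidistance, whose solution is unique.\<close>

lemma circumcenter_orthogonal:
  assumes e: "e \<in> M" and p: "p extreme_point_of e" "p' extreme_point_of e"
  shows "(circumcenter e - midpoint p p') \<bullet> (p' - p) = 0"
proof -
  obtain a b c where abc: "e = convex hull {a, b, c}" "a \<noteq> b"
    "\<And>p. p extreme_point_of e \<longleftrightarrow> p \<in> {a, b, c}"
    using triangleE[OF e] by metis
  let ?N = "\<lambda>q p :: real^2. (q - p) \<bullet> (q - p)"
  have iff: "(\<forall>p p'. p extreme_point_of e \<and> p' extreme_point_of e \<longrightarrow>
      (q - midpoint p p') \<bullet> (p' - p) = 0) \<longleftrightarrow> ?N q a = ?N q b \<and> ?N q a = ?N q c" for q
    unfolding abc(3) inner_midpoint_diff by auto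
  have "\<exists>!q. ?N q a = ?N q b \<and> ?N q a = ?N q c"
    using interior_nonempty[OF e] abc(1,2) by (intro ex1_equidistant triangle_det_nonzero) simp_all
  then have "\<exists>!q. \<forall>p p'. p extreme_point_of e \<and> p' extreme_point_of e \<longrightarrow>
      (q - midpoint p p') \<bullet> (p' - p) = 0"
    unfolding iff .
  from theI'[OF this] show ?thesis
    unfolding circumcenter_def[symmetric] using p by blast
qed

lemma subregion_compact: "e \<in> M \<Longrightarrow> compact (subregion e p)"
  using finite_extreme_points[of e]
  by (auto simp: subregion_def intro!: finite_imp_compact_convex_hull)

lemma midpoint_mem_M: "e \<in> M \<Longrightarrow> p \<in> e \<Longrightarrow> p' \<in> e \<Longrightarrow> midpoint p p' \<in> e"
  using mem_M_convex midpoint_in_closed_segment closed_segment_subset by blast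

lemma subregion_generators_subset:
  assumes "e \<in> M" "p extreme_point_of e"
  shows "insert (circumcenter e) {midpoint p p' |p'. p' extreme_point_of e} \<subseteq> e"
  using assms circumcenters midpoint_mem_M[OF assms(1)]
  by (auto simp: circumcenters_inside_def extreme_point_of_def)

lemma subregion_subset: "e \<in> M \<Longrightarrow> p extreme_point_of e \<Longrightarrow> subregion e p \<subseteq> e"
  unfolding subregion_def by (intro hull_minimal subregion_generators_subset mem_M_convex)

lemma dual_box_compact: "compact (dual_box M p)"
  unfolding dual_box_def using finite_M subregion_compact by (intro compact_UN) auto

lemma dual_box_closed: "closed (dual_box M p)"
  by (simp add: dual_box_compact compact_imp_closed)

lemma dual_box_subset: "dual_box M p \<subseteq> closure \<Omega>"
  using subregion_subset mem_M_subset unfolding dual_box_def by blast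

text \<open>Conformity of the triangulation excludes hanging vertices: p is a face of one triangle,
  hence of its intersection with e, which is in turn a face of e.\<close>

lemma vertex_extreme_point:
  assumes p: "p \<in> mesh_vertices M" and e: "e \<in> M" "p \<in> e"
  shows "p extreme_point_of e"
proof -
  obtain e0 where e0: "e0 \<in> M" "p extreme_point_of e0" using p by (auto simp: mesh_vertices_def)
  have "{p} face_of e0" using e0 by (simp add: face_of_singleton)
  then have "{p} face_of (e \<inter> e0)"
    by (rule face_of_subset) (use e e0 in \<open>auto simp: extreme_point_of_def\<close>)
  moreover have "(e \<inter> e0) face_of e"
    using triangulation e e0 by (simp add: triangulation_of_def triangulation_def)
  ultimately have "{p} face_of e" by (rule face_of_trans)
  then show ?thesis by (simp add: face_of_singleton)
qed

text \<open>An extreme point of e that lies in a subregion is extreme there too, so it must be one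
  of the generators of that hull. It is not the circumcenter, which is equidistant from p and p',
  and no midpoint, since such a point is inner to a segment of e or equals p'.\<close>

lemma vertex_not_in_other_box:
  assumes p: "p \<in> mesh_vertices M" and ne: "p \<noteq> p'"
  shows "p \<notin> dual_box M p'"
proof
  assume "p \<in> dual_box M p'"
  then obtain e where e: "e \<in> M" "p' extreme_point_of e" "p \<in> subregion e p'"
    by (auto simp: dual_box_def)
  let ?X = "insert (circumcenter e) {midpoint p' p'' |p''. p'' extreme_point_of e}"
  have pe: "p extreme_point_of e"
    using p e subregion_subset by (intro vertex_extreme_point) auto
  then have "{p} face_of e" by (simp add: face_of_singleton)
  then have "{p} face_of (convex hull ?X)"
    by (rule face_of_subset) (use e subregion_subset[OF e(1,2)] in \<open>auto simp: subregion_def\<close>)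
  then have "p \<in> ?X" by (intro extreme_point_of_convex_hull) (simp add: face_of_singleton)
  then show False
  proof
    assume "p = circumcenter e"
    then have "(p - p') \<bullet> (p - p') = 0"
      using circumcenter_orthogonal[OF e(1) pe e(2)] by (simp add: inner_midpoint_diff)
    then show False using ne by simp
  next
    assume "p \<in> {midpoint p' p'' |p''. p'' extreme_point_of e}"
    then obtain p'' where p'': "p = midpoint p' p''" "p'' extreme_point_of e" by auto
    then have "p' \<noteq> p''" using ne by auto
    then have "p \<in> open_segment p' p''" using p'' by simp
    then show False using pe e(2) p''(2) by (auto simp: extreme_point_of_def)
  qed
qed

text \<open>The other boxes are finitely many closed sets missing p, so a ball around p avoids them.
  Within this ball, the copy of e shrunk towards p provides interior points of the box of p, even if
  p lies on the boundary of the domain.\<close>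

lemma ex_open_box_interpolation_const:
  assumes p: "p \<in> mesh_vertices M"
  obtains U where "open U" "U \<noteq> {}" "U \<subseteq> \<Omega>" "\<And>v x. x \<in> U \<Longrightarrow> box_interpolation M v x = v p"
proof -
  obtain e where e: "e \<in> M" "p extreme_point_of e" using p by (auto simp: mesh_vertices_def)
  define C where "C = (\<Union>p'\<in>mesh_vertices M - {p}. dual_box M p')"
  have "closed C" unfolding C_def using finite_mesh_vertices by (intro closed_UN) (simp_all add: dual_box_closed)
  moreover have "p \<notin> C" using vertex_not_in_other_box[OF p] by (auto simp: C_def)
  ultimately obtain r where "r > 0" "ball p r \<subseteq> - C"
    using open_contains_ball[of "- C"] by (auto simp: open_Compl)
  then have r: "r > 0" "ball p r \<inter> C = {}" by auto
  \<comment> \<open>The image of e under the homothety with center p and ratio 1/2; its corners are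
    p and the midpoints of the edges at p, all of them generators of the subregion.\<close>
  define K where "K = (\<lambda>x. (1/2) *\<^sub>R p + (1/2) *\<^sub>R x) ` e"
  have K_mid: "(1/2) *\<^sub>R p + (1/2) *\<^sub>R x = midpoint p x" for x
    by (simp add: midpoint_def scaleR_add_right)
  have "K = convex hull ((\<lambda>x. (1/2) *\<^sub>R p + (1/2) *\<^sub>R x) ` {p'. p' extreme_point_of e})"
    unfolding K_def convex_hull_affinity using mem_M_hull[OF e(1)] by simp
  also have "\<dots> \<subseteq> subregion e p"
    unfolding subregion_def K_mid by (rule hull_mono) auto
  finally have K_sub: "K \<subseteq> subregion e p" .
  have "convex K" unfolding K_def by (intro convex_affinity mem_M_convex e)
  have "(\<lambda>x. (1/2) *\<^sub>R p + (1/2) *\<^sub>R x) ` interior e \<subseteq> interior K"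
    unfolding K_def using interior_subset by (intro interior_maximal open_affinity) auto
  then have int: "interior K \<noteq> {}" using interior_nonempty[OF e(1)] by auto
  have "p \<in> K"
  proof -
    have "p = (1/2) *\<^sub>R p + (1/2) *\<^sub>R p" unfolding K_mid by simp
    moreover have "p \<in> e" using e(2) by (simp add: extreme_point_of_def)
    ultimately show ?thesis unfolding K_def by (rule image_eqI)
  qed
  then have "p \<in> closure (interior K)"
    using convex_closure_interior[OF \<open>convex K\<close> int] closure_subset by auto
  then have "ball p r \<inter> interior K \<noteq> {}"
    using r(1) open_Int_closure_eq_empty[of "ball p r" "interior K"] by force
  \<comment> \<open>Boxes are contained in the closed domain only; convexity makes the open domain
    the interior of its closure.\<close>
  moreover have "ball p r \<inter> interior K \<subseteq> \<Omega>"
  proof -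
    have "interior K \<subseteq> interior (closure \<Omega>)"
      using K_sub subregion_subset[OF e] mem_M_subset[OF e(1)] by (intro interior_mono) auto
    then show ?thesis unfolding interior_closure_domain by auto
  qed
  moreover have "box_interpolation M v x = v p" if x: "x \<in> ball p r \<inter> interior K" for v x
  proof -
    have "x \<in> dual_box M p"
      using x K_sub e interior_subset unfolding dual_box_def by blast
    moreover have "x \<notin> dual_box M p'" if "p' \<in> mesh_vertices M" "p' \<noteq> p" for p'
      using x r(2) that by (auto simp: C_def)
    ultimately have "box_interpolation M v x = (\<Sum>p'\<in>mesh_vertices M. if p' = p then v p else 0)"
      unfolding box_interpolation_def by (intro sum.cong) auto
    then show ?thesis using p finite_mesh_vertices by simp
  qed
  ultimately show ?thesis by (intro that[of "ball p r \<inter> interior K"]) auto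
qed

end

section \<open>Piecewise affine functions and the lumped inner product\<close>

context fe_mesh
begin

definition piecewise_affine :: "(real^2 \<Rightarrow> real) \<Rightarrow> bool" where
  "piecewise_affine v \<longleftrightarrow> (\<forall>e\<in>M. \<exists>a c. \<forall>x\<in>e. v x = a \<bullet> x + c)"

lemma piecewise_affineE:
  assumes "piecewise_affine v"
  obtains a c where "\<And>e x. e \<in> M \<Longrightarrow> x \<in> e \<Longrightarrow> v x = a e \<bullet> x + c e"
proof -
  have "\<exists>a. \<forall>e\<in>M. \<exists>c. \<forall>x\<in>e. v x = a e \<bullet> x + c"
    using assms unfolding piecewise_affine_def by (rule bchoice)
  then obtain a where "\<forall>e\<in>M. \<exists>c. \<forall>x\<in>e. v x = a e \<bullet> x + c" by blast
  from bchoice[OF this] obtain c where "\<forall>e\<in>M. \<forall>x\<in>e. v x = a e \<bullet> x + c e" by blast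
  then show ?thesis by (intro that[of a c]) auto
qed

lemma piecewise_affine_const: "piecewise_affine (\<lambda>_. k)"
  unfolding piecewise_affine_def by (intro ballI exI[of _ 0] exI[of _ k]) simp

lemma fe_space_iff: "v \<in> fe_space \<Omega> M \<longleftrightarrow> v \<in> H10_space \<Omega> \<and> piecewise_affine v"
  by (simp add: fe_space_def piecewise_affine_def)

lemma fe_space_piecewise_affine: "v \<in> fe_space \<Omega> M \<Longrightarrow> piecewise_affine v"
  by (simp add: fe_space_iff)

lemma piecewise_affine_continuous_on:
  assumes "piecewise_affine v"
  shows "continuous_on (closure \<Omega>) v"
proof -
  obtain a c where v: "\<And>e x. e \<in> M \<Longrightarrow> x \<in> e \<Longrightarrow> v x = a e \<bullet> x + c e"
    using piecewise_affineE[OF assms] by blast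
  have "continuous_on (\<Union>e\<in>M. e) v"
  proof (rule continuous_on_closed_Union)
    fix e assume e: "e \<in> M"
    have "continuous_on e (\<lambda>x. a e \<bullet> x + c e)" by (intro continuous_intros)
    then show "continuous_on e v" using v[OF e] by (simp cong: continuous_on_cong)
  qed (auto simp: finite_M mem_M_closed)
  then show ?thesis by (simp add: Union_M)
qed

lemma piecewise_affine_bounded:
  assumes "piecewise_affine v"
  obtains B where "\<And>x. x \<in> closure \<Omega> \<Longrightarrow> \<bar>v x\<bar> \<le> B"
proof -
  have "compact (v ` closure \<Omega>)"
    by (intro compact_continuous_image piecewise_affine_continuous_on assms compact_closure_domain)
  then have "bounded (v ` closure \<Omega>)" by (rule compact_imp_bounded)
  then show ?thesis using that by (auto simp: bounded_iff)
qed

text \<open>On each triangle the difference is affine and vanishes at the corners, hence on their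
  convex hull.\<close>

lemma piecewise_affine_eqI:
  assumes v: "piecewise_affine v" and w: "piecewise_affine w"
    and eq: "\<And>p. p \<in> mesh_vertices M \<Longrightarrow> v p = w p" and x: "x \<in> closure \<Omega>"
  shows "v x = w x"
proof -
  obtain e where e: "e \<in> M" "x \<in> e" using x Union_M by blast
  obtain a c where 1: "\<And>e x. e \<in> M \<Longrightarrow> x \<in> e \<Longrightarrow> v x = a e \<bullet> x + c e"
    using piecewise_affineE[OF v] by blast
  obtain a' c' where 2: "\<And>e x. e \<in> M \<Longrightarrow> x \<in> e \<Longrightarrow> w x = a' e \<bullet> x + c' e"
    using piecewise_affineE[OF w] by blast
  have diff: "v y - w y = (a e - a' e) \<bullet> y + (c e - c' e)" if "y \<in> e" for y
    using 1[OF e(1) that] 2[OF e(1) that] by (simp add: inner_diff_left)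
  have "(a e - a' e) \<bullet> x + (c e - c' e) = 0"
  proof (rule affine_eq_on_hull)
    show "x \<in> convex hull {p. p extreme_point_of e}" using e mem_M_hull by simp
    fix p assume p: "p \<in> {p. p extreme_point_of e}"
    then have "p \<in> e" "p \<in> mesh_vertices M" using e by (auto simp: extreme_point_of_def mesh_vertices_def)
    then show "(a e - a' e) \<bullet> p + (c e - c' e) = 0" using diff eq by force
  qed
  then show ?thesis using diff[OF e(2)] by simp
qed

lemma fe_space_lin_domain: "v \<in> fe_space \<Omega> M \<Longrightarrow> w \<in> fe_space \<Omega> M \<Longrightarrow> (\<lambda>x. a * v x + b * w x) \<in> fe_space \<Omega> M"
  by (rule fe_space_lin[OF bounded_domain domain_lebesgue])

lemma fe_space_Lp_space_2: "v \<in> fe_space \<Omega> M \<Longrightarrow> v \<in> Lp_space 2 \<Omega>"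
  by (intro continuous_in_Lp_space_2 piecewise_affine_continuous_on fe_space_piecewise_affine
      bounded_domain domain_lebesgue)

text \<open>Leads from almost everywhere to an actual point, as a nonempty open set is not null.
  Definiteness of both inner products below rests on it.\<close>

lemma L2_inner_self_eq_0D:
  assumes v: "v \<in> Lp_space 2 \<Omega>" and zero: "L2_inner \<Omega> v v = 0"
    and U: "open U" "U \<noteq> {}" "U \<subseteq> \<Omega>"
  shows "\<exists>x\<in>U. v x = 0"
proof (rule ccontr)
  assume "\<not> ?thesis"
  then have ne: "v x \<noteq> 0" if "x \<in> U" for x using that by blast
  have "integrable (lebesgue_on \<Omega>) (\<lambda>x. v x * v x)" by (intro Lp_space_2_integrable_mult v)
  then have "AE x in lebesgue_on \<Omega>. v x * v x = 0"
    using zero unfolding L2_inner_def by (subst (asm) integral_nonneg_eq_0_iff_AE) auto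
  then have "AE x in lebesgue. x \<in> \<Omega> \<longrightarrow> v x * v x = 0"
    by (subst (asm) AE_restrict_space_iff) (use domain_lebesgue in auto)
  then have "AE x in lebesgue. x \<notin> U"
    by (rule AE_mp) (use ne U in auto)
  then have "U \<in> null_sets lebesgue"
    by (subst (asm) AE_iff_null_sets[symmetric]) (use U in auto)
  then show False
    using open_not_negligible[OF U(1,2)] by (simp add: negligible_iff_null_sets)
qed

lemma L2_inner_self_nonneg: "0 \<le> L2_inner \<Omega> v v"
  unfolding L2_inner_def by simp

lemma L2_inner_cong:
  "(\<And>x. x \<in> \<Omega> \<Longrightarrow> v x = v' x) \<Longrightarrow> (\<And>x. x \<in> \<Omega> \<Longrightarrow> w x = w' x) \<Longrightarrow> L2_inner \<Omega> v w = L2_inner \<Omega> v' w'"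
  unfolding L2_inner_def by (rule Bochner_Integration.integral_cong) (auto simp: space_restrict_space)

text \<open>A vertex may lie on the boundary of the domain, so the affine formula of a triangle at p
  is used: if nonzero at p, it is nonzero on an open set that meets the interior of this triangle,
  because p is in the closure of that interior.\<close>

lemma L2_inner_fe_space_eq_0_iff:
  assumes v: "v \<in> fe_space \<Omega> M"
  shows "L2_inner \<Omega> v v = 0 \<longleftrightarrow> (\<forall>p\<in>mesh_vertices M. v p = 0)"
proof
  assume zero: "L2_inner \<Omega> v v = 0"
  show "\<forall>p\<in>mesh_vertices M. v p = 0"
  proof (rule ballI, rule ccontr)
    fix p assume "p \<in> mesh_vertices M" and ne: "v p \<noteq> 0"
    then obtain e where e: "e \<in> M" "p extreme_point_of e" by (auto simp: mesh_vertices_def)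
    then have pe: "p \<in> e" by (simp add: extreme_point_of_def)
    obtain a c where "\<And>e x. e \<in> M \<Longrightarrow> x \<in> e \<Longrightarrow> v x = a e \<bullet> x + c e"
      using piecewise_affineE[OF fe_space_piecewise_affine[OF v]] by blast
    then have a: "\<And>x. x \<in> e \<Longrightarrow> v x = a e \<bullet> x + c e" using e by blast
    have op: "open {x. a e \<bullet> x + c e \<noteq> 0}"
      by (intro open_Collect_neq continuous_intros)
    have "p \<in> closure (interior e)"
      using convex_closure_interior[OF mem_M_convex interior_nonempty] e(1) pe closure_subset by auto
    moreover have "p \<in> {x. a e \<bullet> x + c e \<noteq> 0}" using a[OF pe] ne by simp
    ultimately have "{x. a e \<bullet> x + c e \<noteq> 0} \<inter> interior e \<noteq> {}"
      using open_Int_closure_eq_empty[OF op, of "interior e"] by blast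
    moreover have "interior e \<subseteq> \<Omega>"
      using interior_mono[OF mem_M_subset[OF e(1)]] interior_closure_domain by simp
    ultimately obtain x where "x \<in> {x. a e \<bullet> x + c e \<noteq> 0} \<inter> interior e" "v x = 0"
      using L2_inner_self_eq_0D[OF fe_space_Lp_space_2[OF v] zero, of "{x. a e \<bullet> x + c e \<noteq> 0} \<inter> interior e"]
        op by (meson inf.coboundedI2 open_Int open_interior)
    then show False using a[of x] interior_subset by auto
  qed
next
  assume "\<forall>p\<in>mesh_vertices M. v p = 0"
  then have "v x = 0" if "x \<in> \<Omega>" for x
    using piecewise_affine_eqI[OF fe_space_piecewise_affine[OF v] piecewise_affine_const[of 0], of x]
      that closure_subset by auto
  then have "L2_inner \<Omega> v v = L2_inner \<Omega> (\<lambda>_. 0) (\<lambda>_. 0)" by (intro L2_inner_cong) auto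
  then show "L2_inner \<Omega> v v = 0" by (simp add: L2_inner_def)
qed

section \<open>Box interpolation and the two inner products on the finite element space\<close>

lemma dual_box_indicator_measurable:
  "indicat_real (dual_box M p) \<in> borel_measurable (lebesgue_on \<Omega>)"
proof -
  have "indicat_real (dual_box M p) \<in> borel_measurable borel"
    by (intro borel_measurable_indicator borel_closed dual_box_closed)
  then have "indicat_real (dual_box M p) \<in> borel_measurable lebesgue"
    by (intro measurable_completion) simp
  then show ?thesis by (rule measurable_restrict_space1)
qed

lemma dual_box_indicator_Lp_space_2: "indicat_real (dual_box M p) \<in> Lp_space 2 \<Omega>"
  unfolding Lp_space_2_iff
proof
  show "integrable (lebesgue_on \<Omega>) (\<lambda>x. (indicat_real (dual_box M p) x)\<^sup>2)"
  proof (rule finite_measure.integrable_const_bound[OF finite_measure_domain, where B = 1])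
    show "(\<lambda>x. (indicat_real (dual_box M p) x)\<^sup>2) \<in> borel_measurable (lebesgue_on \<Omega>)"
      by (intro borel_measurable_power dual_box_indicator_measurable)
  qed (simp add: indicator_def)
qed (rule dual_box_indicator_measurable)

lemma box_interpolation_Lp_space_2: "box_interpolation M v \<in> Lp_space 2 \<Omega>"
proof -
  have "(\<lambda>x. \<Sum>p\<in>P. v p * indicator (dual_box M p) x) \<in> Lp_space 2 \<Omega>" for P
  proof (induction P rule: infinite_finite_induct)
    case (insert p P)
    then show ?case
      using Lp_space_2_lin[OF dual_box_indicator_Lp_space_2 insert.IH, of "v p" p 1]
      by (simp only: sum.insert[OF insert.hyps] mult_1_left)
  qed (simp_all add: Lp_space_2_iff)
  then show ?thesis unfolding box_interpolation_def[abs_def] .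
qed

lemma box_interpolation_lin:
  "box_interpolation M (\<lambda>x. a * v x + b * w x) =
     (\<lambda>x. a * box_interpolation M v x + b * box_interpolation M w x)"
  by (auto simp: box_interpolation_def algebra_simps sum.distrib sum_distrib_left)

lemma L2_inner_box_interpolation:
  assumes z: "\<And>p. p \<in> mesh_vertices M \<Longrightarrow> integrable (lebesgue_on \<Omega>) (\<lambda>x. z x * indicator (dual_box M p) x)"
  shows "L2_inner \<Omega> z (box_interpolation M v) =
    (\<Sum>p\<in>mesh_vertices M. v p * L2_inner \<Omega> z (indicator (dual_box M p)))"
proof -
  have "L2_inner \<Omega> z (box_interpolation M v) =
      (\<integral>x. (\<Sum>p\<in>mesh_vertices M. v p * (z x * indicator (dual_box M p) x)) \<partial>lebesgue_on \<Omega>)"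
    unfolding L2_inner_def box_interpolation_def by (simp add: sum_distrib_left mult_ac)
  also have "\<dots> = (\<Sum>p\<in>mesh_vertices M. v p * L2_inner \<Omega> z (indicator (dual_box M p)))"
    unfolding L2_inner_def using z by (subst Bochner_Integration.integral_sum) auto
  finally show ?thesis .
qed

definition lumped_inner :: "(real^2 \<Rightarrow> real) \<Rightarrow> (real^2 \<Rightarrow> real) \<Rightarrow> real" where
  "lumped_inner v w = L2_inner \<Omega> (box_interpolation M v) (box_interpolation M w)"

text \<open>For fixed w the form is a finite combination of nodal values of v with constant
  coefficients. This lets time derivatives pass through it and shows that it sees nodal values
  only.\<close>

lemma lumped_inner_sum:
  "lumped_inner v w = (\<Sum>p\<in>mesh_vertices M. v p * L2_inner \<Omega> (box_interpolation M w) (indicator (dual_box M p)))"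
  unfolding lumped_inner_def L2_inner_commute[of _ "box_interpolation M v"]
  by (intro L2_inner_box_interpolation Lp_space_2_integrable_mult box_interpolation_Lp_space_2
      dual_box_indicator_Lp_space_2)

sublocale lumped: nodal_inner_space "fe_space \<Omega> M" lumped_inner "mesh_vertices M"
proof
  show "lumped_inner (\<lambda>x. a * v x + b * w x) z = a * lumped_inner v z + b * lumped_inner w z" for v w z a b
    unfolding lumped_inner_def box_interpolation_lin
    by (intro L2_inner_lin box_interpolation_Lp_space_2)
  show "lumped_inner v w = lumped_inner w v" for v w
    unfolding lumped_inner_def by (rule L2_inner_commute)
  show "0 \<le> lumped_inner v v" for v unfolding lumped_inner_def by (rule L2_inner_self_nonneg)
  show "lumped_inner v v = 0 \<longleftrightarrow> (\<forall>p\<in>mesh_vertices M. v p = 0)" for v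
  proof
    assume zero: "lumped_inner v v = 0"
    show "\<forall>p\<in>mesh_vertices M. v p = 0"
    proof
      fix p assume "p \<in> mesh_vertices M"
      then obtain U where U: "open U" "U \<noteq> {}" "U \<subseteq> \<Omega>"
        "\<And>v x. x \<in> U \<Longrightarrow> box_interpolation M v x = v p"
        using ex_open_box_interpolation_const by metis
      then show "v p = 0"
        using L2_inner_self_eq_0D[OF box_interpolation_Lp_space_2 zero[unfolded lumped_inner_def] U(1-3)]
        by auto
    qed
  qed (simp add: lumped_inner_sum)
qed (rule finite_mesh_vertices fe_space_zero[OF bounded_domain domain_lebesgue] fe_space_lin_domain; assumption)+

text \<open>The second inner product on the same space serves the initial condition: the representer
  of \<open>L2_inner \<Omega> u0\<close> is the projection, and definiteness makes its nodal values
  unique.\<close>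

sublocale L2: nodal_inner_space "fe_space \<Omega> M" "L2_inner \<Omega>" "mesh_vertices M"
proof
  show "L2_inner \<Omega> (\<lambda>x. a * v x + b * w x) z = a * L2_inner \<Omega> v z + b * L2_inner \<Omega> w z"
    if "v \<in> fe_space \<Omega> M" "w \<in> fe_space \<Omega> M" "z \<in> fe_space \<Omega> M" for v w z a b
    by (intro L2_inner_lin fe_space_Lp_space_2 that)
qed (rule finite_mesh_vertices L2_inner_commute L2_inner_self_nonneg L2_inner_fe_space_eq_0_iff
    lumped.S_zero lumped.S_lin; assumption)+

lemma ex_L2_projection:
  assumes u0: "u0 \<in> Lp_space 2 \<Omega>"
  shows "\<exists>w. is_L2_projection \<Omega> (fe_space \<Omega> M) u0 w"
proof -
  have "\<exists>w\<in>fe_space \<Omega> M. \<forall>v\<in>fe_space \<Omega> M. L2_inner \<Omega> w v = L2_inner \<Omega> u0 v"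
  proof (rule L2.ex_representer)
    show "L2_inner \<Omega> u0 (\<lambda>x. a * v x + b * w x) = a * L2_inner \<Omega> u0 v + b * L2_inner \<Omega> u0 w"
      if "v \<in> fe_space \<Omega> M" "w \<in> fe_space \<Omega> M" for v w a b
      unfolding L2_inner_commute[of _ u0] by (intro L2_inner_lin fe_space_Lp_space_2 that u0)
    show "L2_inner \<Omega> u0 v = L2_inner \<Omega> u0 w"
      if "v \<in> fe_space \<Omega> M" "w \<in> fe_space \<Omega> M" "\<And>p. p \<in> mesh_vertices M \<Longrightarrow> v p = w p" for v w
      by (rule L2_inner_cong[OF refl piecewise_affine_eqI])
         (use that closure_subset in \<open>auto intro: fe_space_piecewise_affine\<close>)
  qed
  then show ?thesis by (auto simp: is_L2_projection_def)
qed

lemma L2_projection_unique: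
  assumes "is_L2_projection \<Omega> (fe_space \<Omega> M) u0 v" "is_L2_projection \<Omega> (fe_space \<Omega> M) u0 w"
    and p: "p \<in> mesh_vertices M"
  shows "v p = w p"
proof -
  have vw: "v \<in> fe_space \<Omega> M" "w \<in> fe_space \<Omega> M" using assms by (auto simp: is_L2_projection_def)
  define d where "d = (\<lambda>x. 1 * v x + (-1) * w x)"
  have d: "d \<in> fe_space \<Omega> M" unfolding d_def by (rule fe_space_lin_domain[OF vw])
  have "L2_inner \<Omega> d d = 1 * L2_inner \<Omega> v d + (-1) * L2_inner \<Omega> w d"
    by (subst d_def) (rule L2.Q_lin[OF vw d])
  also have "\<dots> = 0" using assms d by (simp add: is_L2_projection_def)
  finally have "d p = 0" using L2.Q_eq_0_iff[OF d] p by blast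
  then show ?thesis by (simp add: d_def)
qed

end

section \<open>Normal derivatives on the boundaries of boxes\<close>

text \<open>For two different unit normals, a small step from x in direction n - m leaves the
  half-plane of n but stays in that of m, although both describe b near x.\<close>

lemma is_outward_normal_unique:
  assumes n: "is_outward_normal b x n" and m: "is_outward_normal b x m"
  shows "n = m"
proof (rule ccontr)
  assume ne: "n \<noteq> m"
  have nn: "n \<bullet> n = 1" "m \<bullet> m = 1" using n m by (simp_all add: is_outward_normal_def norm_eq_1)
  have "0 < (n - m) \<bullet> (n - m)" using ne by simp
  then have lt: "n \<bullet> m < 1" using nn by (simp add: inner_diff_left inner_diff_right inner_commute)
  obtain \<epsilon>1 where \<epsilon>1: "\<epsilon>1 > 0" "\<And>y. y \<in> ball x \<epsilon>1 \<Longrightarrow> y \<in> b \<longleftrightarrow> (y - x) \<bullet> n \<le> 0"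
    using n by (auto simp: is_outward_normal_def)
  obtain \<epsilon>2 where \<epsilon>2: "\<epsilon>2 > 0" "\<And>y. y \<in> ball x \<epsilon>2 \<Longrightarrow> y \<in> b \<longleftrightarrow> (y - x) \<bullet> m \<le> 0"
    using m by (auto simp: is_outward_normal_def)
  \<comment> \<open>The step has length half the smaller radius, so it stays in both balls.\<close>
  define t where "t = min \<epsilon>1 \<epsilon>2 / (2 * norm (n - m))"
  have t: "t > 0" using \<epsilon>1 \<epsilon>2 ne by (simp add: t_def)
  have "norm (t *\<^sub>R (n - m)) = t * norm (n - m)" using t by simp
  also have "\<dots> = min \<epsilon>1 \<epsilon>2 / 2" using ne by (simp add: t_def)
  finally have "norm (t *\<^sub>R (n - m)) = min \<epsilon>1 \<epsilon>2 / 2" .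
  then have "x + t *\<^sub>R (n - m) \<in> ball x \<epsilon>1" "x + t *\<^sub>R (n - m) \<in> ball x \<epsilon>2"
    using \<epsilon>1(1) \<epsilon>2(1) by (simp_all add: dist_norm)
  then have "(t *\<^sub>R (n - m)) \<bullet> n \<le> 0 \<longleftrightarrow> (t *\<^sub>R (n - m)) \<bullet> m \<le> 0"
    using \<epsilon>1(2) \<epsilon>2(2) by fastforce
  moreover have "(t *\<^sub>R (n - m)) \<bullet> n = t * (1 - n \<bullet> m)" "(t *\<^sub>R (n - m)) \<bullet> m = t * (n \<bullet> m - 1)"
    using nn by (simp_all add: inner_diff_left inner_diff_right inner_commute)
  moreover have "t * (1 - n \<bullet> m) > 0" "t * (n \<bullet> m - 1) < 0"
    using t lt by (auto intro: mult_pos_pos mult_pos_neg)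
  ultimately show False by linarith
qed

lemma outward_normal_eq: "is_outward_normal b x n \<Longrightarrow> outward_normal b x = n"
  unfolding outward_normal_def using is_outward_normal_unique by (metis the_equality)

lemma outward_normal_cases:
  obtains "outward_normal b x = 0" "\<nexists>n. is_outward_normal b x n"
  | "is_outward_normal b x (outward_normal b x)"
proof (cases "\<exists>n. is_outward_normal b x n")
  case True
  then obtain n where "is_outward_normal b x n" by blast
  then show ?thesis using that(2) outward_normal_eq by metis
next
  case False
  then show ?thesis using that(1) by (simp add: outward_normal_def)
qed

lemma norm_outward_normal_le: "norm (outward_normal b x) \<le> 1"
  by (rule outward_normal_cases[of b x]) (simp_all add: is_outward_normal_def)

text \<open>Near x the frontier can only lie on the bounding line of the half-plane, and moving the
  base point along this line does not change the half-plane.\<close>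

lemma is_outward_normal_nearby:
  assumes n: "is_outward_normal b x n"
  obtains \<epsilon> where "\<epsilon> > 0" "\<And>y. y \<in> frontier b \<Longrightarrow> y \<in> ball x \<epsilon> \<Longrightarrow> is_outward_normal b y n"
proof -
  obtain \<epsilon> where \<epsilon>: "\<epsilon> > 0" "\<And>y. y \<in> ball x \<epsilon> \<Longrightarrow> y \<in> b \<longleftrightarrow> (y - x) \<bullet> n \<le> 0"
    using n by (auto simp: is_outward_normal_def)
  show ?thesis
  proof (rule that[OF \<epsilon>(1)])
    fix y assume y: "y \<in> frontier b" "y \<in> ball x \<epsilon>"
    have "\<not> (y - x) \<bullet> n < 0"
    proof
      assume lt: "(y - x) \<bullet> n < 0"
      let ?U = "ball x \<epsilon> \<inter> {z. (z - x) \<bullet> n < 0}"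
      have "open ?U" by (intro open_Int open_ball open_Collect_less continuous_intros)
      moreover have "?U \<subseteq> b" using \<epsilon>(2) by force
      ultimately have "y \<in> interior b" using lt y by (intro interiorI[of ?U]) auto
      then show False using y by (simp add: frontier_def)
    qed
    moreover have "\<not> (y - x) \<bullet> n > 0"
    proof
      assume gt: "(y - x) \<bullet> n > 0"
      let ?U = "ball x \<epsilon> \<inter> {z. 0 < (z - x) \<bullet> n}"
      have "open ?U" by (intro open_Int open_ball open_Collect_less continuous_intros)
      moreover have "?U \<inter> b = {}" using \<epsilon>(2) by force
      ultimately have "?U \<inter> closure b = {}" using open_Int_closure_eq_empty by blast
      then show False using y gt by (auto simp: frontier_def)
    qed
    ultimately have 0: "(y - x) \<bullet> n = 0" by simp
    show "is_outward_normal b y n"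
      unfolding is_outward_normal_def
    proof (intro conjI exI[of _ "\<epsilon> - dist x y"] ballI)
      show "norm n = 1" using n by (simp add: is_outward_normal_def)
      show "\<epsilon> - dist x y > 0" using y by simp
      fix z assume "z \<in> ball y (\<epsilon> - dist x y)"
      then have "z \<in> ball x \<epsilon>" using dist_triangle[of x z y] by simp
      then have "z \<in> b \<longleftrightarrow> (z - x) \<bullet> n \<le> 0" by (rule \<epsilon>(2))
      also have "(z - x) \<bullet> n = (z - y) \<bullet> n" using 0 by (simp add: inner_diff_left)
      finally show "z \<in> b \<longleftrightarrow> (z - y) \<bullet> n \<le> 0" .
    qed
  qed
qed

text \<open>Where it exists, the normal is locally constant along the frontier.\<close>

lemma outward_normal_borel_measurable:
  "(\<lambda>x. indicat_real (frontier b) x *\<^sub>R outward_normal b x) \<in> borel_measurable borel"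
proof -
  let ?f = "\<lambda>x. indicat_real (frontier b) x *\<^sub>R outward_normal b x"
  \<comment> \<open>The points with a normal in W form a relatively open part of the closed frontier
    for every set W, because the normal is locally constant. Points without a normal are kept apart;
    there the function is 0.\<close>
  define E where "E W = {x \<in> frontier b. (\<exists>n. is_outward_normal b x n) \<and> outward_normal b x \<in> W}" for W
  have E: "E W \<in> sets borel" for W
  proof -
    have "\<exists>\<epsilon>>0. frontier b \<inter> ball x \<epsilon> \<subseteq> E W" if "x \<in> E W" for x
    proof -
      obtain n where n: "is_outward_normal b x n" using \<open>x \<in> E W\<close> by (auto simp: E_def)
      obtain \<epsilon> where \<epsilon>: "\<epsilon> > 0" "\<And>y. y \<in> frontier b \<Longrightarrow> y \<in> ball x \<epsilon> \<Longrightarrow> is_outward_normal b y n"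
        using is_outward_normal_nearby[OF n] by blast
      have "outward_normal b y \<in> W" if "is_outward_normal b y n" for y
        using \<open>x \<in> E W\<close> outward_normal_eq[OF n] outward_normal_eq[OF that] by (simp add: E_def)
      then have "frontier b \<inter> ball x \<epsilon> \<subseteq> E W" unfolding E_def using \<epsilon>(2) by blast
      then show ?thesis using \<epsilon>(1) by blast
    qed
    then obtain \<epsilon> where \<epsilon>: "\<And>x. x \<in> E W \<Longrightarrow> \<epsilon> x > 0" "\<And>x. x \<in> E W \<Longrightarrow> frontier b \<inter> ball x (\<epsilon> x) \<subseteq> E W"
      by metis
    have "E W = frontier b \<inter> (\<Union>x\<in>E W. ball x (\<epsilon> x))"
    proof
      show "E W \<subseteq> frontier b \<inter> (\<Union>x\<in>E W. ball x (\<epsilon> x))"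
        using \<epsilon>(1) by (fastforce simp: E_def)
      show "frontier b \<inter> (\<Union>x\<in>E W. ball x (\<epsilon> x)) \<subseteq> E W" using \<epsilon>(2) by blast
    qed
    moreover have "open (\<Union>x\<in>E W. ball x (\<epsilon> x))" by blast
    ultimately show ?thesis by (metis borel_closed borel_open frontier_closed sets.Int)
  qed
  show ?thesis
  proof (rule measurableI)
    fix W :: "(real^2) set"
    have f0: "?f x = 0" if "x \<notin> E UNIV" for x
      using that by (auto simp: E_def indicator_def outward_normal_def)
    have fE: "?f x = outward_normal b x" if "x \<in> E UNIV" for x
      using that by (auto simp: E_def)
    have "?f -` W \<inter> space borel = E W \<union> (if 0 \<in> W then - E UNIV else {})"
    proof (intro set_eqI)
      fix x
      show "x \<in> ?f -` W \<inter> space borel \<longleftrightarrow> x \<in> E W \<union> (if 0 \<in> W then - E UNIV else {})"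
      proof (cases "x \<in> E UNIV")
        case True
        then show ?thesis using fE[OF True] by (auto simp: E_def)
      next
        case False
        then have "x \<notin> E W" by (auto simp: E_def)
        then show ?thesis using f0[OF False] False by auto
      qed
    qed
    moreover have "- E UNIV \<in> sets borel" using E[of UNIV] by (rule borel_comp)
    ultimately show "?f -` W \<inter> space borel \<in> sets borel" using E[of W] by auto
  qed simp
qed

context fe_mesh
begin

text \<open>
  Near \<open>x\<close> only the finitely many closed triangles through \<open>x\<close> matter, so the beginning of the
  inward ray stays in one of them.
\<close>

lemma inward_ray_in_triangle:
  assumes x: "x \<in> dual_box M p"
  obtains e \<delta> where "e \<in> M" "\<delta> > 0" "\<And>s. s \<in> {-\<delta>..0} \<Longrightarrow> x + s *\<^sub>R outward_normal (dual_box M p) x \<in> e"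
proof -
  define N where "N = outward_normal (dual_box M p) x"
  \<comment> \<open>If x has no normal, the default value 0 shrinks the ray to the point x
    itself.\<close>
  have "\<exists>\<epsilon>>0. \<forall>s\<in>{-\<epsilon>..0}. x + s *\<^sub>R N \<in> dual_box M p"
  proof (rule outward_normal_cases[of "dual_box M p" x])
    assume "outward_normal (dual_box M p) x = 0"
    then show ?thesis using x by (intro exI[of _ 1]) (simp add: N_def)
  next
    assume "is_outward_normal (dual_box M p) x (outward_normal (dual_box M p) x)"
    then obtain \<epsilon> where n1: "norm N = 1" and \<epsilon>: "\<epsilon> > 0"
      "\<And>y. y \<in> ball x \<epsilon> \<Longrightarrow> y \<in> dual_box M p \<longleftrightarrow> (y - x) \<bullet> N \<le> 0"
      by (auto simp: is_outward_normal_def N_def)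
    have "x + s *\<^sub>R N \<in> dual_box M p" if s: "s \<in> {-(\<epsilon>/2)..0}" for s
    proof -
      have "x + s *\<^sub>R N \<in> ball x \<epsilon>" using s \<epsilon>(1) n1 by (simp add: dist_norm)
      moreover have "(x + s *\<^sub>R N - x) \<bullet> N \<le> 0"
        using s by (simp add: mult_le_0_iff)
      ultimately show ?thesis using \<epsilon>(2) by blast
    qed
    then show ?thesis using \<epsilon>(1) by (intro exI[of _ "\<epsilon>/2"]) auto
  qed
  then obtain \<epsilon> where \<epsilon>: "\<epsilon> > 0" "\<And>s. s \<in> {-\<epsilon>..0} \<Longrightarrow> x + s *\<^sub>R N \<in> closure \<Omega>"
    using dual_box_subset by blast
  define C where "C = \<Union>{e\<in>M. x \<notin> e}"
  have "closed C" unfolding C_def using finite_M mem_M_closed by (intro closed_Union) auto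
  moreover have "x \<in> - C" by (auto simp: C_def)
  ultimately obtain r where r: "r > 0" "ball x r \<subseteq> - C"
    using open_contains_ball[of "- C"] by (auto simp: open_Compl)
  define \<delta> where "\<delta> = min \<epsilon> (r / 2)"
  have \<delta>: "\<delta> > 0" "\<delta> \<le> \<epsilon>" "\<delta> < r" using \<epsilon>(1) r(1) by (auto simp: \<delta>_def)
  \<comment> \<open>The far end of the ray selects the triangle: y is so close to x that its
    triangle contains x as well, and convexity supplies the segment between them.\<close>
  define y where "y = x + (-\<delta>) *\<^sub>R N"
  have "y \<in> closure \<Omega>" unfolding y_def by (rule \<epsilon>(2)) (use \<delta> in auto)
  then obtain e where e: "e \<in> M" "y \<in> e" using Union_M by blast
  have "norm (\<delta> *\<^sub>R N) \<le> \<delta> * 1"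
    using norm_outward_normal_le \<delta>(1) unfolding N_def norm_scaleR by (intro mult_mono) auto
  then have "norm (\<delta> *\<^sub>R N) < r" using \<delta>(3) by linarith
  then have "y \<in> ball x r" by (simp add: y_def dist_norm)
  then have "y \<notin> C" using r(2) by auto
  then have xe: "x \<in> e" using e by (auto simp: C_def)
  show ?thesis
  proof (rule that[OF e(1) \<delta>(1)])
    fix s assume s: "s \<in> {-\<delta>..0}"
    define \<tau> where "\<tau> = - s / \<delta>"
    have \<tau>: "0 \<le> \<tau>" "\<tau> \<le> 1" "\<tau> * \<delta> = - s" using s \<delta>(1) by (auto simp: \<tau>_def field_simps)
    have "(1 - \<tau>) *\<^sub>R x + \<tau> *\<^sub>R y \<in> e"
      by (rule convexD_alt[OF mem_M_convex[OF e(1)] xe e(2) \<tau>(1,2)])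
    also have "(1 - \<tau>) *\<^sub>R x + \<tau> *\<^sub>R y = x - (\<tau> * \<delta>) *\<^sub>R N"
      by (simp add: y_def algebra_simps)
    finally show "x + s *\<^sub>R outward_normal (dual_box M p) x \<in> e" by (simp add: \<tau>(3) N_def)
  qed
qed

section \<open>One-sided normal derivatives of piecewise affine functions\<close>

lemma has_derivative_along_ray:
  fixes N :: "real^2"
  assumes \<delta>: "\<delta> > 0" "\<And>s. s \<in> {-\<delta>..0} \<Longrightarrow> x + s *\<^sub>R N \<in> e"
    and u: "\<And>y. y \<in> e \<Longrightarrow> u y = a \<bullet> y + c"
  shows "((\<lambda>s. u (x + s *\<^sub>R N)) has_vector_derivative a \<bullet> N) (at_left 0)"
proof -
  have "((\<lambda>s. a \<bullet> x + s * (a \<bullet> N) + c) has_vector_derivative a \<bullet> N) (at 0 within {..0})"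
    unfolding has_real_derivative_iff_has_vector_derivative[symmetric]
    by (auto intro!: derivative_eq_intros)
  then have "((\<lambda>s. u (x + s *\<^sub>R N)) has_vector_derivative a \<bullet> N) (at 0 within {..0})"
    by (rule has_vector_derivative_transform_within[OF _ \<delta>(1)])
       (auto simp: u[OF \<delta>(2)] dist_real_def inner_add_right)
  then show ?thesis by (rule has_vector_derivative_within_subset) auto
qed

text \<open>The slope a belongs to the triangle entered by the inward ray, so across an edge of the
  mesh it may depend on x. At corners the normal is 0 and both sides vanish.\<close>

lemma normal_derivative_eq:
  assumes "\<delta> > 0" "\<And>s. s \<in> {-\<delta>..0} \<Longrightarrow> x + s *\<^sub>R outward_normal b x \<in> e"
    and "\<And>y. y \<in> e \<Longrightarrow> u y = a \<bullet> y + c"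
  shows "normal_derivative b u x = a \<bullet> outward_normal b x"
  unfolding normal_derivative_def
  by (rule vector_derivative_within[OF trivial_limit_at_left_real has_derivative_along_ray[OF assms]])

text \<open>The ray and its triangle depend on x and the box alone, so one triangle serves all
  functions, and slopes are linear.\<close>

lemma normal_derivative_sum:
  assumes \<phi>: "\<And>i. i < n \<Longrightarrow> piecewise_affine (\<phi> i)" and x: "x \<in> dual_box M p"
  shows "normal_derivative (dual_box M p) (\<lambda>x. \<Sum>i<n. c i * \<phi> i x) x =
    (\<Sum>i<n. c i * normal_derivative (dual_box M p) (\<phi> i) x)"
proof -
  obtain e \<delta> where e: "e \<in> M" "\<delta> > 0"
    "\<And>s. s \<in> {-\<delta>..0} \<Longrightarrow> x + s *\<^sub>R outward_normal (dual_box M p) x \<in> e"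
    using inward_ray_in_triangle[OF x] by blast
  have "\<exists>a d. \<forall>y\<in>e. \<phi> i y = a \<bullet> y + d" if "i < n" for i
    using \<phi>[OF that] e(1) by (simp add: piecewise_affine_def)
  then obtain a d where a: "\<And>i y. i < n \<Longrightarrow> y \<in> e \<Longrightarrow> \<phi> i y = a i \<bullet> y + d i" by metis
  have nd: "normal_derivative (dual_box M p) (\<phi> i) x = a i \<bullet> outward_normal (dual_box M p) x" if "i < n" for i
    by (rule normal_derivative_eq[OF e(2,3) a[OF that]])
  have "normal_derivative (dual_box M p) (\<lambda>x. \<Sum>i<n. c i * \<phi> i x) x =
      (\<Sum>i<n. c i *\<^sub>R a i) \<bullet> outward_normal (dual_box M p) x"
    by (rule normal_derivative_eq[OF e(2,3), where c = "\<Sum>i<n. c i * d i"])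
       (auto simp: a inner_sum_left sum.distrib[symmetric] algebra_simps intro!: sum.cong)
  then show ?thesis using nd by (simp add: inner_sum_left)
qed

lemma normal_derivative_cong:
  assumes u: "piecewise_affine u" and eq: "\<And>y. y \<in> closure \<Omega> \<Longrightarrow> u y = w y" and x: "x \<in> dual_box M p"
  shows "normal_derivative (dual_box M p) u x = normal_derivative (dual_box M p) w x"
proof -
  obtain e \<delta> where e: "e \<in> M" "\<delta> > 0"
    "\<And>s. s \<in> {-\<delta>..0} \<Longrightarrow> x + s *\<^sub>R outward_normal (dual_box M p) x \<in> e"
    using inward_ray_in_triangle[OF x] by blast
  have "\<exists>a d. \<forall>y\<in>e. u y = a \<bullet> y + d" using u e(1) by (simp add: piecewise_affine_def)
  then obtain a d where a: "\<And>y. y \<in> e \<Longrightarrow> u y = a \<bullet> y + d" by blast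
  have "w y = a \<bullet> y + d" if "y \<in> e" for y
    using a[OF that] eq[of y] mem_M_subset[OF e(1)] that by auto
  then show ?thesis using normal_derivative_eq[OF e(2,3)] a by metis
qed

lemma normal_derivative_bounded:
  assumes u: "piecewise_affine u"
  obtains K where "\<And>p x. x \<in> dual_box M p \<Longrightarrow> \<bar>normal_derivative (dual_box M p) u x\<bar> \<le> K"
proof -
  obtain a c where a: "\<And>e x. e \<in> M \<Longrightarrow> x \<in> e \<Longrightarrow> u x = a e \<bullet> x + c e"
    using piecewise_affineE[OF u] by blast
  show ?thesis
  \<comment> \<open>The triangle met by the ray varies with x; the sum over all triangles dominates
    the slope on each of them.\<close>
  proof (rule that[of "\<Sum>e\<in>M. norm (a e)"])
    fix p x assume x: "x \<in> dual_box M p"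
    obtain e \<delta> where e: "e \<in> M" "\<delta> > 0"
      "\<And>s. s \<in> {-\<delta>..0} \<Longrightarrow> x + s *\<^sub>R outward_normal (dual_box M p) x \<in> e"
      using inward_ray_in_triangle[OF x] by blast
    have "\<bar>normal_derivative (dual_box M p) u x\<bar> = \<bar>a e \<bullet> outward_normal (dual_box M p) x\<bar>"
      using normal_derivative_eq[OF e(2,3) a[OF e(1)]] by simp
    also have "\<dots> \<le> norm (a e) * norm (outward_normal (dual_box M p) x)" by (rule Cauchy_Schwarz_ineq2)
    also have "\<dots> \<le> norm (a e) * 1" by (intro mult_left_mono norm_outward_normal_le) simp
    also have "\<dots> \<le> (\<Sum>e\<in>M. norm (a e))" unfolding mult_1_right by (intro member_le_sum e(1) finite_M) simp
    finally show "\<bar>normal_derivative (dual_box M p) u x\<bar> \<le> (\<Sum>e\<in>M. norm (a e))" .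
  qed
qed

lemma piecewise_affine_borel_measurable:
  assumes "piecewise_affine u"
  shows "(\<lambda>x. indicat_real (closure \<Omega>) x * u x) \<in> borel_measurable borel"
  using borel_measurable_continuous_on_indicator[OF _ piecewise_affine_continuous_on[OF assms]] by simp

lemma frontier_dual_box_subset: "frontier (dual_box M p) \<subseteq> dual_box M p"
  by (rule frontier_subset_closed[OF dual_box_closed])

text \<open>At each frontier point the backward difference quotients with step 1/(m+1) are
  eventually constant, since the function is affine along the beginning of the inward ray. Their
  pointwise limit is thus the normal derivative, and each quotient is Borel because the normal
  is.\<close>

lemma normal_derivative_borel_measurable:
  assumes u: "piecewise_affine u"
  shows "(\<lambda>x. indicat_real (frontier (dual_box M p)) x * normal_derivative (dual_box M p) u x)
    \<in> borel_measurable borel"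
proof (rule borel_measurable_LIMSEQ_real)
  define b where "b = dual_box M p"
  define N where "N x = indicat_real (frontier b) x *\<^sub>R outward_normal b x" for x
  \<comment> \<open>The values of u off the closed domain are arbitrary; cutting them off makes the
    quotients Borel on the whole plane.\<close>
  define v where "v x = indicat_real (closure \<Omega>) x * u x" for x
  define D where "D m x = indicat_real (frontier b) x *
      ((v x - v (x - (1 / real (Suc m)) *\<^sub>R N x)) * real (Suc m))" for m x
  have [measurable]: "N \<in> borel_measurable borel"
    unfolding N_def[abs_def] by (rule outward_normal_borel_measurable)
  have v[measurable]: "v \<in> borel_measurable borel"
    unfolding v_def[abs_def] by (rule piecewise_affine_borel_measurable[OF u])
  have [measurable]: "frontier b \<in> sets borel" by simp
  show "D m \<in> borel_measurable borel" for m
    unfolding D_def[abs_def] by measurable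
  fix x
  show "(\<lambda>m. D m x) \<longlonglongrightarrow>
      indicat_real (frontier (dual_box M p)) x * normal_derivative (dual_box M p) u x"
  proof (cases "x \<in> frontier b")
    case False
    then show ?thesis by (simp add: D_def b_def)
  next
    case True
    then have x: "x \<in> dual_box M p" using frontier_dual_box_subset by (auto simp: b_def)
    obtain e \<delta> where e: "e \<in> M" "\<delta> > 0" "\<And>s. s \<in> {-\<delta>..0} \<Longrightarrow> x + s *\<^sub>R outward_normal b x \<in> e"
      unfolding b_def using inward_ray_in_triangle[OF x] by blast
    have "\<exists>a d. \<forall>y\<in>e. u y = a \<bullet> y + d" using u e(1) by (simp add: piecewise_affine_def)
    then obtain a d where a: "\<And>y. y \<in> e \<Longrightarrow> u y = a \<bullet> y + d" by blast
    have va: "v y = a \<bullet> y + d" if "y \<in> e" for y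
      using a[OF that] mem_M_subset[OF e(1)] that by (auto simp: v_def)
    have Nx: "N x = outward_normal b x" using True by (simp add: N_def)
    have xe: "x \<in> e" using e(3)[of 0] e(2) by simp
    have "D m x = normal_derivative b u x" if m: "1 / real (Suc m) < \<delta>" for m
    proof -
      have "x - (1 / real (Suc m)) *\<^sub>R N x \<in> e"
        using e(3)[of "- (1 / real (Suc m))"] m by (simp add: Nx)
      then have "D m x = a \<bullet> outward_normal b x"
        using True xe by (simp add: D_def va Nx inner_diff_right del: of_nat_Suc)
      then show ?thesis using normal_derivative_eq[OF e(2,3) a] by simp
    qed
    moreover have "\<forall>\<^sub>F m in sequentially. 1 / real (Suc m) < \<delta>"
    proof -
      have "(\<lambda>m. 1 / real (Suc m)) \<longlonglongrightarrow> 0" using LIMSEQ_inverse_real_of_nat by (simp add: field_simps)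
      then show ?thesis using e(2) by (rule order_tendstoD(2))
    qed
    ultimately have "\<forall>\<^sub>F m in sequentially. D m x = normal_derivative b u x"
      by (auto elim: eventually_mono)
    then have "(\<lambda>m. D m x) \<longlonglongrightarrow> normal_derivative b u x" by (rule tendsto_eventually)
    then show ?thesis using True by (simp add: b_def)
  qed
qed

end

section \<open>The finite volume scheme as an ordinary differential equation\<close>

lemma uniformly_loc_lipschitz_reparam:
  assumes "uniformly_loc_lipschitz n A \<psi>" "\<And>s. s \<in> B \<Longrightarrow> y s \<in> A"
  shows "uniformly_loc_lipschitz n B (\<lambda>c s. \<psi> c (y s))"
  using assms unfolding uniformly_loc_lipschitz_def by meson

lemma uniformly_loc_lipschitz_cong:
  assumes "uniformly_loc_lipschitz n A \<psi>" "\<And>c s. s \<in> A \<Longrightarrow> \<psi> c s = \<psi>' c s"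
  shows "uniformly_loc_lipschitz n A \<psi>'"
  using assms unfolding uniformly_loc_lipschitz_def by simp

text \<open>Normal derivatives are controlled only on the box boundary, whereas the integrals run
  over whole sides; where the indicator vanishes there is nothing to estimate.\<close>

lemma uniformly_loc_lipschitz_indicator:
  assumes \<psi>: "uniformly_loc_lipschitz n A \<psi>"
  shows "uniformly_loc_lipschitz n B (\<lambda>c s. indicator A s * \<psi> c s)"
proof (rule uniformly_loc_lipschitzI)
  fix R
  obtain K where K: "K \<ge> 0" "\<And>c s. c \<in> coord_box n R \<Longrightarrow> s \<in> A \<Longrightarrow> \<bar>\<psi> c s\<bar> \<le> K"
    "\<And>c d s. c \<in> coord_box n R \<Longrightarrow> d \<in> coord_box n R \<Longrightarrow> s \<in> A \<Longrightarrow>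
       \<bar>\<psi> c s - \<psi> d s\<bar> \<le> K * coord_dist n c d"
    by (rule uniformly_loc_lipschitzE[OF \<psi>, of R]) blast
  show "\<exists>K1 K2. \<forall>c\<in>coord_box n R. \<forall>d\<in>coord_box n R. \<forall>s\<in>B.
     \<bar>indicator A s * \<psi> c s\<bar> \<le> K1 \<and>
     \<bar>indicator A s * \<psi> c s - indicator A s * \<psi> d s\<bar> \<le> K2 * coord_dist n c d"
    using K mult_nonneg_nonneg[OF K(1) coord_dist_nonneg]
    by (intro exI[of _ K]) (auto simp: indicator_def)
qed

lemma box_boundary_integral_mult_right:
  "box_boundary_integral M p (\<lambda>x. g x * c) = c * box_boundary_integral M p g"
proof -
  let ?J = "\<lambda>g a b. \<integral>s. indicator (frontier (dual_box M p)) (a + s *\<^sub>R (b - a)) * g (a + s *\<^sub>R (b - a))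
    \<partial>lebesgue_on {0..1}"
  have J: "?J (\<lambda>x. g x * c) a b = c * ?J g a b" for a b
  proof -
    have "?J (\<lambda>x. g x * c) a b = (\<integral>s. c * (indicator (frontier (dual_box M p)) (a + s *\<^sub>R (b - a)) *
        g (a + s *\<^sub>R (b - a))) \<partial>lebesgue_on {0..1})"
      by (simp only: mult_ac)
    then show ?thesis by (simp only: integral_mult_right_zero)
  qed
  show ?thesis
    unfolding box_boundary_integral_def J sum_distrib_left by (intro sum.cong) auto
qed

locale fve_scheme = fe_mesh +
  fixes lam :: real and f k :: "real \<Rightarrow> real" and C \<nu> :: real
  assumes f_lipschitz: "\<And>x y. \<bar>f x - f y\<bar> \<le> C * \<bar>x - y\<bar>"
    and k_lipschitz: "\<And>x y. \<bar>k x - k y\<bar> \<le> C * \<bar>x - y\<bar>"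
    and f_ge: "\<And>x. \<nu> \<le> f x" and \<nu>_pos: "\<nu> > 0"
begin

lemma f_continuous: "continuous_on A f" and k_continuous: "continuous_on A k"
proof -
  have "0 \<le> C" using f_lipschitz[of 1 0] by simp
  then have "C-lipschitz_on A f" "C-lipschitz_on A k"
    using f_lipschitz k_lipschitz by (auto simp: lipschitz_on_def dist_real_def)
  then show "continuous_on A f" "continuous_on A k" by (auto intro: lipschitz_on_continuous_on)
qed

definition flux :: "real^2 \<Rightarrow> (real^2 \<Rightarrow> real) \<Rightarrow> real" where
  "flux p u = box_boundary_integral M p (\<lambda>x. k (u x) * normal_derivative (dual_box M p) u x)"

definition total :: "(real^2 \<Rightarrow> real) \<Rightarrow> real" where
  "total u = (\<integral>x. f (u x) \<partial>lebesgue_on \<Omega>)"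

definition load :: "real^2 \<Rightarrow> (real^2 \<Rightarrow> real) \<Rightarrow> real" where
  "load p u = L2_inner \<Omega> (\<lambda>x. f (u x)) (indicator (dual_box M p))"

text \<open>The coefficient of the nodal value \<open>v p\<close> once every term of the scheme
  except the time derivative stands on the right.\<close>

definition nodal_rhs :: "real^2 \<Rightarrow> (real^2 \<Rightarrow> real) \<Rightarrow> real" where
  "nodal_rhs p u = flux p u + lam / (total u)\<^sup>2 * load p u"

lemma f_compose_Lp_space_2:
  assumes "piecewise_affine u"
  shows "(\<lambda>x. f (u x)) \<in> Lp_space 2 \<Omega>"
  by (intro continuous_in_Lp_space_2 bounded_domain domain_lebesgue)
     (rule continuous_on_compose2[OF f_continuous piecewise_affine_continuous_on[OF assms]], auto)

text \<open>Both the boundary terms and the load are linear in the test function through its nodal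
  values: \<open>v p\<close> is constant on a box boundary, and the box interpolant is a combination
  of indicators of boxes.\<close>

lemma scheme_iff:
  assumes u: "piecewise_affine u"
  shows "L2_inner \<Omega> (box_interpolation M ut) (box_interpolation M v)
       - (\<Sum>p\<in>mesh_vertices M. box_boundary_integral M p
            (\<lambda>x. k (u x) * normal_derivative (dual_box M p) u x * v p))
       = lam / (\<integral>x. f (u x) \<partial>lebesgue_on \<Omega>)\<^sup>2 * L2_inner \<Omega> (\<lambda>x. f (u x)) (box_interpolation M v)
     \<longleftrightarrow> lumped_inner ut v = (\<Sum>p\<in>mesh_vertices M. v p * nodal_rhs p u)"
proof -
  have 1: "L2_inner \<Omega> (\<lambda>x. f (u x)) (box_interpolation M v) = (\<Sum>p\<in>mesh_vertices M. v p * load p u)"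
    unfolding load_def
    by (intro L2_inner_box_interpolation Lp_space_2_integrable_mult f_compose_Lp_space_2 u
        dual_box_indicator_Lp_space_2)
  have 2: "box_boundary_integral M p (\<lambda>x. k (u x) * normal_derivative (dual_box M p) u x * v p) =
      v p * flux p u" for p
    unfolding flux_def by (rule box_boundary_integral_mult_right)
  show ?thesis
    unfolding 1 2 lumped_inner_def[symmetric] total_def[symmetric]
    by (auto simp: nodal_rhs_def algebra_simps sum.distrib sum_distrib_left)
qed

text \<open>Allows a solution to be replaced by its expansion in the basis, which agrees with it on
  the closed domain only. The normal derivatives agree because the inward rays remain in
  triangles.\<close>

lemma nodal_rhs_cong:
  assumes u: "piecewise_affine u" and eq: "\<And>y. y \<in> closure \<Omega> \<Longrightarrow> u y = w y"
  shows "nodal_rhs p u = nodal_rhs p w"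
proof -
  have \<Omega>: "u y = w y" if "y \<in> \<Omega>" for y using eq that closure_subset by auto
  have "total u = total w"
    unfolding total_def by (rule Bochner_Integration.integral_cong) (auto simp: \<Omega> space_restrict_space)
  moreover have "load p u = load p w" unfolding load_def by (rule L2_inner_cong) (simp_all add: \<Omega>)
  moreover have "flux p u = flux p w"
  proof -
    have "indicator (frontier (dual_box M p)) x * (k (u x) * normal_derivative (dual_box M p) u x) =
      indicat_real (frontier (dual_box M p)) x * (k (w x) * normal_derivative (dual_box M p) w x)" for x
    proof (cases "x \<in> frontier (dual_box M p)")
      case True
      then have "x \<in> dual_box M p" using frontier_dual_box_subset by auto
      moreover from this have "x \<in> closure \<Omega>" using dual_box_subset by auto
      ultimately show ?thesis using normal_derivative_cong[OF u eq, of x p] eq[of x] by simp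
    qed simp
    then show ?thesis unfolding flux_def box_boundary_integral_def by (simp only:)
  qed
  ultimately show ?thesis by (simp add: nodal_rhs_def)
qed

section \<open>Dependence of the right-hand side on the coefficients\<close>

context
  fixes n :: nat and \<phi> :: "nat \<Rightarrow> real^2 \<Rightarrow> real"
  assumes \<phi>: "\<And>i. i < n \<Longrightarrow> \<phi> i \<in> fe_space \<Omega> M"
begin

definition combination :: "(nat \<Rightarrow> real) \<Rightarrow> real^2 \<Rightarrow> real" where
  "combination c x = (\<Sum>i<n. c i * \<phi> i x)"

lemma combination_fe_space: "combination c \<in> fe_space \<Omega> M"
  unfolding combination_def[abs_def] by (rule lumped.S_sum) (simp add: \<phi>)

lemma combination_piecewise_affine: "piecewise_affine (combination c)"
  by (rule fe_space_piecewise_affine[OF combination_fe_space])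

lemma \<phi>_piecewise_affine: "i < n \<Longrightarrow> piecewise_affine (\<phi> i)"
  by (rule fe_space_piecewise_affine[OF \<phi>])

lemma combination_loc_lipschitz: "uniformly_loc_lipschitz n (closure \<Omega>) combination"
proof -
  have "uniformly_loc_lipschitz n (closure \<Omega>) (\<lambda>c x. \<Sum>i<n. c i * \<phi> i x)"
  proof (intro uniformly_loc_lipschitz_sum uniformly_loc_lipschitz_mult uniformly_loc_lipschitz_coord)
    fix i assume "i \<in> {..<n}"
    then obtain B where "\<And>x. x \<in> closure \<Omega> \<Longrightarrow> \<bar>\<phi> i x\<bar> \<le> B"
      using piecewise_affine_bounded \<phi>_piecewise_affine by (metis lessThan_iff)
    then show "uniformly_loc_lipschitz n (closure \<Omega>) (\<lambda>c. \<phi> i)" by (rule uniformly_loc_lipschitz_const)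
  qed simp
  then show ?thesis by (simp add: combination_def[abs_def])
qed

lemma f_combination_loc_lipschitz: "uniformly_loc_lipschitz n \<Omega> (\<lambda>c x. f (combination c x))"
  by (intro uniformly_loc_lipschitz_compose[OF _ f_lipschitz]
      uniformly_loc_lipschitz_reparam[OF combination_loc_lipschitz, where y = "\<lambda>x. x"])
     (use closure_subset in auto)

lemma total_ge: "\<nu> * measure lebesgue \<Omega> \<le> total (combination c)"
proof -
  interpret finite_measure "lebesgue_on \<Omega>" by (rule finite_measure_domain)
  have "integrable (lebesgue_on \<Omega>) (\<lambda>x. f (combination c x) * 1)"
    by (intro Lp_space_2_integrable_mult f_compose_Lp_space_2 combination_piecewise_affine
        continuous_in_Lp_space_2 bounded_domain domain_lebesgue continuous_intros)
  then have "(\<integral>x. \<nu> \<partial>lebesgue_on \<Omega>) \<le> total (combination c)"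
    unfolding total_def by (intro integral_mono) (auto simp: f_ge)
  then show ?thesis
    using domain_lebesgue by (simp add: measure_restrict_space mult.commute)
qed

lemma measure_domain_pos: "measure lebesgue \<Omega> > 0"
proof -
  have "\<not> negligible \<Omega>" using open_not_negligible[OF open_domain domain_nonempty] .
  then have "measure lebesgue \<Omega> \<noteq> 0"
    using domain_lmeasurable negligible_iff_measure0 by blast
  then show ?thesis by (simp add: zero_less_measure_iff)
qed

text \<open>The lower bound \<nu> for f bounds the total from below for all coefficients at once, so
  the nonlocal factor is the inverse of a function with a uniform positive lower bound.\<close>

lemma load_loc_lipschitz:
  "uniformly_loc_lipschitz n A (\<lambda>c s. lam / (total (combination c))\<^sup>2 * load p (combination c))"
proof -
  note meas = f_compose_Lp_space_2[OF combination_piecewise_affine, unfolded Lp_space_2_iff, THEN conjunct1]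
  have total: "uniformly_loc_lipschitz n A (\<lambda>c s. total (combination c))"
    unfolding total_def
    by (rule uniformly_loc_lipschitz_integral[OF _ finite_measure_domain meas])
       (simp add: space_restrict_space f_combination_loc_lipschitz)
  define m where "m = \<nu> * measure lebesgue \<Omega>"
  have m: "m > 0" unfolding m_def using \<nu>_pos measure_domain_pos by simp
  have "uniformly_loc_lipschitz n A (\<lambda>c s. inverse (total (combination c) * total (combination c)))"
  proof (rule uniformly_loc_lipschitz_inverse[OF uniformly_loc_lipschitz_mult[OF total total]])
    show "m * m > 0" using m by simp
    show "m * m \<le> total (combination c) * total (combination c)" for c
      using m total_ge[of c] by (intro mult_mono) (auto simp: m_def)
  qed
  moreover have "uniformly_loc_lipschitz n A (\<lambda>c s. load p (combination c))"
    unfolding load_def L2_inner_def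
  proof (rule uniformly_loc_lipschitz_integral[OF _ finite_measure_domain])
    show "uniformly_loc_lipschitz n (space (lebesgue_on \<Omega>))
        (\<lambda>c x. f (combination c x) * indicat_real (dual_box M p) x)"
      by (intro uniformly_loc_lipschitz_mult uniformly_loc_lipschitz_const[of _ _ 1])
         (auto simp: space_restrict_space f_combination_loc_lipschitz indicator_def)
    show "(\<lambda>x. f (combination c x) * indicat_real (dual_box M p) x) \<in> borel_measurable (lebesgue_on \<Omega>)" for c
      by (intro borel_measurable_times meas dual_box_indicator_measurable)
  qed
  ultimately have "uniformly_loc_lipschitz n A (\<lambda>c s. lam *
      inverse (total (combination c) * total (combination c)) * load p (combination c))"
    by (intro uniformly_loc_lipschitz_mult uniformly_loc_lipschitz_const[of _ _ "\<bar>lam\<bar>"]) simp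
  then show ?thesis by (simp add: power2_eq_square divide_inverse)
qed

text \<open>The factor k(u) is Lipschitz and the normal derivative is linear in the coefficients;
  their product is estimated on bounded sets of coefficients.\<close>

lemma flux_integrand_loc_lipschitz:
  "uniformly_loc_lipschitz n A (\<lambda>c x. indicator (frontier (dual_box M p)) x *
     (k (combination c x) * normal_derivative (dual_box M p) (combination c) x))"
proof (intro uniformly_loc_lipschitz_indicator uniformly_loc_lipschitz_mult)
  let ?F = "frontier (dual_box M p)"
  show "uniformly_loc_lipschitz n ?F (\<lambda>c x. k (combination c x))"
    by (intro uniformly_loc_lipschitz_compose[OF _ k_lipschitz]
        uniformly_loc_lipschitz_reparam[OF combination_loc_lipschitz, where y = "\<lambda>x. x"])
       (use frontier_dual_box_subset dual_box_subset in blast)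
  have "uniformly_loc_lipschitz n ?F (\<lambda>c x. \<Sum>i<n. c i * normal_derivative (dual_box M p) (\<phi> i) x)"
  proof (intro uniformly_loc_lipschitz_sum uniformly_loc_lipschitz_mult uniformly_loc_lipschitz_coord)
    fix i assume "i \<in> {..<n}"
    then obtain K where "\<And>p x. x \<in> dual_box M p \<Longrightarrow> \<bar>normal_derivative (dual_box M p) (\<phi> i) x\<bar> \<le> K"
      using normal_derivative_bounded \<phi>_piecewise_affine by (metis lessThan_iff)
    then show "uniformly_loc_lipschitz n ?F (\<lambda>c. normal_derivative (dual_box M p) (\<phi> i))"
      using frontier_dual_box_subset by (intro uniformly_loc_lipschitz_const[of _ _ K]) blast
  qed simp
  then show "uniformly_loc_lipschitz n ?F (\<lambda>c. normal_derivative (dual_box M p) (combination c))"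
  proof (rule uniformly_loc_lipschitz_cong)
    fix c x assume "x \<in> ?F"
    then have "x \<in> dual_box M p" using frontier_dual_box_subset by blast
    then show "(\<Sum>i<n. c i * normal_derivative (dual_box M p) (\<phi> i) x) =
        normal_derivative (dual_box M p) (combination c) x"
      unfolding combination_def[abs_def] by (intro normal_derivative_sum[symmetric] \<phi>_piecewise_affine)
  qed
qed

lemma flux_integrand_borel_measurable:
  "(\<lambda>x. indicator (frontier (dual_box M p)) x *
     (k (combination c x) * normal_derivative (dual_box M p) (combination c) x)) \<in> borel_measurable borel"
proof -
  \<comment> \<open>The combination is cut off outside the closed domain to make it Borel; the
    indicator of the box boundary hides the change.\<close>
  have "(\<lambda>x. k (indicat_real (closure \<Omega>) x * combination c x)) \<in> borel_measurable borel"
    by (rule measurable_compose[OF piecewise_affine_borel_measurable[OF combination_piecewise_affine]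
          borel_measurable_continuous_onI[OF k_continuous]])
  then have "(\<lambda>x. k (indicat_real (closure \<Omega>) x * combination c x) *
      (indicat_real (frontier (dual_box M p)) x * normal_derivative (dual_box M p) (combination c) x))
      \<in> borel_measurable borel"
    by (intro borel_measurable_times normal_derivative_borel_measurable combination_piecewise_affine)
  also have "(\<lambda>x. k (indicat_real (closure \<Omega>) x * combination c x) *
      (indicat_real (frontier (dual_box M p)) x * normal_derivative (dual_box M p) (combination c) x)) =
      (\<lambda>x. indicator (frontier (dual_box M p)) x *
     (k (combination c x) * normal_derivative (dual_box M p) (combination c) x))"
  proof
    fix x
    have "x \<in> closure \<Omega>" if "x \<in> frontier (dual_box M p)"
      using that frontier_dual_box_subset dual_box_subset by blast
    then show "k (indicat_real (closure \<Omega>) x * combination c x) *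
      (indicat_real (frontier (dual_box M p)) x * normal_derivative (dual_box M p) (combination c) x) =
      indicator (frontier (dual_box M p)) x *
     (k (combination c x) * normal_derivative (dual_box M p) (combination c) x)"
      by (cases "x \<in> frontier (dual_box M p)") auto
  qed
  finally show ?thesis .
qed

text \<open>Each side is parametrised affinely over [0, 1], and the estimate, uniform over the
  plane, is inherited along this curve.\<close>

lemma flux_loc_lipschitz: "uniformly_loc_lipschitz n A (\<lambda>c s. flux p (combination c))"
  unfolding flux_def box_boundary_integral_def case_prod_beta
proof (intro uniformly_loc_lipschitz_sum uniformly_loc_lipschitz_mult)
  fix z :: "(real^2) \<times> (real^2)"
  show "uniformly_loc_lipschitz n A (\<lambda>c s. dist (fst z) (snd z))"
    by (rule uniformly_loc_lipschitz_const[of _ _ "dist (fst z) (snd z)"]) simp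
  let ?y = "\<lambda>s. fst z + s *\<^sub>R (snd z - fst z)"
  let ?g = "\<lambda>c x. indicator (frontier (dual_box M p)) x *
     (k (combination c x) * normal_derivative (dual_box M p) (combination c) x)"
  show "uniformly_loc_lipschitz n A (\<lambda>c s. \<integral>s. ?g c (?y s) \<partial>lebesgue_on {0..1})"
  proof (rule uniformly_loc_lipschitz_integral)
    show "uniformly_loc_lipschitz n (space (lebesgue_on {0..1})) (\<lambda>c s. ?g c (?y s))"
      by (rule uniformly_loc_lipschitz_reparam[OF flux_integrand_loc_lipschitz[of UNIV]]) simp
    show "finite_measure (lebesgue_on {0..1::real})"
      by (rule finite_measure_lebesgue_on) simp
    fix c
    have "(\<lambda>s. ?g c (?y s)) \<in> borel_measurable borel"
      by (rule measurable_compose[OF _ flux_integrand_borel_measurable])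
         (intro borel_measurable_continuous_onI continuous_intros)
    then have "(\<lambda>s. ?g c (?y s)) \<in> borel_measurable lebesgue"
      by (intro measurable_completion) simp
    then show "(\<lambda>s. ?g c (?y s)) \<in> borel_measurable (lebesgue_on {0..1})"
      by (rule measurable_restrict_space1)
  qed
qed

lemma nodal_rhs_loc_lipschitz: "uniformly_loc_lipschitz n A (\<lambda>c s. nodal_rhs p (combination c))"
  unfolding nodal_rhs_def by (intro uniformly_loc_lipschitz_add flux_loc_lipschitz load_loc_lipschitz)

end

text \<open>The lumped inner products with the basis functions serve as coordinates. Existence lifts
  a solution of the coordinate system back to the finite element space; for uniqueness, the
  coordinates of any solution of the scheme are shown to solve that system.\<close>

lemma fve_solution_locally_unique:
  assumes u0: "u0 \<in> Lp_space 2 \<Omega>"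
  shows "\<exists>t0>0. (\<exists>uh. fve_solution \<Omega> M lam f k u0 t0 uh) \<and>
    (\<forall>uh wh. fve_solution \<Omega> M lam f k u0 t0 uh \<and> fve_solution \<Omega> M lam f k u0 t0 wh
       \<longrightarrow> (\<forall>t\<in>{0..t0}. \<forall>x\<in>closure \<Omega>. uh t x = wh t x))"
proof -
  obtain n \<phi> where on: "lumped.orthonormal_family n \<phi>"
    and basis: "\<And>v p. v \<in> fe_space \<Omega> M \<Longrightarrow> p \<in> mesh_vertices M \<Longrightarrow>
      v p = (\<Sum>i<n. lumped_inner v (\<phi> i) * \<phi> i p)"
    using lumped.ex_orthonormal_basis by blast
  have \<phi>: "\<phi> i \<in> fe_space \<Omega> M" if "i < n" for i
    using on that by (simp add: lumped.orthonormal_family_def)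
  define comb where "comb = combination n \<phi>"
  have comb: "comb c x = (\<Sum>i<n. c i * \<phi> i x)" for c x
    by (simp add: comb_def combination_def[OF \<phi>])
  have comb_fe: "comb c \<in> fe_space \<Omega> M" for c
    unfolding comb_def by (rule combination_fe_space[OF \<phi>])
  have comb_pa: "piecewise_affine (comb c)" for c by (rule fe_space_piecewise_affine[OF comb_fe])
  \<comment> \<open>The expansion is exact at the vertices, and two piecewise affine functions with
    equal nodal values agree on the closed domain.\<close>
  have expand: "comb (\<lambda>i. lumped_inner v (\<phi> i)) x = v x" if "v \<in> fe_space \<Omega> M" "x \<in> closure \<Omega>" for v x
    by (rule piecewise_affine_eqI[OF comb_pa fe_space_piecewise_affine[OF that(1)] _ that(2)])
       (simp add: comb basis[OF that(1)])
  have comb_cong: "comb c x = comb d x" if "\<And>i. i < n \<Longrightarrow> c i = d i" for c d x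
    unfolding comb using that by (intro sum.cong) auto
  \<comment> \<open>The scheme tested with \<open>\<phi> i\<close>; orthonormality reduces the mass
    matrix to the identity, so this is the derivative of the i-th coordinate.\<close>
  define G where "G i c = (\<Sum>p\<in>mesh_vertices M. \<phi> i p * nodal_rhs p (comb c))" for i c
  have G_lip: "uniformly_loc_lipschitz n UNIV (\<lambda>c (s::unit). G i c)" for i
    unfolding G_def comb_def
    by (intro uniformly_loc_lipschitz_sum uniformly_loc_lipschitz_mult nodal_rhs_loc_lipschitz \<phi>)
       (rule uniformly_loc_lipschitz_const[OF order_refl])
  obtain w0 where w0: "is_L2_projection \<Omega> (fe_space \<Omega> M) u0 w0"
    using ex_L2_projection[OF u0] by blast
  define a where "a i = lumped_inner w0 (\<phi> i)" for i
  have w0_fe: "w0 \<in> fe_space \<Omega> M" using w0 by (simp add: is_L2_projection_def)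
  obtain t0 c where t0: "t0 > 0" and c0: "\<And>i. i < n \<Longrightarrow> c 0 i = a i"
    and c: "\<And>t i. t \<in> {0..t0} \<Longrightarrow> i < n \<Longrightarrow>
       ((\<lambda>t. c t i) has_real_derivative G i (c t)) (at t within {0..t0})"
    using ode_system_local_existence[of n G a, OF G_lip] by blast
  have "fve_solution \<Omega> M lam f k u0 t0 (\<lambda>t. comb (c t))"
    unfolding fve_solution_def
  proof (intro conjI ballI exI[of _ "\<lambda>t. comb (\<lambda>i. G i (c t))"])
    show "comb (c t) \<in> fe_space \<Omega> M" for t by (rule comb_fe)
    show "is_L2_projection \<Omega> (fe_space \<Omega> M) u0 (comb (c 0))"
    proof -
      \<comment> \<open>The expansion reproduces the projection on the closed domain only, which
        suffices because the defining inner products integrate over \<open>\<Omega>\<close>.\<close>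
      have "comb (c 0) x = w0 x" if "x \<in> closure \<Omega>" for x
        using expand[OF w0_fe that] comb_cong[of "c 0" a] c0 by (simp add: a_def[abs_def])
      then have "L2_inner \<Omega> (comb (c 0)) v = L2_inner \<Omega> w0 v" for v
        using closure_subset by (intro L2_inner_cong) auto
      then show ?thesis using w0 comb_fe by (simp add: is_L2_projection_def)
    qed
    fix t assume t: "t \<in> {0..t0}"
    show "((\<lambda>s. comb (c s) x) has_real_derivative comb (\<lambda>i. G i (c t)) x) (at t within {0..t0})" for x
      unfolding comb using c[OF t] by (intro DERIV_sum DERIV_cmult_right) auto
    fix v assume v: "v \<in> fe_space \<Omega> M"
    have "lumped_inner (comb (\<lambda>i. G i (c t))) v = (\<Sum>i<n. G i (c t) * lumped_inner (\<phi> i) v)"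
      unfolding comb[abs_def] by (rule lumped.Q_sum[OF _ v]) (simp add: \<phi>)
    also have "\<dots> = (\<Sum>i<n. \<Sum>p\<in>mesh_vertices M. lumped_inner v (\<phi> i) * \<phi> i p * nodal_rhs p (comb (c t)))"
      unfolding G_def sum_distrib_right using lumped.Q_sym[OF v \<phi>]
      by (intro sum.cong refl) (simp add: mult_ac)
    also have "\<dots> = (\<Sum>p\<in>mesh_vertices M. (\<Sum>i<n. lumped_inner v (\<phi> i) * \<phi> i p) * nodal_rhs p (comb (c t)))"
      unfolding sum_distrib_right by (rule sum.swap)
    also have "\<dots> = (\<Sum>p\<in>mesh_vertices M. v p * nodal_rhs p (comb (c t)))"
      by (intro sum.cong refl) (simp add: basis[OF v, symmetric])
    finally show "L2_inner \<Omega> (box_interpolation M (comb (\<lambda>i. G i (c t)))) (box_interpolation M v)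
       - (\<Sum>p\<in>mesh_vertices M. box_boundary_integral M p
            (\<lambda>x. k (comb (c t) x) * normal_derivative (dual_box M p) (comb (c t)) x * v p))
       = lam / (\<integral>x. f (comb (c t) x) \<partial>lebesgue_on \<Omega>)\<^sup>2 *
         L2_inner \<Omega> (\<lambda>x. f (comb (c t) x)) (box_interpolation M v)"
      by (subst scheme_iff[OF comb_pa])
  qed
  moreover have "uh t x = wh t x"
    if uh: "fve_solution \<Omega> M lam f k u0 t0 uh" and wh: "fve_solution \<Omega> M lam f k u0 t0 wh"
      and t: "t \<in> {0..t0}" and x: "x \<in> closure \<Omega>" for uh wh t x
  proof -
    have ode: "((\<lambda>t. lumped_inner (vh t) (\<phi> i)) has_real_derivative
        G i (\<lambda>j. lumped_inner (vh t) (\<phi> j))) (at t within {0..t0})"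
      if vh: "fve_solution \<Omega> M lam f k u0 t0 vh" and t: "t \<in> {0..t0}" and i: "i < n" for vh t i
    proof -
      have fe: "vh t \<in> fe_space \<Omega> M" using vh t by (simp add: fve_solution_def)
      note pa = fe_space_piecewise_affine[OF fe]
      obtain vt where vt: "\<And>t x. t \<in> {0..t0} \<Longrightarrow> x \<in> closure \<Omega> \<Longrightarrow>
           ((\<lambda>s. vh s x) has_real_derivative vt t x) (at t within {0..t0})"
        and eq: "\<And>t v. t \<in> {0..t0} \<Longrightarrow> v \<in> fe_space \<Omega> M \<Longrightarrow>
           L2_inner \<Omega> (box_interpolation M (vt t)) (box_interpolation M v)
           - (\<Sum>p\<in>mesh_vertices M. box_boundary_integral M p
                  (\<lambda>x. k (vh t x) * normal_derivative (dual_box M p) (vh t) x * v p))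
           = lam / (\<integral>x. f (vh t x) \<partial>lebesgue_on \<Omega>)\<^sup>2
             * L2_inner \<Omega> (\<lambda>x. f (vh t x)) (box_interpolation M v)"
        using vh unfolding fve_solution_def by blast
      \<comment> \<open>The derivative \<open>vt t\<close> is given only pointwise, without
        membership in the finite element space; differentiating the finite sum of nodal values gets
        by with that.\<close>
      have "((\<lambda>t. lumped_inner (vh t) (\<phi> i)) has_real_derivative lumped_inner (vt t) (\<phi> i))
          (at t within {0..t0})"
        unfolding lumped_inner_sum using mesh_vertices_subset
        by (intro DERIV_sum DERIV_cmult_right vt t) auto
      also have "lumped_inner (vt t) (\<phi> i) = (\<Sum>p\<in>mesh_vertices M. \<phi> i p * nodal_rhs p (vh t))"
        using eq[OF t \<phi>[OF i]] unfolding scheme_iff[OF pa] .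
      also have "\<dots> = G i (\<lambda>j. lumped_inner (vh t) (\<phi> j))"
        unfolding G_def
        by (intro sum.cong refl arg_cong[where f = "(*) _"] nodal_rhs_cong pa) (simp add: expand[OF fe])
      finally show ?thesis .
    qed
    have fe: "uh s \<in> fe_space \<Omega> M" "wh s \<in> fe_space \<Omega> M" if "s \<in> {0..t0}" for s
      using uh wh that by (simp_all add: fve_solution_def)
    have "uh 0 p = wh 0 p" if "p \<in> mesh_vertices M" for p
      using uh wh that by (intro L2_projection_unique[of u0]) (simp_all add: fve_solution_def)
    then have init: "lumped_inner (uh 0) (\<phi> i) = lumped_inner (wh 0) (\<phi> i)" for i
      unfolding lumped_inner_sum by (intro sum.cong) simp_all
    have "lumped_inner (uh t) (\<phi> i) = lumped_inner (wh t) (\<phi> i)" if "i < n" for i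
      by (rule ode_system_unique[where c = "\<lambda>t i. lumped_inner (uh t) (\<phi> i)" and
            d = "\<lambda>t i. lumped_inner (wh t) (\<phi> i)", OF G_lip ode[OF uh] ode[OF wh] init t that])
    then have "comb (\<lambda>i. lumped_inner (uh t) (\<phi> i)) x = comb (\<lambda>i. lumped_inner (wh t) (\<phi> i)) x"
      by (rule comb_cong)
    then show ?thesis unfolding expand[OF fe(1)[OF t] x] expand[OF fe(2)[OF t] x] .
  qed
  ultimately show ?thesis using t0 by blast
qed

end

theorem theorem1:
  fixes \<Omega> :: "(real^2) set"
    and T lam :: real
    and f k :: "real \<Rightarrow> real"
    and u0 :: "real^2 \<Rightarrow> real"
    and u ut :: "real \<Rightarrow> real^2 \<Rightarrow> real"
    and H :: "real set"
    and M :: "real \<Rightarrow> (real^2) set set"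
  assumes domain: "convex_polygonal_domain \<Omega>"
    and T_pos: "T > 0"
    and initial: "u0 \<in> Lp_space 2 \<Omega>"
    and meshes: "quasi_uniform_family \<Omega> H M"
    and circumcenters: "\<And>h. h \<in> H \<Longrightarrow> circumcenters_inside (M h)"
    and inverse: "inverse_estimates \<Omega> H M"
    and solution: "nonlocal_parabolic_solution \<Omega> T lam f k u0 u ut"
    and u_regular: "u \<in> bochner_space \<infinity> {0<..<T}
          (H10_space \<Omega> \<inter> sobolev_space 2 2 \<Omega>) (sobolev_norm 2 2 \<Omega>)"
    and ut_regular: "ut \<in> bochner_space 2 {0<..<T} (sobolev_space 1 2 \<Omega>) (sobolev_norm 1 2 \<Omega>)"
    and k_bounds: "\<exists>c>0. \<forall>s. inverse c \<le> k s \<and> k s \<le> c"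
    and f_bounds: "\<exists>c1>0. \<exists>c2>0. \<exists>\<nu>>0. \<forall>\<xi>. \<nu> \<le> f \<xi> \<and> f \<xi> \<le> c1 * \<bar>\<xi>\<bar> + c2"
    and lipschitz: "\<exists>c>0. \<forall>\<xi> \<xi>'. \<bar>f \<xi> - f \<xi>'\<bar> + \<bar>k \<xi> - k \<xi>'\<bar> \<le> c * \<bar>\<xi> - \<xi>'\<bar>"
  shows "\<forall>h\<in>H. \<exists>t0>0.
           (\<exists>uh. fve_solution \<Omega> (M h) lam f k u0 t0 uh) \<and>
           (\<forall>uh wh. fve_solution \<Omega> (M h) lam f k u0 t0 uh \<and> fve_solution \<Omega> (M h) lam f k u0 t0 wh
              \<longrightarrow> (\<forall>t\<in>{0..t0}. \<forall>x\<in>closure \<Omega>. uh t x = wh t x))"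
proof
  \<comment> \<open>The meshes are treated one at a time, so the length of the time interval may
    depend on h.\<close>
  fix h assume h: "h \<in> H"
  obtain c where c: "\<And>\<xi> \<xi>'. \<bar>f \<xi> - f \<xi>'\<bar> + \<bar>k \<xi> - k \<xi>'\<bar> \<le> c * \<bar>\<xi> - \<xi>'\<bar>"
    using lipschitz by blast
  obtain \<nu> where \<nu>: "\<nu> > 0" "\<And>\<xi>. \<nu> \<le> f \<xi>" using f_bounds by blast
  interpret fve_scheme \<Omega> "M h" lam f k c \<nu>
  proof
    show "convex_polygonal_domain \<Omega>" by (rule domain)
    show "triangulation_of \<Omega> (M h)" using meshes h by (simp add: quasi_uniform_family_def)
    show "circumcenters_inside (M h)" by (rule circumcenters[OF h])
    \<comment> \<open>Quasi-uniformity places a ball of radius d * h > 0 in every triangle, which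
      excludes degenerate ones.\<close>
    show "interior e \<noteq> {}" if e: "e \<in> M h" for e
    proof -
      obtain d x where "d > 0" "ball x (d * h) \<subseteq> e"
        using meshes h e unfolding quasi_uniform_family_def by blast
      moreover have "h > 0" using meshes h by (simp add: quasi_uniform_family_def)
      ultimately have "x \<in> interior e" by (intro interiorI[of "ball x (d * h)"]) auto
      then show ?thesis by blast
    qed
    show "\<bar>f x - f y\<bar> \<le> c * \<bar>x - y\<bar>" "\<bar>k x - k y\<bar> \<le> c * \<bar>x - y\<bar>" for x y
      using c[of x y] by linarith+
  qed (use \<nu> in auto)
  show "\<exists>t0>0. (\<exists>uh. fve_solution \<Omega> (M h) lam f k u0 t0 uh) \<and>
     (\<forall>uh wh. fve_solution \<Omega> (M h) lam f k u0 t0 uh \<and> fve_solution \<Omega> (M h) lam f k u0 t0 wh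
        \<longrightarrow> (\<forall>t\<in>{0..t0}. \<forall>x\<in>closure \<Omega>. uh t x = wh t x))"
    by (rule fve_solution_locally_unique[OF initial])
qed

end
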